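(* Let $\mathcal{E}_4$ be the elliptic curve over $\mathbb{Q}(t)$ given by $y^2=x^3+t^4+1$ and $\mathcal{L}_4=\mathcal{E}_4(\mathbb{C}(t))$ its Mordell--Weil lattice. Then $\mathcal{L}_4\cong\mathcal{E}_4(\mathcal{K}_4(t))$ has rank $r_4=6$, where the splitting field $\mathcal{K}_4$ is a number field of degree $16$ with defining minimal polynomial $$g_4(x)=x^{16}-8x^{15}+38x^{14}-120x^{13}+272x^{12}-436x^{11}+472x^{10}-264x^{9}-62x^{8}+216x^{7}-128x^{6}-8x^{5}+56x^{4}-48x^{3}+32x^{2}-16x+4,$$ and $\mathcal{K}_4$ contains $\mathbb{Q}(\zeta_{12},\alpha_1)$, where $\zeta_{12}=(\mathrm{i}+\sqrt3)/2$ and $\alpha_1=2^{1/4}3^{1/8}(\sqrt3-1)^{1/2}$. Moreover, with $\zeta_3=(\mathrm{i}\sqrt3-1)/2$ and $\zeta_6=(1+\mathrm{i}\sqrt3)/2$, the six points $$P_1=(-1,\ t^2),\qquad P_2=(-\zeta_3,\ t^2),$$ $$P_3=\Big(\alpha_1t+(\sqrt3-1),\ t^2+\tfrac{\alpha_1^3}{2}t+\tfrac{\sqrt3\,\alpha_1^2}{2}\Big),$$ $$P_4=\Big(\zeta_{12}\alpha_1t+\zeta_3(\sqrt3-1),\ t^2+\tfrac{\mathrm{i}\,\alpha_1^3}{2}t-\tfrac{\sqrt3\,\alpha_1^2}{2}\Big),$$ $$P_5=\Big(\zeta_6\alpha_1t+\zeta_3^2(\sqrt3-1),\ t^2-\tfrac{\alpha_1^3}{2}t+\tfrac{\sqrt3\,\alpha_1^2}{2}\Big),$$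 $$P_6=\Big(\mathrm{i}\,\alpha_1t+(\sqrt3-1),\ t^2-\tfrac{\mathrm{i}\,\alpha_1^3}{2}t-\tfrac{\sqrt3\,\alpha_1^2}{2}\Big)$$ form a set of linearly independent generators of $\mathcal{E}_4(\mathcal{K}_4(t))$.
   Context: The Mordell--Weil lattice of $\mathcal{E}$ over $\mathbb{Q}(t)$ is the group $\mathcal{E}(\mathbb{C}(t))$ (modulo torsion) with the Shioda height pairing; its rank is the Mordell--Weil rank. The splitting field is the smallest subfield $\mathcal{K}\subset\mathbb{C}$ such that $\mathcal{E}(\mathcal{K}(t))=\mathcal{E}(\mathbb{C}(t))$. A defining minimal polynomial of a number field $K$ is an irreducible $g\in\mathbb{Q}[x]$ with $K\cong\mathbb{Q}[x]/(g)$. "Linearly independent generators" means the points are linearly independent in the lattice and generate it. *)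

theory Defs
  imports
    Complex_Main
    "HOL-Library.Extended_Nat"
    "HOL-Computational_Algebra.Computational_Algebra"
    "HOL-Algebra.Algebra"
    "HOL-Algebra.Algebraic_Closure_Type"
begin

datatype 'k ec_point = PtInf | Pt 'k 'k

definition on_curve :: "'k::field \<Rightarrow> 'k \<Rightarrow> 'k ec_point \<Rightarrow> bool" where
  "on_curve a b P = (case P of PtInf \<Rightarrow> True | Pt x y \<Rightarrow> y ^ 2 = x ^ 3 + a * x + b)"

definition ec_neg :: "'k::field ec_point \<Rightarrow> 'k ec_point" where
  "ec_neg P = (case P of PtInf \<Rightarrow> PtInf | Pt x y \<Rightarrow> Pt x (- y))"

definition line_point :: "'k::field \<Rightarrow> 'k \<Rightarrow> 'k \<Rightarrow> 'k \<Rightarrow> 'k ec_point" where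
  "line_point l x1 y1 x2 = (let x3 = l ^ 2 - x1 - x2 in Pt x3 (l * (x1 - x3) - y1))"

text \<open>Chord-and-tangent addition on \<open>y\<^sup>2 = x\<^sup>3 + a x + b\<close> (characteristic different from 2).
  In the tangent case both points lie on the curve and \<open>y2 \<noteq> - y1\<close>, so the two points
  coincide and \<open>y1 \<noteq> 0\<close>.\<close>

fun ec_add :: "'k::field \<Rightarrow> 'k ec_point \<Rightarrow> 'k ec_point \<Rightarrow> 'k ec_point" where
  "ec_add a PtInf Q = Q"
| "ec_add a P PtInf = P"
| "ec_add a (Pt x1 y1) (Pt x2 y2) =
     (if x1 \<noteq> x2 then line_point ((y2 - y1) / (x2 - x1)) x1 y1 x2
      else if y2 = - y1 then PtInf
      else line_point ((3 * x1 ^ 2 + a) / (2 * y1)) x1 y1 x2)"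

type_synonym ratfun = "complex poly fract"

abbreviation complex_ring :: "complex ring" where
  "complex_ring \<equiv> ring_of_type_algebra"

abbreviation of_poly :: "complex poly \<Rightarrow> ratfun" where
  "of_poly p \<equiv> Fraction_Field.Fract p 1"

definition ratfuns_over :: "complex set \<Rightarrow> ratfun set" where
  "ratfuns_over K = {of_poly p / of_poly q | p q.
     set (Polynomial.coeffs p) \<subseteq> K \<and> set (Polynomial.coeffs q) \<subseteq> K \<and> q \<noteq> 0}"

record 'a paired_group = "'a monoid" +
  pairing :: "'a \<Rightarrow> 'a \<Rightarrow> rat"

definition lattice_isomorphic ::
    "'a paired_group \<Rightarrow> 'b paired_group \<Rightarrow> bool" where
  "lattice_isomorphic G H \<longleftrightarrow>
     (\<exists>\<phi>\<in>iso G H. \<forall>x\<in>carrier G. \<forall>y\<in>carrier G. pairing H (\<phi> x) (\<phi> y) = pairing G x y)"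

definition torsion :: "('a, 'b) monoid_scheme \<Rightarrow> 'a set" where
  "torsion G = {x \<in> carrier G. \<exists>n::nat. n > 0 \<and> x [^]\<^bsub>G\<^esub> n = \<one>\<^bsub>G\<^esub>}"

text \<open>Linear independence over the integers of the images in the quotient by the torsion
  subgroup.\<close>

definition lin_indep :: "('a, 'b) monoid_scheme \<Rightarrow> 'a set \<Rightarrow> bool" where
  "lin_indep G S \<longleftrightarrow> finite S \<and> S \<subseteq> carrier G \<and>
     (\<forall>n :: 'a \<Rightarrow> int. finprod G (\<lambda>x. x [^]\<^bsub>G\<^esub> n x) S \<in> torsion G \<longrightarrow> (\<forall>x\<in>S. n x = 0))"

definition ab_rank :: "('a, 'b) monoid_scheme \<Rightarrow> enat" where
  "ab_rank G = (SUP S \<in> {S. lin_indep G S}. enat (card S))"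

definition lin_indep_generators :: "('a, 'b) monoid_scheme \<Rightarrow> 'a list \<Rightarrow> bool" where
  "lin_indep_generators G Ps \<longleftrightarrow>
     distinct Ps \<and> lin_indep G (set Ps) \<and> generate G (set Ps) = carrier G"

definition b4 :: ratfun where
  "b4 = of_poly [:1, 0, 0, 0, 1:]"

text \<open>
  The Shioda height pairing is
  \<open>\<langle>P,Q\<rangle> = \<chi> + (P.O) + (Q.O) - (P.Q) - \<Sum>\<^sub>v contr\<^sub>v(P,Q)\<close>, computed on the minimal elliptic
  surface over the projective line. Here that surface is rational, so \<open>\<chi> = 1\<close> and every section
  has self-intersection \<open>-1\<close>. With \<open>s = 1/t\<close>, \<open>x' = s\<^sup>2 x\<close>, \<open>y' = s\<^sup>3 y\<close>, the minimal
  Weierstrass model at infinity is \<open>y'\<^sup>2 = x'\<^sup>3 + s\<^sup>2 (1 + s\<^sup>4)\<close>. The singular fibres are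
  of type II at the four roots of \<open>t\<^sup>4 + 1\<close> and of type IV at infinity, so only infinity
  contributes.
\<close>

text \<open>The intersection number of P with the zero section O: half the total pole order of x
  (of x' at infinity) if P is not O.\<close>

definition zero_inter :: "ratfun ec_point \<Rightarrow> rat" where
  "zero_inter P = (case P of PtInf \<Rightarrow> - 1
    | Pt x y \<Rightarrow> (let m = of_nat (Polynomial.degree (fst (quot_of_fract x)));
                   n = of_nat (Polynomial.degree (snd (quot_of_fract x)))
               in (n + max 0 (m - n - 2)) / 2))"

text \<open>The intersection number \<open>(P.Q)\<close> is that of \<open>P - Q\<close> with O, since translation by a
  section is an automorphism of the surface.\<close>

definition section_inter :: "ratfun ec_point \<Rightarrow> ratfun ec_point \<Rightarrow> rat" where
  "section_inter P Q = zero_inter (ec_add 0 P (ec_neg Q))"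

text \<open>The component of the fibre at infinity that P meets. P misses the identity component
  iff it passes through the singular point \<open>x' = y' = 0\<close> over \<open>s = 0\<close>, that is iff x has
  degree less than 2. Then \<open>y'/s\<close> takes one of the values \<open>1\<close>, \<open>-1\<close> at \<open>s = 0\<close>, namely the
  leading coefficient of y, and this value tells the two other components apart. The value
  \<open>0\<close> encodes the identity component.\<close>

definition fibre_comp :: "ratfun ec_point \<Rightarrow> complex" where
  "fibre_comp P = (case P of PtInf \<Rightarrow> 0
    | Pt x y \<Rightarrow>
        (if Polynomial.degree (fst (quot_of_fract x)) \<ge>
            Polynomial.degree (snd (quot_of_fract x)) + 2
         then 0
         else Polynomial.lead_coeff (fst (quot_of_fract y)) /
              Polynomial.lead_coeff (snd (quot_of_fract y))))"

definition contr_inf :: "ratfun ec_point \<Rightarrow> ratfun ec_point \<Rightarrow> rat" where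
  "contr_inf P Q = (if fibre_comp P = 0 \<or> fibre_comp Q = 0 then 0
                    else if fibre_comp P = fibre_comp Q then 2 / 3 else 1 / 3)"

definition height_pairing :: "ratfun ec_point \<Rightarrow> ratfun ec_point \<Rightarrow> rat" where
  "height_pairing P Q =
     1 + zero_inter P + zero_inter Q - section_inter P Q - contr_inf P Q"

definition E4 :: "complex set \<Rightarrow> ratfun ec_point paired_group" where
  "E4 K = \<lparr> carrier = {P. on_curve 0 b4 P \<and> set_ec_point P \<subseteq> ratfuns_over K},
            monoid.mult = ec_add 0,
            one = PtInf,
            pairing = height_pairing \<rparr>"

text \<open>The Mordell-Weil lattice: \<open>\<complex>(t)\<close>-rational points modulo torsion. The height pairing
  does not depend on the representatives chosen in the two cosets.\<close>

definition L4 :: "ratfun ec_point set paired_group" where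
  "L4 = (let G = E4 UNIV; Q = G Mod torsion G in
     \<lparr> carrier = carrier Q, monoid.mult = monoid.mult Q, one = one Q,
       pairing = (\<lambda>U V. height_pairing (SOME P. P \<in> U) (SOME P. P \<in> V)) \<rparr>)"

definition is_splitting_field :: "complex set \<Rightarrow> bool" where
  "is_splitting_field K \<longleftrightarrow>
     subfield K complex_ring \<and> carrier (E4 K) = carrier (E4 UNIV) \<and>
     (\<forall>F. subfield F complex_ring \<and> carrier (E4 F) = carrier (E4 UNIV) \<longrightarrow> K \<subseteq> F)"

definition has_degree_over_rat :: "complex set \<Rightarrow> nat \<Rightarrow> bool" where
  "has_degree_over_rat K n \<longleftrightarrow> ring.dimension complex_ring n \<rat> K"

definition defining_min_poly :: "complex set \<Rightarrow> rat poly \<Rightarrow> bool" where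
  "defining_min_poly K g \<longleftrightarrow> Factorial_Ring.irreducible g \<and>
     (ring_of_type_algebra :: rat poly ring) Quot (PIdl\<^bsub>ring_of_type_algebra\<^esub> g)
       \<simeq> complex_ring \<lparr> carrier := K \<rparr>"

definition g4 :: "rat poly" where
  "g4 = [:4, -16, 32, -48, 56, -8, -128, 216, -62, -264, 472, -436, 272, -120, 38, -8, 1:]"

abbreviation sqrt3 :: complex where
  "sqrt3 \<equiv> complex_of_real (sqrt 3)"

definition zeta12 :: complex where "zeta12 = (\<i> + sqrt3) / 2"
definition zeta3 :: complex where "zeta3 = (\<i> * sqrt3 - 1) / 2"
definition zeta6 :: complex where "zeta6 = (1 + \<i> * sqrt3) / 2"

definition alpha1 :: complex where
  "alpha1 = complex_of_real (2 powr (1/4) * 3 powr (1/8) * (sqrt 3 - 1) powr (1/2))"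

definition P1 :: "ratfun ec_point" where
  "P1 = Pt (of_poly [:-1:]) (of_poly [:0, 0, 1:])"

definition P2 :: "ratfun ec_point" where
  "P2 = Pt (of_poly [:- zeta3:]) (of_poly [:0, 0, 1:])"

definition P3 :: "ratfun ec_point" where
  "P3 = Pt (of_poly [:sqrt3 - 1, alpha1:])
           (of_poly [:sqrt3 * alpha1 ^ 2 / 2, alpha1 ^ 3 / 2, 1:])"

definition P4 :: "ratfun ec_point" where
  "P4 = Pt (of_poly [:zeta3 * (sqrt3 - 1), zeta12 * alpha1:])
           (of_poly [:- (sqrt3 * alpha1 ^ 2 / 2), \<i> * alpha1 ^ 3 / 2, 1:])"

definition P5 :: "ratfun ec_point" where
  "P5 = Pt (of_poly [:zeta3 ^ 2 * (sqrt3 - 1), zeta6 * alpha1:])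
           (of_poly [:sqrt3 * alpha1 ^ 2 / 2, - (alpha1 ^ 3 / 2), 1:])"

definition P6 :: "ratfun ec_point" where
  "P6 = Pt (of_poly [:sqrt3 - 1, \<i> * alpha1:])
           (of_poly [:- (sqrt3 * alpha1 ^ 2 / 2), - (\<i> * alpha1 ^ 3 / 2), 1:])"

end

theory Submission
  imports Defs
begin

text \<open>After a linear change of coordinates the curve becomes a cubic surface, and its sections
  \<open>C\<^sub>e\<close> (\<open>e\<^sup>3 = 1\<close>) and \<open>A\<^sub>e\<close> (\<open>e\<^sup>1\<^sup>2 = 1\<close>) given by lines on that surface sum to zero when they are coplanar.
  The six points are among these lines and generate all of them.

  The lines generate the Mordell-Weil group: the surface is rational, with coordinates that are
  quotients of linear forms whose zeros are lines of this kind. For a point \<open>P\<close>, the functions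
  \<open>x - x(P)\<close> and \<open>y - y(P)\<close> become polynomials in two variables up to functions whose divisors
  consist of lines. An irreducible factor of the first polynomial that vanishes at \<open>P\<close> divides
  the second one, because two coprime polynomials have only constant common zeros. Hence it does
  not vanish at \<open>-P\<close>, and its divisor is \<open>P\<close> plus lines. Since a principal divisor sums to zero,
  \<open>P\<close> is a combination of lines.

  Independence: the automorphisms \<open>x \<mapsto> \<zeta>\<^sub>3 x\<close> and \<open>t \<mapsto> i t\<close> reduce a relation over the Eisenstein
  integers to multiples of two single points. These have infinite order because doubling divides
  the value of \<open>x\<close> at a root of \<open>t\<^sup>4 + 1\<close> by 4.

  The coordinates of the generators generate \<open>Q(i, alpha1)\<close>. It contains a root of \<open>g4\<close>, which is
  irreducible by its Newton polygon at 2.\<close>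

section \<open>The affine coordinate ring and its divisors\<close>

text \<open>All divisors live on the affine curve over \<open>ratfun\<close>, are effective and
  consist of rational points; infinity enters only through degrees. A pair P, -P is cut out by a
  vertical line, so subtracting a divisor means adding its negative, and even associativity follows
  from uniqueness of the point that completes a divisor to a principal one. The surface reappears
  when t stops being a constant: p and q are the pencils of planes through two skew lines,
  \<open>CP 1\<close> and \<open>AP (zeta3 ^ 2)\<close>. Planes with given p and q meet in a line
  crossing both, which has one further point on the surface, so x, u and s are rational in p and q.
  The obstacle is their common denominator, whose divisor must consist of lines too. For this
  \<open>Pi0\<close> is chosen: it cuts the surface in three lines, on which p, q and p q
  respectively are constant. Generation is proved for every subgroup containing the lines, hence
  serves as an induction rule: for 1 + om + om^2 = 0, for the span of the six points and for
  rationality over \<open>K4\<close>. For independence, t -> it has square 1 on \<open>CC 1\<close>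
  but -1 on \<open>AA 1 - AA (-1)\<close>, and -1 is not a square in Q(zeta3).\<close>

instance fract :: ("{idom,ring_char_0}") ring_char_0
proof
  show "inj (of_nat :: nat \<Rightarrow> 'a fract)"
    by (rule injI) (simp add: of_nat_fract eq_fract)
qed

instance fract :: ("{idom,ring_char_0}") field_char_0 ..

text \<open>\<open>b4\<close> has a simple zero at a primitive 8th root of unity, whereas the order
  of a cube is a multiple of 3. Hence no rational point has y = 0, and opposite points are always
  distinct.\<close>

lemma ratfun_cube_ne:
  fixes x :: ratfun
  shows "x ^ 3 + b4 \<noteq> 0"
proof
  assume h: "x ^ 3 + b4 = 0"
  obtain n d where x: "x = Fract n d" and d: "d \<noteq> 0" by (cases x) auto
  define t0 :: complex where "t0 = csqrt \<i>"
  have t2: "t0 ^ 2 = \<i>" unfolding t0_def by (rule power2_csqrt)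
  have t4: "t0 ^ 4 = -1" using t2 by (simp add: power4_eq_xxxx power2_eq_square flip: mult.assoc) (simp add: mult.assoc)
  define c :: "complex poly" where "c = [:1, 0, 0, 0, 1:]"
  have c0: "c \<noteq> 0" by (simp add: c_def)
  have r: "poly c t0 = 0" using t4 by (simp add: c_def power4_eq_xxxx mult.assoc)
  have tn: "t0 \<noteq> 0" using t4 by auto
  have p: "poly (pderiv c) t0 \<noteq> 0" using tn by (simp add: c_def pderiv_pCons)
  have "order t0 c = Suc (order t0 (pderiv c))"
    using c0 r by (rule order_pderiv)
  then have oc: "order t0 c = 1" using p by (simp add: order_0I)
  have e: "n ^ 3 = - (c * d ^ 3)"
    using h d unfolding x b4_def c_def[symmetric]
    by (simp add: power3_eq_cube Zero_fract_def eq_fract eq_neg_iff_add_eq_0)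
  have "c * d ^ 3 \<noteq> 0" using c0 d by simp
  then have n0: "n \<noteq> 0" using e by auto
  have "order t0 (n ^ 3) = 3 * order t0 n"
    using n0 by (simp add: power3_eq_cube order_mult)
  moreover have "order t0 (- (c * d ^ 3)) = 1 + 3 * order t0 d"
    using c0 d oc by (simp add: power3_eq_cube order_mult)
  ultimately have "3 * order t0 n = 1 + 3 * order t0 d" using e by simp
  then show False by presburger
qed

text \<open>\<open>Cfn a b\<close> stands for the function \<open>a(x) + b(x) y\<close> on the affine curve over \<open>\<complex>(t)\<close>.\<close>

datatype cfn = Cfn (fre: "ratfun poly") (fim: "ratfun poly")

definition fcub :: "ratfun poly" where "fcub = [:b4, 0, 0, 1:]"

lemma degree_fcub [simp]: "degree fcub = 3" by (simp add: fcub_def)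
lemma fcub_ne0 [simp]: "fcub \<noteq> 0" by (simp add: fcub_def)

instantiation cfn :: comm_ring_1
begin
definition zero_cfn where "0 = Cfn 0 0"
definition one_cfn where "1 = Cfn 1 0"
definition plus_cfn where "g + h = Cfn (fre g + fre h) (fim g + fim h)"
definition minus_cfn where "g - h = Cfn (fre g - fre h) (fim g - fim h)"
definition uminus_cfn where "- g = Cfn (- fre g) (- fim g)"
definition times_cfn where
  "g * h = Cfn (fre g * fre h + fcub * (fim g * fim h)) (fre g * fim h + fim g * fre h)"
instance
  by standard
    (simp_all add: zero_cfn_def one_cfn_def plus_cfn_def minus_cfn_def uminus_cfn_def
      times_cfn_def algebra_simps cfn.expand)
end

lemma cfn_sel [simp]:
  "fre 0 = 0" "fim 0 = 0" "fre 1 = 1" "fim 1 = 0"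
  "fre (g + h) = fre g + fre h" "fim (g + h) = fim g + fim h"
  "fre (g - h) = fre g - fre h" "fim (g - h) = fim g - fim h"
  "fre (- g) = - fre g" "fim (- g) = - fim g"
  "fre (g * h) = fre g * fre h + fcub * (fim g * fim h)"
  "fim (g * h) = fre g * fim h + fim g * fre h"
  by (simp_all add: zero_cfn_def one_cfn_def plus_cfn_def minus_cfn_def uminus_cfn_def times_cfn_def)

definition nrm :: "cfn \<Rightarrow> ratfun poly" where "nrm g = fre g ^ 2 - fcub * fim g ^ 2"
definition cfn_conj :: "cfn \<Rightarrow> cfn" where "cfn_conj g = Cfn (fre g) (- fim g)"

lemma nrm_mult: "nrm (g * h) = nrm g * nrm h"
  by (simp add: nrm_def power2_eq_square algebra_simps)

lemma nrm_conj [simp]: "nrm (cfn_conj g) = nrm g" by (simp add: nrm_def cfn_conj_def)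
lemma cfn_conj_sel [simp]: "fre (cfn_conj g) = fre g" "fim (cfn_conj g) = - fim g" by (simp_all add: cfn_conj_def)
lemma mult_conj: "g * cfn_conj g = Cfn (nrm g) 0"
  by (rule cfn.expand) (simp add: nrm_def power2_eq_square algebra_simps)

text \<open>The two terms of the norm have degrees of different parity, so their leading terms
  cannot cancel. The degree is the pole order at infinity, where x has a pole of order 2 and y one
  of order 3.\<close>

lemma degree_nrm:
  shows "degree (nrm g) = (if fim g = 0 then 2 * degree (fre g)
    else max (2 * degree (fre g)) (2 * degree (fim g) + 3))"
proof (cases "fim g = 0")
  case True
  then show ?thesis by (cases "fre g = 0") (simp_all add: nrm_def degree_power_eq)
next
  case False
  have a: "degree (fre g ^ 2) = 2 * degree (fre g)"
    by (cases "fre g = 0") (simp_all add: degree_power_eq)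
  have b: "degree (fcub * fim g ^ 2) = 2 * degree (fim g) + 3"
    using False by (simp add: degree_mult_eq degree_power_eq)
  have "degree (fre g ^ 2) < degree (fcub * fim g ^ 2) \<or>
        degree (fcub * fim g ^ 2) < degree (fre g ^ 2)"
    unfolding a b by presburger
  then show ?thesis
  proof
    assume l: "degree (fre g ^ 2) < degree (fcub * fim g ^ 2)"
    then have "degree (nrm g) = degree (fcub * fim g ^ 2)"
      unfolding nrm_def by (metis degree_add_eq_right degree_minus diff_conv_add_uminus)
    then show ?thesis using False l unfolding a b by simp
  next
    assume l: "degree (fcub * fim g ^ 2) < degree (fre g ^ 2)"
    then have "degree (nrm g) = degree (fre g ^ 2)"
      unfolding nrm_def by (metis degree_add_eq_left degree_minus diff_conv_add_uminus)
    then show ?thesis using False l unfolding a b by simp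
  qed
qed

text \<open>No function has just a simple pole at infinity. This is where positive genus enters, and
  it is the source of uniqueness in the group law.\<close>

lemma degree_nrm_ne_1: "degree (nrm g) \<noteq> 1"
  unfolding degree_nrm by auto

lemma nrm_eq_0_iff [simp]: "nrm g = 0 \<longleftrightarrow> g = 0"
proof
  assume h: "nrm g = 0"
  then have "fim g = 0" using degree_nrm[of g] by (auto split: if_splits)
  moreover from this have "fre g = 0" using h by (simp add: nrm_def)
  ultimately show "g = 0" by (simp add: cfn.expand)
qed (simp add: nrm_def)

instance cfn :: idom
proof
  fix a b :: cfn
  assume "a \<noteq> 0" "b \<noteq> 0"
  then have "nrm (a * b) \<noteq> 0" by (simp add: nrm_mult)
  then show "a * b \<noteq> 0" by simp
qed


definition px :: "ratfun ec_point \<Rightarrow> ratfun" where "px P = (case P of PtInf \<Rightarrow> 0 | Pt x y \<Rightarrow> x)"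
definition py :: "ratfun ec_point \<Rightarrow> ratfun" where "py P = (case P of PtInf \<Rightarrow> 0 | Pt x y \<Rightarrow> y)"
lemma pxy [simp]: "px (Pt x y) = x" "py (Pt x y) = y" by (simp_all add: px_def py_def)

definition aff :: "ratfun ec_point set" where
  "aff = {P. P \<noteq> PtInf \<and> on_curve 0 b4 P}"

lemma affE:
  assumes "P \<in> aff"
  shows "P = Pt (px P) (py P)" "py P ^ 2 = px P ^ 3 + b4" "py P \<noteq> 0"
proof -
  show 1: "P = Pt (px P) (py P)" and 2: "py P ^ 2 = px P ^ 3 + b4"
    using assms by (cases P; auto simp: aff_def on_curve_def)+
  show "py P \<noteq> 0" using 2 ratfun_cube_ne[of "px P"] by auto
qed

lemma aff_Pt: "Pt x y \<in> aff \<longleftrightarrow> y ^ 2 = x ^ 3 + b4"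
  by (auto simp: aff_def on_curve_def)

lemma ec_neg_simps [simp]: "ec_neg PtInf = PtInf" "ec_neg (Pt x y) = Pt x (- y)"
  "ec_neg (ec_neg P) = P"
  by (simp_all add: ec_neg_def split: ec_point.splits)

lemma aff_neg [simp]: "ec_neg P \<in> aff \<longleftrightarrow> P \<in> aff"
  by (cases P) (auto simp: aff_def on_curve_def)

lemma px_neg [simp]: "px (ec_neg P) = px P" by (cases P) (auto simp: px_def)
lemma py_neg [simp]: "py (ec_neg P) = - py P" by (cases P) (auto simp: py_def)

lemma aff_eq_iff: "P \<in> aff \<Longrightarrow> Q \<in> aff \<Longrightarrow> P = Q \<longleftrightarrow> px P = px Q \<and> py P = py Q"
  by (metis affE(1))

lemma aff_px_eq: "P \<in> aff \<Longrightarrow> Q \<in> aff \<Longrightarrow> px P = px Q \<Longrightarrow> Q = P \<or> Q = ec_neg P"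
  by (metis affE(2) aff_eq_iff aff_neg power2_eq_iff px_neg py_neg)

lemma neg_ne: "P \<in> aff \<Longrightarrow> ec_neg P \<noteq> P"
proof
  assume P: "P \<in> aff" and "ec_neg P = P"
  then have "- py P = py P" by (metis py_neg)
  then have "2 * py P = 0" by (metis add.left_inverse mult_2)
  then show False using affE(3)[OF P] by simp
qed

text \<open>Expansion in the local parameter \<open>X - px P\<close>, which is a uniformizer at every affine
  point because no point of the curve has \<open>y = 0\<close>.\<close>

definition shp :: "ratfun \<Rightarrow> ratfun poly \<Rightarrow> ratfun fps" where
  "shp c p = fps_of_poly (pcompose p [:c, 1:])"

lemma shp_simps [simp]:
  "shp c (p * q) = shp c p * shp c q" "shp c (p + q) = shp c p + shp c q"
  "shp c (p - q) = shp c p - shp c q" "shp c (- p) = - shp c p" "shp c 0 = 0" "shp c 1 = 1"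
  "shp c p $ 0 = poly p c"
  by (simp_all add: shp_def pcompose_mult pcompose_add pcompose_diff pcompose_uminus
     fps_of_poly_mult fps_of_poly_add fps_of_poly_diff fps_of_poly_uminus
     pcompose_1 pcompose_coeff_0)

lemma shp_power [simp]: "shp c (p ^ n) = shp c p ^ n"
  by (induction n) simp_all

lemma subdegree_shp:
  assumes "p \<noteq> 0" shows "subdegree (shp c p) = order c p"
proof -
  obtain q where q: "p = [:- c, 1:] ^ order c p * q" "\<not> [:- c, 1:] dvd q"
    using order_decomp[OF assms] by blast
  have "shp c [:- c, 1:] = fps_X" by (simp add: shp_def pcompose_pCons fps_of_poly_linear)
  then have e: "shp c p = fps_X ^ order c p * shp c q"
    by (subst q(1)) simp
  have "poly q c \<noteq> 0" using q(2) by (simp add: dvd_iff_poly_eq_0)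
  then have "subdegree (shp c q) = 0" by simp
  moreover have "shp c q \<noteq> 0" using \<open>poly q c \<noteq> 0\<close> by (metis shp_simps(7) fps_zero_nth)
  ultimately show ?thesis unfolding e by simp
qed

text \<open>The expansion of y at P; the constant term \<open>py P\<close>, which is nonzero,
  selects the branch of the square root.\<close>

definition ysr :: "ratfun ec_point \<Rightarrow> ratfun fps" where
  "ysr P = fps_radical (\<lambda>_ _. py P) 2 (shp (px P) fcub)"

lemma ysr:
  assumes "P \<in> aff"
  shows "ysr P ^ 2 = shp (px P) fcub" "ysr P $ 0 = py P"
proof -
  have e: "poly fcub (px P) = py P ^ 2"
    using affE(2)[OF assms] by (simp add: fcub_def power3_eq_cube algebra_simps)
  show "ysr P ^ 2 = shp (px P) fcub"
    using power_radical[of "shp (px P) fcub" "\<lambda>_ _. py P" 1] e affE(3)[OF assms]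
    by (simp add: ysr_def numeral_2_eq_2)
  show "ysr P $ 0 = py P" by (simp add: ysr_def)
qed

lemma ysr_neg: assumes "P \<in> aff" shows "ysr (ec_neg P) = - ysr P"
proof -
  have "ysr (ec_neg P) ^ 2 = ysr P ^ 2" using ysr[OF assms] ysr[of "ec_neg P"] assms by simp
  then have "ysr (ec_neg P) = ysr P \<or> ysr (ec_neg P) = - ysr P" by (simp add: power2_eq_iff)
  moreover have "ysr (ec_neg P) \<noteq> ysr P"
  proof
    assume "ysr (ec_neg P) = ysr P"
    then have "- py P = py P" using ysr(2)[OF assms] ysr(2)[of "ec_neg P"] assms by simp
    then have "2 * py P = 0" by (metis add.left_inverse mult_2)
    then show False using affE(3)[OF assms] by simp
  qed
  ultimately show ?thesis by blast
qed

definition expn :: "ratfun ec_point \<Rightarrow> cfn \<Rightarrow> ratfun fps" where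
  "expn P g = shp (px P) (fre g) + shp (px P) (fim g) * ysr P"

definition ev :: "ratfun ec_point \<Rightarrow> cfn \<Rightarrow> ratfun" where
  "ev P g = poly (fre g) (px P) + poly (fim g) (px P) * py P"

lemma expn_mult: assumes "P \<in> aff" shows "expn P (g * h) = expn P g * expn P h"
proof -
  have "expn P g * expn P h = shp (px P) (fre g * fre h) +
     shp (px P) (fim g * fim h) * ysr P ^ 2 + shp (px P) (fre g * fim h + fim g * fre h) * ysr P"
    by (simp add: expn_def power2_eq_square algebra_simps)
  then show ?thesis by (simp only: ysr(1)[OF assms] flip: shp_simps(1,2)) (simp add: expn_def algebra_simps)
qed

lemma expn_neg: assumes "P \<in> aff" shows "expn (ec_neg P) g = expn P (cfn_conj g)"
  using ysr_neg[OF assms] by (simp add: expn_def)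

lemma expn_0: assumes "P \<in> aff" shows "expn P g $ 0 = ev P g"
  using ysr(2)[OF assms] by (simp add: expn_def ev_def)

lemma ev_mult: "P \<in> aff \<Longrightarrow> ev P (g * h) = ev P g * ev P h"
  using expn_mult[of P g h] by (simp flip: expn_0)
lemma ev_simps [simp]: "ev P (g + h) = ev P g + ev P h" "ev P (g - h) = ev P g - ev P h"
  "ev P 0 = 0" "ev P 1 = 1"  "ev P (- g) = - ev P g"
  by (simp_all add: ev_def algebra_simps)
lemma ev_power: "P \<in> aff \<Longrightarrow> ev P (g ^ n) = ev P g ^ n"
  by (induction n) (simp_all add: ev_mult)

lemma expn_ne0: assumes "P \<in> aff" "g \<noteq> 0" shows "expn P g \<noteq> 0"
proof -
  have "expn P g * expn P (cfn_conj g) = shp (px P) (nrm g)"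
    by (simp add: expn_mult[OF assms(1), symmetric] mult_conj) (simp add: expn_def)
  moreover have "shp (px P) (nrm g) \<noteq> 0"
  proof -
    have "pcompose (nrm g) [:px P, 1:] \<noteq> 0" using assms(2) by (simp add: pcompose_eq_0_iff)
    then show ?thesis by (metis shp_def fps_of_poly_0 fps_of_poly_eq_iff)
  qed
  ultimately show ?thesis by auto
qed

definition ordP :: "ratfun ec_point \<Rightarrow> cfn \<Rightarrow> nat" where "ordP P g = subdegree (expn P g)"

lemma ordP_mult: "P \<in> aff \<Longrightarrow> g \<noteq> 0 \<Longrightarrow> h \<noteq> 0 \<Longrightarrow> ordP P (g * h) = ordP P g + ordP P h"
  by (simp add: ordP_def expn_mult expn_ne0)

lemma ordP_eq_0_iff: "P \<in> aff \<Longrightarrow> g \<noteq> 0 \<Longrightarrow> ordP P g = 0 \<longleftrightarrow> ev P g \<noteq> 0"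
  by (simp add: ordP_def subdegree_eq_0_iff expn_0 expn_ne0)

lemma ordP_neg: "P \<in> aff \<Longrightarrow> ordP (ec_neg P) g = ordP P (cfn_conj g)"
  by (simp add: ordP_def expn_neg)

text \<open>The product of g with its conjugate is the norm, a function of x alone, and conjugation
  exchanges P and -P.\<close>

lemma ordP_pair:
  assumes "P \<in> aff" "g \<noteq> 0"
  shows "ordP P g + ordP (ec_neg P) g = order (px P) (nrm g)"
proof -
  have c: "cfn_conj g \<noteq> 0" using assms(2) by (metis nrm_conj nrm_eq_0_iff)
  have "ordP P g + ordP (ec_neg P) g = ordP P (g * cfn_conj g)"
    using assms c by (simp add: ordP_neg ordP_mult)
  also have "\<dots> = subdegree (shp (px P) (nrm g))"
    by (simp add: mult_conj ordP_def expn_def)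
  finally show ?thesis using assms(2) by (simp add: subdegree_shp)
qed

text \<open>Grouping zeros by their x-coordinate reduces the count to roots of the norm. Equality
  can fail: the norm may have roots outside \<open>ratfun\<close>, or roots whose y-coordinate is
  not rational.\<close>

lemma sum_ordP_le:
  assumes "finite S" "S \<subseteq> aff" "g \<noteq> 0"
  shows "(\<Sum>P\<in>S. ordP P g) \<le> degree (nrm g)"
proof -
  have "(\<Sum>P\<in>S. ordP P g) = (\<Sum>x\<in>px ` S. \<Sum>P\<in>{P\<in>S. px P = x}. ordP P g)"
    using assms(1) by (rule sum.image_gen)
  also have "\<dots> \<le> (\<Sum>x\<in>px ` S. order x (nrm g))"
  proof (rule sum_mono)
    fix x assume "x \<in> px ` S"
    then obtain P where P: "P \<in> S" "x = px P" by auto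
    then have Pa: "P \<in> aff" using assms(2) by auto
    have "{Q\<in>S. px Q = x} \<subseteq> {P, ec_neg P}"
      using P aff_px_eq[OF Pa] subsetD[OF assms(2)] by fastforce
    then have "(\<Sum>P\<in>{P\<in>S. px P = x}. ordP P g) \<le> (\<Sum>Q\<in>{P, ec_neg P}. ordP Q g)"
      by (intro sum_mono2) auto
    also have "\<dots> = order x (nrm g)"
      using neg_ne[OF Pa] ordP_pair[OF Pa assms(3)] P(2) by auto
    finally show "(\<Sum>P\<in>{P\<in>S. px P = x}. ordP P g) \<le> order x (nrm g)" .
  qed
  also have "\<dots> = (\<Sum>x\<in>{x\<in>px ` S. poly (nrm g) x = 0}. order x (nrm g))"
    using assms(1) by (intro sum.mono_neutral_right) (auto simp: order_0I)
  also have "\<dots> \<le> (\<Sum>x | poly (nrm g) x = 0. order x (nrm g))"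
    using assms(3) poly_roots_finite[of "nrm g"] by (intro sum_mono2) auto
  also have "\<dots> \<le> degree (nrm g)" using assms(3) by (intro sum_order_le_degree) simp
  finally show ?thesis .
qed

text \<open>Since \<open>degree (nrm g)\<close> is the order of the pole of \<open>g\<close> at infinity, the condition on the
  size says that all zeros of \<open>g\<close> are rational points over \<open>\<complex>(t)\<close>.\<close>

definition isdiv :: "cfn \<Rightarrow> ratfun ec_point multiset \<Rightarrow> bool" where
  "isdiv g D \<longleftrightarrow> g \<noteq> 0 \<and> set_mset D \<subseteq> aff \<and> size D = degree (nrm g) \<and>
     (\<forall>P\<in>aff. count D P = ordP P g)"

lemma isdiv_mult: "isdiv g D \<Longrightarrow> isdiv h E \<Longrightarrow> isdiv (g * h) (D + E)"
  by (auto simp: isdiv_def ordP_mult nrm_mult degree_mult_eq)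


lemma isdiv_const: assumes "c \<noteq> 0" shows "isdiv (Cfn [:c:] 0) {#}"
proof -
  have "Cfn [:c:] 0 \<noteq> 0" using assms by (simp add: zero_cfn_def)
  then show ?thesis using assms by (auto simp: isdiv_def ordP_eq_0_iff ev_def nrm_def
    degree_power_eq intro!: sym[of "0::nat"] )
qed

lemma isdiv_conj: assumes "isdiv g D" shows "isdiv (cfn_conj g) (image_mset ec_neg D)"
proof -
  have "count (image_mset ec_neg D) P = ordP P (cfn_conj g)" if "P \<in> aff" for P
  proof -
    have "ec_neg -` {P} = {ec_neg P}" by (auto simp: ec_neg_simps(3))
    then have "count (image_mset ec_neg D) P = count D (ec_neg P)"
      by (cases "ec_neg P \<in># D") (simp_all add: count_image_mset not_in_iff)
    then show ?thesis using assms that ordP_neg[of P g] by (simp add: isdiv_def)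
  qed
  moreover have "cfn_conj g \<noteq> 0" using assms by (metis isdiv_def nrm_conj nrm_eq_0_iff)
  ultimately show ?thesis using assms by (auto simp: isdiv_def)
qed

lemma isdiv_vert: assumes "P \<in> aff" shows "isdiv (Cfn [:- px P, 1:] 0) {#P, ec_neg P#}"
proof -
  let ?g = "Cfn [:- px P, 1:] 0"
  have g: "?g \<noteq> 0" by (simp add: zero_cfn_def)
  have "count {#P, ec_neg P#} Q = ordP Q ?g" if Q: "Q \<in> aff" for Q
  proof (cases "px Q = px P")
    case True
    have "expn Q ?g = fps_X" using True
      by (simp add: expn_def shp_def pcompose_pCons fps_of_poly_linear)
    then show ?thesis using aff_px_eq[OF assms Q] True neg_ne[OF assms] by (auto simp: ordP_def)
  next
    case False
    then have "ordP Q ?g = 0" using g Q by (simp add: ordP_eq_0_iff ev_def)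
    then show ?thesis using False by auto
  qed
  then show ?thesis using g assms by (auto simp: isdiv_def nrm_def degree_power_eq)
qed

text \<open>Each factor has at most as many rational zeros as poles, and the totals agree, so
  neither factor can have a zero outside the rational points.\<close>

lemma isdiv_sub:
  assumes "isdiv (g * h) D"
  shows "\<exists>E F. D = E + F \<and> isdiv g E \<and> isdiv h F"
proof -
  have g: "g \<noteq> 0" and h: "h \<noteq> 0" using assms by (auto simp: isdiv_def)
  have D: "set_mset D \<subseteq> aff" "size D = degree (nrm g) + degree (nrm h)"
    "\<And>P. P \<in> aff \<Longrightarrow> count D P = ordP P g + ordP P h"
    using assms g h by (auto simp: isdiv_def ordP_mult nrm_mult degree_mult_eq)
  define m where "m f = Abs_multiset (\<lambda>P. if P \<in># D then ordP P f else 0)" for f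
  have cm: "count (m f) P = (if P \<in># D then ordP P f else 0)" for f P
    unfolding m_def by (subst count_Abs_multiset) (auto intro: finite_subset[of _ "set_mset D"])
  have c0: "ordP P g = 0" "ordP P h = 0" if "P \<in> aff" "P \<notin># D" for P
    using D(3)[OF that(1)] that(2) by (auto simp: not_in_iff)
  have cmg: "count (m g) P = ordP P g" "count (m h) P = ordP P h" if "P \<in> aff" for P
    using c0 that by (auto simp: cm)
  have s: "set_mset (m f) \<subseteq> set_mset D" for f
    by (auto simp: cm simp flip: count_greater_zero_iff split: if_splits)
  have sz: "size (m f) \<le> degree (nrm f)" if "f \<noteq> 0" for f
  proof -
    have "size (m f) = (\<Sum>P\<in>set_mset (m f). count (m f) P)" by (simp add: size_multiset_overloaded_eq)
    also have "\<dots> = (\<Sum>P\<in>set_mset (m f). ordP P f)"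
      using s[of f] by (intro sum.cong) (auto simp: cm)
    also have "\<dots> \<le> degree (nrm f)"
      using s[of f] D(1) that by (intro sum_ordP_le) auto
    finally show ?thesis .
  qed
  have e: "D = m g + m h"
  proof (rule multiset_eqI)
    fix P show "count D P = count (m g + m h) P"
      using D(1) D(3)[of P] by (cases "P \<in># D") (auto simp: cm not_in_iff)
  qed
  have "size (m g) = degree (nrm g)" "size (m h) = degree (nrm h)"
    using sz[OF g] sz[OF h] D(2) arg_cong[OF e, of size] by auto
  then have "isdiv g (m g)" "isdiv h (m h)"
    using g h s[of g] s[of h] D(1) cmg by (auto simp: isdiv_def)
  then show ?thesis using e by blast
qed

lemma isdiv_cancel: assumes "isdiv (g * h) (D + E)" "isdiv h E" shows "isdiv g D"
proof -
  have "g \<noteq> 0" "h \<noteq> 0" using assms by (auto simp: isdiv_def)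
  then show ?thesis using assms by (auto simp: isdiv_def ordP_mult nrm_mult degree_mult_eq)
qed

text \<open>If a + b y vanishes at P and at -P, then a and b vanish at \<open>px P\<close> because
  \<open>py P\<close> is nonzero; so the vertical line divides the function within the coordinate
  ring.\<close>

lemma isdiv_vert_dvd:
  assumes "isdiv g (D + {#P, ec_neg P#})"
  shows "\<exists>g'. isdiv g' D"
proof -
  have P: "P \<in> aff" and g: "g \<noteq> 0" using assms by (auto simp: isdiv_def)
  have "ordP P g \<noteq> 0" "ordP (ec_neg P) g \<noteq> 0"
    using assms P unfolding isdiv_def by (metis add_is_0 aff_neg count_add_mset count_union nat.simps(3))+
  then have z: "ev P g = 0" "ev (ec_neg P) g = 0" using P g by (auto simp: ordP_eq_0_iff)
  have "poly (fre g) (px P) = 0" "poly (fim g) (px P) * py P = 0"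
  proof -
    have a: "poly (fre g) (px P) + poly (fim g) (px P) * py P = 0"
      "poly (fre g) (px P) - poly (fim g) (px P) * py P = 0"
      using z by (simp_all add: ev_def)
    have "2 * poly (fre g) (px P) = (poly (fre g) (px P) + poly (fim g) (px P) * py P) +
      (poly (fre g) (px P) - poly (fim g) (px P) * py P)" by simp
    also have "\<dots> = 0" unfolding a by simp
    finally show "poly (fre g) (px P) = 0" by simp
    then show "poly (fim g) (px P) * py P = 0" using a by simp
  qed
  then have "poly (fim g) (px P) = 0" "poly (fre g) (px P) = 0" using affE(3)[OF P] by auto
  then obtain a b where ab: "fre g = [:- px P, 1:] * a" "fim g = [:- px P, 1:] * b"
    by (auto simp: poly_eq_0_iff_dvd elim!: dvdE)
  have "g = Cfn a b * Cfn [:- px P, 1:] 0"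
    by (rule cfn.expand) (simp add: ab mult.commute)
  then show ?thesis using isdiv_cancel[OF _ isdiv_vert[OF P]] assms by metis
qed

section \<open>The group law\<close>

lemma order_linear: "order x [:- a, 1:] = (if x = (a::ratfun) then 1 else 0)"
  using order_power_n_n[of a 1] by (auto intro: order_0I)

text \<open>The hypothesis says that the line y = l x + m meets the curve over x1, x2, x3, with
  multiplicity. P and -P cannot both lie on it, so the order at P is the full multiplicity of
  \<open>px P\<close> in the norm.\<close>

lemma isdiv_line:
  assumes e: "[:m, l:] ^ 2 - fcub = - ([:- x1, 1:] * [:- x2, 1:] * [:- x3, 1:])"
  shows "isdiv (Cfn [:- m, - l:] 1) {#Pt x1 (l * x1 + m), Pt x2 (l * x2 + m), Pt x3 (l * x3 + m)#}"
proof -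
  let ?g = "Cfn [:- m, - l:] 1"
  let ?p = "\<lambda>x. Pt x (l * x + m)"
  have g: "?g \<noteq> 0" by (simp add: zero_cfn_def)
  have "[:- m, - l:] ^ 2 = [:m, l:] ^ 2" by (simp add: power2_eq_square)
  then have n: "nrm ?g = - ([:- x1, 1:] * [:- x2, 1:] * [:- x3, 1:])"
    unfolding nrm_def using e by simp
  have dn: "degree (nrm ?g) = 3"
    unfolding n by (simp add: degree_mult_eq del: mult_pCons_left mult_pCons_right)
  have on: "order x (nrm ?g) = count {#x1, x2, x3#} x" for x
    unfolding n by (simp add: order_mult order_linear del: mult_pCons_left mult_pCons_right)
  have fc: "fcub = [:m, l:] ^ 2 + [:- x1, 1:] * [:- x2, 1:] * [:- x3, 1:]"
    using e by (simp add: diff_eq_eq del: mult_pCons_left mult_pCons_right)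
  have "poly fcub x = (l * x + m) ^ 2 + (x - x1) * (x - x2) * (x - x3)" for x
    unfolding fc by (simp del: mult_pCons_left mult_pCons_right add: algebra_simps)
  then have "poly fcub x = (l * x + m) ^ 2" if "x \<in> {x1, x2, x3}" for x
    using that by auto
  then have a: "?p x \<in> aff" if "x \<in> {x1, x2, x3}" for x
    using that by (force simp: aff_Pt fcub_def power3_eq_cube algebra_simps)
  have "count {#?p x1, ?p x2, ?p x3#} P = ordP P ?g" if P: "P \<in> aff" for P
  proof (cases "ev P ?g = 0")
    case True
    then have y: "py P = l * px P + m" by (simp add: ev_def eq_neg_iff_add_eq_0 algebra_simps)
    have "ev (ec_neg P) ?g = ev P ?g - 2 * py P" by (simp add: ev_def)
    then have "ev (ec_neg P) ?g \<noteq> 0" using True affE(3)[OF P] by simp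
    then have "ordP (ec_neg P) ?g = 0" using P g by (simp add: ordP_eq_0_iff)
    then have "ordP P ?g = count {#x1, x2, x3#} (px P)" using ordP_pair[OF P g] on by simp
    moreover have "?p x = P \<longleftrightarrow> x = px P" for x using affE(1)[OF P] y by (metis pxy(1))
    ultimately show ?thesis by simp
  next
    case False
    then have "ordP P ?g = 0" using P g by (simp add: ordP_eq_0_iff)
    moreover have "ev (?p x) ?g = 0" for x by (simp add: ev_def)
    ultimately show ?thesis using False by auto
  qed
  then show ?thesis using g dn a by (auto simp: isdiv_def)
qed

text \<open>\<open>R\<close> is the difference of the curve equations along the line, divided by
  \<open>px P - px Q\<close>; for P = Q it is the tangency condition 2 l y = 3 x^2. One computation
  thus serves chords and tangents.\<close>

lemma line_third:
  assumes P: "P \<in> aff" and Q: "Q \<in> aff" and lP: "py P = l * px P + m" and lQ: "py Q = l * px Q + m"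
    and R: "l * (l * (px P + px Q) + 2 * m) = px P ^ 2 + px P * px Q + px Q ^ 2"
  defines "x3 \<equiv> l ^ 2 - px P - px Q"
  shows "isdiv (Cfn [:- m, - l:] 1) {#P, Q, Pt x3 (l * x3 + m)#}"
proof -
  define x1 x2 where "x1 = px P" and "x2 = px Q"
  have b: "b4 = (l * x1 + m) ^ 2 - x1 ^ 3" using affE(2)[OF P] lP by (simp add: x1_def)
  have R': "l * (l * (x1 + x2) + 2 * m) = x1 ^ 2 + x1 * x2 + x2 ^ 2" using R by (simp add: x1_def x2_def)
  have x3: "x3 = l ^ 2 - x1 - x2" by (simp add: x3_def x1_def x2_def)
  \<comment> \<open>Vieta's formulas for the intersection of the line with the curve.\<close>
  have 2: "2 * l * m = - (x1 * x2 + x1 * x3 + x2 * x3)" unfolding x3 using R' by Groebner_Basis.algebra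
  have 0: "m ^ 2 - b4 = x1 * x2 * x3" unfolding b x3 using R' by Groebner_Basis.algebra
  have 1: "l ^ 2 = x1 + x2 + x3" unfolding x3 by simp
  have "[:m, l:] ^ 2 - fcub = [:m ^ 2 - b4, 2 * l * m, l ^ 2, - 1:]"
    by (simp add: fcub_def power2_eq_square algebra_simps)
  also have "\<dots> = [:x1 * x2 * x3, - (x1 * x2 + x1 * x3 + x2 * x3), x1 + x2 + x3, - 1:]"
    unfolding 0 1[symmetric] 2 ..
  also have "\<dots> = - ([:- x1, 1:] * [:- x2, 1:] * [:- x3, 1:])"
    by (simp add: algebra_simps)
  finally have "isdiv (Cfn [:- m, - l:] 1) {#Pt x1 (l * x1 + m), Pt x2 (l * x2 + m), Pt x3 (l * x3 + m)#}"
    by (rule isdiv_line)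
  then show ?thesis using affE(1)[OF P] affE(1)[OF Q] lP lQ by (simp add: x1_def x2_def)
qed

lemma ec_add_PtInf [simp]: "ec_add a P PtInf = P" by (cases P) simp_all

lemma line_add:
  assumes P: "P \<in> aff" and Q: "Q \<in> aff" and n: "px P \<noteq> px Q"
    and lP: "py P = l * px P + m" and lQ: "py Q = l * px Q + m"
  shows "isdiv (Cfn [:- m, - l:] 1) {#P, Q, ec_neg (ec_add 0 P Q)#}"
proof -
  define x1 x2 where "x1 = px P" and "x2 = px Q"
  have "(l * x1 + m) ^ 2 - x1 ^ 3 = (l * x2 + m) ^ 2 - x2 ^ 3"
    using affE(2)[OF P] affE(2)[OF Q] lP lQ by (simp add: x1_def x2_def)
  then have "(x1 - x2) * (l * (l * (x1 + x2) + 2 * m)) = (x1 - x2) * (x1 ^ 2 + x1 * x2 + x2 ^ 2)"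
    by Groebner_Basis.algebra
  then have R: "l * (l * (px P + px Q) + 2 * m) = px P ^ 2 + px P * px Q + px Q ^ 2"
    using n by (simp add: x1_def x2_def)
  have "(py Q - py P) / (px Q - px P) = l" using n lP lQ by (simp add: field_simps)
  then have "ec_neg (ec_add 0 P Q) = (let x3 = l ^ 2 - px P - px Q in Pt x3 (l * x3 + m))"
    using n lP by (subst affE(1)[OF P], subst affE(1)[OF Q])
      (simp add: line_point_def Let_def algebra_simps)
  then show ?thesis using line_third[OF P Q lP lQ R] by (simp add: Let_def)
qed

lemma line_double:
  assumes P: "P \<in> aff"
  shows "\<exists>g. isdiv g {#P, P, ec_neg (ec_add 0 P P)#}"
proof -
  define l where "l = 3 * px P ^ 2 / (2 * py P)"
  define m where "m = py P - l * px P"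
  have l2: "2 * py P * l = 3 * px P ^ 2" using affE(3)[OF P] by (simp add: l_def)
  have lP: "py P = l * px P + m" by (simp add: m_def)
  have R: "l * (l * (px P + px P) + 2 * m) = px P ^ 2 + px P * px P + px P ^ 2"
  proof -
    have "l * (l * (px P + px P) + 2 * m) = 2 * py P * l" by (simp add: lP algebra_simps)
    then show ?thesis using l2 by (simp add: power2_eq_square algebra_simps)
  qed
  have "py P \<noteq> - py P" using affE(3)[OF P] by (metis neg_ne[OF P] affE(1)[OF P] ec_neg_simps(2))
  then have "ec_add 0 P P = line_point l (px P) (py P) (px P)"
    by (subst (1 2) affE(1)[OF P]) (simp add: l_def)
  then have "ec_neg (ec_add 0 P P) = (let x3 = l ^ 2 - px P - px P in Pt x3 (l * x3 + m))"
    by (simp add: line_point_def Let_def m_def algebra_simps)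
  then show ?thesis using line_third[OF P P lP lP R] by (auto simp: Let_def)
qed

text \<open>Says that D minus \<open>size D\<close> times the point at infinity is the divisor of a
  function; as all poles lie at infinity, D alone records it.\<close>

definition prin :: "ratfun ec_point multiset \<Rightarrow> bool" where "prin D \<longleftrightarrow> (\<exists>g. isdiv g D)"

definition pm :: "ratfun ec_point \<Rightarrow> ratfun ec_point multiset" where
  "pm P = (if P = PtInf then {#} else {#P#})"

lemma prin_add: "prin D \<Longrightarrow> prin E \<Longrightarrow> prin (D + E)"
  unfolding prin_def using isdiv_mult by blast

lemma prin_empty: "prin {#}"
  unfolding prin_def using isdiv_const[of 1] by auto

lemma prin_aff: "prin D \<Longrightarrow> set_mset D \<subseteq> aff" by (auto simp: prin_def isdiv_def)

lemma prin_neg: "prin D \<Longrightarrow> prin (image_mset ec_neg D)"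
  unfolding prin_def using isdiv_conj by blast

lemma prin_pair_cancel:
  "prin (D + (E + image_mset ec_neg E)) \<Longrightarrow> prin D"
proof (induction E)
  case (add P E)
  then have "prin ((D + (E + image_mset ec_neg E)) + {#P, ec_neg P#})"
    by (simp add: add_mset_commute)
  then have "prin (D + (E + image_mset ec_neg E))" unfolding prin_def using isdiv_vert_dvd by metis
  then show ?case by (rule add.IH)
qed simp

text \<open>Adding the negative of E creates opposite pairs, which can be removed; no quotient of
  functions is formed.\<close>

lemma prin_cancel: assumes "prin (D + E)" "prin E" shows "prin D"
proof -
  have "prin (D + (E + image_mset ec_neg E))"
    using prin_add[OF assms(1) prin_neg[OF assms(2)]] by (simp add: add.assoc)
  then show ?thesis by (rule prin_pair_cancel)
qed

lemma not_prin_single: "\<not> prin {#P#}"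
  by (metis degree_nrm_ne_1 isdiv_def prin_def size_single)


lemma on_curve_cases: "on_curve 0 b4 P \<longleftrightarrow> P = PtInf \<or> P \<in> aff"
  by (auto simp: aff_def on_curve_def)

lemma pm_PtInf [simp]: "pm PtInf = {#}" by (simp add: pm_def)
lemma pm_aff: "P \<in> aff \<Longrightarrow> pm P = {#P#}" by (auto simp: pm_def aff_def)
lemma pm_neg: "pm (ec_neg P) = image_mset ec_neg (pm P)"
  by (cases P) (auto simp: pm_def)

lemma prin_pm_neg: assumes "on_curve 0 b4 P" shows "prin (pm P + pm (ec_neg P))"
  using assms isdiv_vert[of P] prin_empty
  by (auto simp: on_curve_cases pm_aff prin_def add_mset_commute)

lemma ec_add_neg [simp]: "ec_add 0 P (ec_neg P) = PtInf"
  by (cases P) simp_all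

lemma ec_add_cases:
  assumes "P \<in> aff" "Q \<in> aff"
  obtains "px P \<noteq> px Q" | "Q = P" | "Q = ec_neg P"
  using aff_px_eq[OF assms] by blast

text \<open>P, Q and -(P + Q) are the zeros of a line. Since \<open>pm\<close> omits the point at
  infinity, the degenerate cases reduce to vertical lines or the empty divisor.\<close>

lemma prin_add_pm:
  assumes "on_curve 0 b4 P" "on_curve 0 b4 Q"
  shows "prin (pm P + pm Q + pm (ec_neg (ec_add 0 P Q)))"
proof (cases "P = PtInf \<or> Q = PtInf")
  case True
  then show ?thesis using prin_pm_neg[of P] prin_pm_neg[of Q] assms prin_empty by auto
next
  case False
  then have P: "P \<in> aff" and Q: "Q \<in> aff" using assms by (auto simp: on_curve_cases)
  have fin: ?thesis if "isdiv g {#P, Q, ec_neg (ec_add 0 P Q)#}" for g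
  proof -
    have "ec_neg (ec_add 0 P Q) \<in> aff" using that by (auto simp: isdiv_def)
    then show ?thesis using that P Q by (auto simp: pm_aff prin_def add_mset_commute)
  qed
  from P Q show ?thesis
  proof (cases rule: ec_add_cases)
    case 1
    define l where "l = (py Q - py P) / (px Q - px P)"
    have a: "py P = l * px P + (py P - l * px P)" by simp
    have "l * (px Q - px P) = py Q - py P" using 1 by (simp add: l_def)
    then have "py Q = l * px Q + (py P - l * px P)" by (simp add: algebra_simps)
    from line_add[OF P Q 1 a this] show ?thesis by (rule fin)
  next
    case 2
    then show ?thesis using line_double[OF P] fin by auto
  next
    case 3
    then show ?thesis using prin_pm_neg[OF assms(1)] by simp
  qed
qed

lemma on_curve_add:
  assumes "on_curve 0 b4 P" "on_curve 0 b4 Q"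
  shows "on_curve 0 b4 (ec_add 0 P Q)"
proof -
  have "set_mset (pm (ec_neg (ec_add 0 P Q))) \<subseteq> aff"
    using prin_aff[OF prin_add_pm[OF assms]] by auto
  then have "ec_neg (ec_add 0 P Q) = PtInf \<or> ec_add 0 P Q \<in> aff"
    by (auto simp: pm_def split: if_splits)
  then show ?thesis unfolding on_curve_cases by (metis ec_neg_simps(1,3))
qed

lemma on_curve_neg: "on_curve 0 b4 P \<Longrightarrow> on_curve 0 b4 (ec_neg P)"
  by (auto simp: on_curve_cases)

lemma ec_add_eq_PtInf:
  assumes "on_curve 0 b4 P" "on_curve 0 b4 Q" "ec_add 0 P Q = PtInf"
  shows "Q = ec_neg P"
  using assms by (cases P; cases Q) (auto simp: line_point_def Let_def split: if_splits)

lemma prin_pm_iff: "on_curve 0 b4 P \<Longrightarrow> prin (pm P) \<longleftrightarrow> P = PtInf"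
  using not_prin_single[of P] prin_empty by (auto simp: pm_def)

text \<open>If P and Q both complete D, then P together with -Q is principal; so is the single point
  -(P - Q) unless it is the origin, and a single point never is.\<close>

lemma prin_eq:
  assumes "on_curve 0 b4 P" "on_curve 0 b4 Q" "prin (D + pm P)" "prin (D + pm Q)"
  shows "P = Q"
proof -
  have n: "on_curve 0 b4 (ec_neg Q)" using assms(2) by (rule on_curve_neg)
  have "prin (image_mset ec_neg D + pm (ec_neg Q))" using prin_neg[OF assms(4)] by (simp add: pm_neg)
  with assms(3) have "prin ((pm P + pm (ec_neg Q)) + (D + image_mset ec_neg D))"
    using prin_add by (metis (no_types, lifting) add.assoc add.commute)
  then have 1: "prin (pm P + pm (ec_neg Q))" by (rule prin_pair_cancel)
  have "prin (pm (ec_neg (ec_add 0 P (ec_neg Q))))"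
    by (rule prin_cancel[OF _ 1]) (use prin_add_pm[OF assms(1) n] in \<open>simp add: ac_simps\<close>)
  then have "ec_neg (ec_add 0 P (ec_neg Q)) = PtInf"
    using prin_pm_iff on_curve_neg on_curve_add assms(1) n by blast
  then have "ec_add 0 P (ec_neg Q) = PtInf" by (metis ec_neg_simps(1,3))
  from ec_add_eq_PtInf[OF assms(1) n this] show ?thesis by (metis ec_neg_simps(3))
qed

lemma ec_neg_inject: "ec_neg P = ec_neg Q \<longleftrightarrow> P = Q" by (metis ec_neg_simps(3))

lemma ec_add_commute:
  assumes "on_curve 0 b4 P" "on_curve 0 b4 Q"
  shows "ec_add 0 P Q = ec_add 0 Q P"
proof -
  have "ec_neg (ec_add 0 P Q) = ec_neg (ec_add 0 Q P)"
  proof (rule prin_eq)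
    show "prin (pm P + pm Q + pm (ec_neg (ec_add 0 P Q)))" by (rule prin_add_pm[OF assms])
    show "prin (pm P + pm Q + pm (ec_neg (ec_add 0 Q P)))"
      using prin_add_pm[OF assms(2,1)] by (simp add: add.commute)
  qed (use assms on_curve_add on_curve_neg in auto)
  then show ?thesis by (simp add: ec_neg_inject)
qed

lemma prin_add3:
  assumes "on_curve 0 b4 P" "on_curve 0 b4 Q" "on_curve 0 b4 R"
  shows "prin (pm P + pm Q + pm R + pm (ec_neg (ec_add 0 (ec_add 0 P Q) R)))"
proof -
  let ?S = "ec_add 0 P Q"
  have S: "on_curve 0 b4 ?S" by (rule on_curve_add[OF assms(1,2)])
  have "prin ((pm P + pm Q + pm (ec_neg ?S)) + (pm ?S + pm R + pm (ec_neg (ec_add 0 ?S R))))"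
    by (rule prin_add[OF prin_add_pm[OF assms(1,2)] prin_add_pm[OF S assms(3)]])
  then have "prin ((pm P + pm Q + pm R + pm (ec_neg (ec_add 0 ?S R))) + (pm ?S + image_mset ec_neg (pm ?S)))"
    by (simp add: pm_neg ac_simps)
  then show ?thesis by (rule prin_pair_cancel)
qed

text \<open>Both bracketings complete the same multiset of P, Q, R to a principal divisor, so
  uniqueness replaces any calculation with the addition formulas.\<close>

lemma ec_add_assoc:
  assumes "on_curve 0 b4 P" "on_curve 0 b4 Q" "on_curve 0 b4 R"
  shows "ec_add 0 (ec_add 0 P Q) R = ec_add 0 P (ec_add 0 Q R)"
proof -
  have "ec_add 0 P (ec_add 0 Q R) = ec_add 0 (ec_add 0 Q R) P"
    by (intro ec_add_commute on_curve_add assms)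
  moreover have "ec_neg (ec_add 0 (ec_add 0 P Q) R) = ec_neg (ec_add 0 (ec_add 0 Q R) P)"
  proof (rule prin_eq)
    show "prin (pm P + pm Q + pm R + pm (ec_neg (ec_add 0 (ec_add 0 P Q) R)))"
      by (rule prin_add3[OF assms])
    show "prin (pm P + pm Q + pm R + pm (ec_neg (ec_add 0 (ec_add 0 Q R) P)))"
      using prin_add3[OF assms(2,3,1)] by (simp add: ac_simps)
  qed (use assms on_curve_add on_curve_neg in auto)
  ultimately show ?thesis by (simp add: ec_neg_inject)
qed

section \<open>The Mordell-Weil group as a type\<close>

typedef mw = "{P. on_curve 0 b4 P}" by (rule exI[of _ PtInf]) (simp add: on_curve_def)

setup_lifting type_definition_mw

instantiation mw :: ab_group_add
begin
lift_definition zero_mw :: mw is PtInf by (simp add: on_curve_def)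
lift_definition plus_mw :: "mw \<Rightarrow> mw \<Rightarrow> mw" is "ec_add 0" by (rule on_curve_add)
lift_definition uminus_mw :: "mw \<Rightarrow> mw" is ec_neg by (rule on_curve_neg)
definition minus_mw :: "mw \<Rightarrow> mw \<Rightarrow> mw" where "minus_mw P Q = P + - Q"
instance
proof
  fix a b c :: mw
  show "a + b + c = a + (b + c)" by transfer (rule ec_add_assoc)
  show "a + b = b + a" by transfer (rule ec_add_commute)
  show "0 + a = a" by transfer simp
  show "- a + a = 0" by transfer (metis ec_add_neg ec_neg_simps(3))
qed (simp add: minus_mw_def)
end

text \<open>One direction of Abel's theorem. Adding points one at a time, E together with minus its
  sum stays principal; cancelling the principal D leaves a single point or nothing.\<close>

lemma prin_sum_mset:
  assumes "prin (image_mset Rep_mw D)"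
  shows "sum_mset D = 0"
proof -
  have "prin (image_mset Rep_mw E + pm (Rep_mw (- sum_mset E)))" if "0 \<notin># E" for E
    using that
  proof (induction E)
    case empty
    then show ?case by (simp add: zero_mw.rep_eq uminus_mw.rep_eq prin_empty)
  next
    case (add P E)
    let ?S = "sum_mset E"
    have oc: "on_curve 0 b4 (Rep_mw Q)" for Q using Rep_mw[of Q] by simp
    have P: "pm (Rep_mw P) = {#Rep_mw P#}"
      using add.prems by (auto simp: pm_def) (metis Rep_mw_inject zero_mw.rep_eq)
    have "prin (pm (Rep_mw P) + pm (Rep_mw ?S) + pm (Rep_mw (- (P + ?S))))"
      using prin_add_pm[OF oc oc, of P ?S] by (simp only: plus_mw.rep_eq uminus_mw.rep_eq)
    moreover have "prin (image_mset Rep_mw E + pm (Rep_mw (- ?S)))" using add by auto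
    ultimately have "prin ((image_mset Rep_mw (add_mset P E) + pm (Rep_mw (- (P + ?S)))) +
        (pm (Rep_mw ?S) + image_mset ec_neg (pm (Rep_mw ?S))))"
      using prin_add P by (fastforce simp: uminus_mw.rep_eq pm_neg ac_simps)
    then show ?case using prin_pair_cancel by simp
  qed
  moreover have "0 \<notin># D"
    using prin_aff[OF assms] by (force simp: zero_mw.rep_eq aff_def)
  ultimately have "prin (pm (Rep_mw (- sum_mset D)) + image_mset Rep_mw D)"
    by (simp add: add.commute)
  then have "prin (pm (Rep_mw (- sum_mset D)))" using assms prin_cancel by blast
  then have "Rep_mw (- sum_mset D) = PtInf" using prin_pm_iff Rep_mw by blast
  then have "- sum_mset D = 0" by (metis Rep_mw_inject zero_mw.rep_eq)
  then show ?thesis by simp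
qed

section \<open>Lines on the cubic surface\<close>

definition cst :: "complex \<Rightarrow> ratfun" where "cst c = to_fract [:c:]"

lemma cst_simps [simp]: "cst 0 = 0" "cst 1 = 1" "cst (c + d) = cst c + cst d"
  "cst (c - d) = cst c - cst d" "cst (- c) = - cst c" "cst (c * d) = cst c * cst d"
  by (simp_all add: cst_def one_pCons[symmetric] flip: to_fract_add to_fract_diff to_fract_uminus to_fract_mult)

lemma cst_eq_iff [simp]: "cst c = cst d \<longleftrightarrow> c = d" by (simp add: cst_def)
lemma cst_eq_0 [simp]: "cst c = 0 \<longleftrightarrow> c = 0" using cst_eq_iff[of c 0] by (simp del: cst_eq_iff)
lemma cst_power [simp]: "cst (c ^ n) = cst c ^ n" by (induction n) simp_all
lemma cst_numeral [simp]: "cst (numeral n) = numeral n"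
  by (metis cst_def numeral_poly of_nat_fract of_nat_numeral to_fract_def of_nat_poly)
lemma cst_divide [simp]: "cst (c / d) = cst c / cst d"
proof (cases "d = 0")
  case False
  then have "cst (c / d) * cst d = cst c" by (simp flip: cst_simps)
  then show ?thesis using False by (simp add: field_simps)
qed simp

definition tt :: ratfun where "tt = to_fract [:0, 1:]"

lemma cst_tt_inject: "cst a + cst b * tt = cst c + cst d * tt \<longleftrightarrow> a = c \<and> b = d"
proof -
  have "cst a + cst b * tt = to_fract [:a, b:]" for a b
    by (simp add: cst_def tt_def flip: to_fract_add to_fract_mult)
  then show ?thesis by simp
qed

lemma tt_ne_cst: "tt \<noteq> cst c" using cst_tt_inject[of 0 1 c 0] by simp

definition II :: ratfun where "II = cst \<i>"
definition SS :: ratfun where "SS = cst sqrt3"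
definition ww :: ratfun where "ww = cst zeta3"
definition aa :: ratfun where "aa = cst alpha1"
definition ss :: ratfun where "ss = aa * tt"

lemma sqrt3_sq: "sqrt3 ^ 2 = 3" by (simp flip: of_real_power)

lemma alpha1_pow4: "alpha1 ^ 4 = 8 * sqrt3 - 12"
proof -
  have p: "sqrt 3 - 1 > (0::real)" by simp
  have "(2 powr (1/4) * 3 powr (1/8) * (sqrt 3 - 1) powr (1/2)) ^ 4
      = (2::real) * 3 powr (1/2) * (sqrt 3 - 1) ^ 2"
    using p by (simp add: power_mult_distrib powr_power)
  also have "\<dots> = 8 * sqrt 3 - 12" by (simp add: powr_half_sqrt power2_diff algebra_simps)
  finally have "complex_of_real ((2 powr (1/4) * 3 powr (1/8) * (sqrt 3 - 1) powr (1/2)) ^ 4)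
      = complex_of_real (8 * sqrt 3 - 12)" by simp
  then show ?thesis by (simp add: alpha1_def)
qed

lemma alpha1_ne0: "alpha1 \<noteq> 0"
proof
  assume "alpha1 = 0"
  then have "complex_of_real (8 * sqrt 3 - 12) = 0" using alpha1_pow4 by simp
  then have "8 * sqrt 3 - 12 = (0::real)" by (simp only: of_real_eq_0_iff)
  then have "sqrt 3 = 3 / 2" by simp
  then have "3 = (3 / 2 :: real) ^ 2" by (metis real_sqrt_pow2 zero_le_numeral)
  then show False by (simp add: power2_eq_square)
qed

lemma kfacts: "II ^ 2 = - 1" "SS ^ 2 = 3" "2 * ww = II * SS - 1" "aa ^ 4 = 8 * SS - 12" "aa \<noteq> 0"
  "b4 = tt ^ 4 + 1"
proof -
  show "II ^ 2 = - 1" by (simp add: II_def flip: cst_power)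
  show "SS ^ 2 = 3" unfolding SS_def by (simp only: sqrt3_sq cst_numeral flip: cst_power)
  show "2 * ww = II * SS - 1" by (simp add: ww_def II_def SS_def zeta3_def)
  show "aa ^ 4 = 8 * SS - 12" unfolding aa_def SS_def
    by (simp only: alpha1_pow4 cst_numeral cst_simps flip: cst_power)
  show "aa \<noteq> 0" by (simp add: aa_def alpha1_ne0)
  have "tt ^ 4 + 1 = to_fract ([:0, 1:] * [:0, 1:] * [:0, 1:] * [:0, 1:] + 1)"
    unfolding tt_def by (simp only: to_fract_add to_fract_mult to_fract_1 power4_eq_xxxx)
  also have "\<dots> = b4" by (simp add: b4_def to_fract_def one_pCons)
  finally show "b4 = tt ^ 4 + 1" by simp
qed

lemma ww_cube: "ww ^ 3 = 1"
proof -
  have "8 * ww ^ 3 = 8" using kfacts(1-3) by Groebner_Basis.algebra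
  then show ?thesis by simp
qed

lemma ww_sum: "ww ^ 2 + ww + 1 = 0"
proof -
  have "4 * (ww ^ 2 + ww + 1) = 0" using kfacts(1-3) by Groebner_Basis.algebra
  then show ?thesis unfolding mult_eq_0_iff by simp
qed

text \<open>In the coordinates \<open>x\<close> and \<open>u = 2 (y - t\<^sup>2) / alpha1\<^sup>2\<close>, with \<open>s = alpha1 t\<close>, the curve becomes
  the cubic surface \<open>x\<^sup>3 + 1 + (3 - 2 sqrt 3) u\<^sup>2 = u s\<^sup>2\<close>. The points \<open>AP e\<close> for \<open>e\<^sup>1\<^sup>2 = 1\<close> and
  \<open>CP e\<close> for \<open>e\<^sup>3 = 1\<close> are lines on it.\<close>

definition QP :: "ratfun \<Rightarrow> ratfun \<Rightarrow> ratfun ec_point" where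
  "QP x u = Pt x (aa ^ 2 * u / 2 + tt ^ 2)"

text \<open>The curve reads (y - t^2) (y + t^2) = x^3 + 1. The first factor is
  \<open>aa ^ 2 * u / 2\<close>, and \<open>3 - 2 * SS\<close> is -aa^4 / 4.\<close>

lemma QP_aff:
  assumes "x ^ 3 + 1 + (3 - 2 * SS) * u ^ 2 = u * ss ^ 2"
  shows "QP x u \<in> aff"
proof -
  define y where "y = aa ^ 2 * u / 2 + tt ^ 2"
  have y: "2 * y = aa ^ 2 * u + 2 * tt ^ 2" by (simp add: y_def)
  have "4 * y ^ 2 = 4 * (x ^ 3 + b4)"
    using y kfacts(4,6) assms unfolding ss_def by Groebner_Basis.algebra
  then have "y ^ 2 = x ^ 3 + b4" by (simp only: mult_cancel_left) simp
  then show ?thesis by (simp add: QP_def aff_Pt y_def)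
qed

lemma px_QP [simp]: "px (QP x u) = x" by (simp add: QP_def)

definition AP :: "complex \<Rightarrow> ratfun ec_point" where
  "AP e = QP (cst e * ss + (SS - 1) * cst e ^ 4) (cst e ^ 3 * ss + SS * cst e ^ 6)"

definition CP :: "complex \<Rightarrow> ratfun ec_point" where "CP e = QP (- cst e) 0"

lemma AP_aff: assumes "e ^ 12 = 1" shows "AP e \<in> aff"
proof -
  define h where "h = cst e"
  have h: "h ^ 12 = 1" by (simp add: h_def assms flip: cst_power)
  show ?thesis unfolding AP_def h_def[symmetric]
  proof (rule QP_aff)
    show "(h * ss + (SS - 1) * h ^ 4) ^ 3 + 1 + (3 - 2 * SS) * (h ^ 3 * ss + SS * h ^ 6) ^ 2 =
      (h ^ 3 * ss + SS * h ^ 6) * ss ^ 2"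
      using h kfacts(2) by Groebner_Basis.algebra
  qed
qed

lemma CP_aff: assumes "e ^ 3 = 1" shows "CP e \<in> aff"
proof -
  have "cst e ^ 3 = 1" by (simp add: assms flip: cst_power)
  then show ?thesis unfolding CP_def by (intro QP_aff) simp
qed

definition Xf :: cfn where "Xf = Cfn [:0, 1:] 0"
definition Uf :: cfn where "Uf = Cfn [:- 2 * tt ^ 2 / aa ^ 2:] [:2 / aa ^ 2:]"
definition kc :: "ratfun \<Rightarrow> cfn" where "kc k = Cfn [:k:] 0"

lemma kc_simps [simp]: "kc 0 = 0" "kc 1 = 1" "kc (a + b) = kc a + kc b" "kc (a * b) = kc a * kc b"
  "kc (- a) = - kc a" "kc (a - b) = kc a - kc b" "kc a = 0 \<longleftrightarrow> a = 0" "kc a = kc b \<longleftrightarrow> a = b"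
  by (auto simp: kc_def zero_cfn_def one_cfn_def plus_cfn_def times_cfn_def uminus_cfn_def
      minus_cfn_def one_pCons)
lemma kc_power [simp]: "kc (a ^ n) = kc a ^ n" by (induction n) simp_all
lemma kc_numeral [simp]: "kc (numeral n) = numeral n"
proof -
  have "kc (of_nat m) = of_nat m" for m by (induction m) simp_all
  from this[of "numeral n"] show ?thesis by simp
qed

lemma ev_kc [simp]: "ev P (kc a) = a" by (simp add: ev_def kc_def)
lemma ev_kc_mult [simp]: "ev P (kc a * g) = a * ev P g"
  by (simp add: ev_def kc_def algebra_simps)
lemma ev_Xf [simp]: "ev P Xf = px P" by (simp add: ev_def Xf_def)
lemma ev_Uf [simp]: "ev (QP x u) Uf = u"
  using kfacts(5) by (simp add: ev_def Uf_def QP_def field_simps)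

lemma isdiv_kc: "a \<noteq> 0 \<Longrightarrow> isdiv (kc a) {#}" unfolding kc_def by (rule isdiv_const)

text \<open>For a, b constant and c affine in s this is a plane section of the cubic surface. Over
  \<open>ratfun\<close> it is a line in x and y, since u is affine in y.\<close>

definition plane :: "ratfun \<Rightarrow> ratfun \<Rightarrow> ratfun \<Rightarrow> cfn" where
  "plane a b c = kc a * Xf + kc b * Uf + kc c"

lemma ev_plane: "ev P (plane a b c) = a * px P + b * ev P Uf + c"
  by (simp add: plane_def)

lemma plane_div:
  assumes b: "b \<noteq> 0" and P: "P \<in> aff" and Q: "Q \<in> aff" and n: "px P \<noteq> px Q"
    and z: "ev P (plane a b c) = 0" "ev Q (plane a b c) = 0"
  shows "isdiv (plane a b c) {#P, Q, ec_neg (ec_add 0 P Q)#}"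
proof -
  define l where "l = - a * aa ^ 2 / (2 * b)"
  define m where "m = tt ^ 2 - c * aa ^ 2 / (2 * b)"
  define k where "k = 2 * b / aa ^ 2"
  have k: "k \<noteq> 0" using b kfacts(5) by (simp add: k_def)
  have e: "plane a b c = kc k * Cfn [:- m, - l:] 1"
    using b kfacts(5)
    by (intro cfn.expand) (simp add: plane_def kc_def Xf_def Uf_def k_def l_def m_def field_simps)
  have "py R = l * px R + m" if "ev R (plane a b c) = 0" for R
  proof -
    have "ev R (Cfn [:- m, - l:] 1) = 0" using that k unfolding e by simp
    then show ?thesis by (simp add: ev_def eq_neg_iff_add_eq_0 algebra_simps)
  qed
  from line_add[OF P Q n this[OF z(1)] this[OF z(2)]] isdiv_mult[OF isdiv_kc[OF k]]
  show ?thesis unfolding e by fastforce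
qed

lemma collinear:
  assumes "b \<noteq> 0" "P \<in> aff" "Q \<in> aff" "R \<in> aff" "px P \<noteq> px Q" "px P \<noteq> px R" "px Q \<noteq> px R"
    and "ev P (plane a b c) = 0" "ev Q (plane a b c) = 0" "ev R (plane a b c) = 0"
  shows "Abs_mw P + Abs_mw Q + Abs_mw R = 0"
proof -
  have d: "isdiv (plane a b c) {#P, Q, ec_neg (ec_add 0 P Q)#}"
    using assms by (intro plane_div) auto
  then have "ordP R (plane a b c) \<noteq> 0" using assms(4,10) by (simp add: ordP_eq_0_iff isdiv_def)
  then have "count {#P, Q, ec_neg (ec_add 0 P Q)#} R \<noteq> 0"
    using d assms(4) unfolding isdiv_def by metis
  then have R: "R = ec_neg (ec_add 0 P Q)" using assms by (auto split: if_splits)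
  have "on_curve 0 b4 P" "on_curve 0 b4 Q" using assms by (auto simp: on_curve_cases)
  then have "Abs_mw R = - (Abs_mw P + Abs_mw Q)"
    unfolding R by (simp add: plus_mw.abs_eq uminus_mw.abs_eq eq_onp_def on_curve_add)
  then show ?thesis by simp
qed

lemma AP_px_ne: "e \<noteq> f \<Longrightarrow> px (AP e) \<noteq> px (AP f)"
  using cst_tt_inject[of "(sqrt3 - 1) * e ^ 4" "e * alpha1" "(sqrt3 - 1) * f ^ 4" "f * alpha1"] alpha1_ne0
  by (simp add: AP_def ss_def aa_def SS_def algebra_simps)

lemma AP_CP_px_ne: "e \<noteq> 0 \<Longrightarrow> px (AP e) \<noteq> px (CP f)"
  using cst_tt_inject[of "(sqrt3 - 1) * e ^ 4" "e * alpha1" "- f" 0] alpha1_ne0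
  by (simp add: AP_def CP_def ss_def aa_def SS_def algebra_simps)

definition AA :: "complex \<Rightarrow> mw" where "AA e = Abs_mw (AP e)"
definition CC :: "complex \<Rightarrow> mw" where "CC e = Abs_mw (CP e)"

lemma zeta3_facts: "zeta3 ^ 3 = 1" "zeta3 \<noteq> 1" "zeta3 ^ 2 \<noteq> 1" "zeta3 ^ 2 + zeta3 + 1 = 0" "zeta3 \<noteq> 0"
proof -
  have "cst (zeta3 ^ 3) = cst 1" using ww_cube by (simp add: ww_def)
  then show 3: "zeta3 ^ 3 = 1" by (simp only: cst_eq_iff)
  have "cst (zeta3 ^ 2 + zeta3 + 1) = cst 0" using ww_sum by (simp add: ww_def)
  then show s: "zeta3 ^ 2 + zeta3 + 1 = 0" by (simp only: cst_eq_iff)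
  show 1: "zeta3 \<noteq> 1" using s by auto
  show "zeta3 ^ 2 \<noteq> 1"
  proof
    assume a: "zeta3 ^ 2 = 1"
    have "zeta3 ^ 3 = zeta3 * zeta3 ^ 2" by (simp add: power3_eq_cube power2_eq_square)
    then show False using 3 1 a by simp
  qed
  show "zeta3 \<noteq> 0" using 3 by auto
qed

text \<open>The u-coordinate of \<open>AP e\<close> depends only on e^3, so the three lines share
  the plane u = e^3 s + sqrt3 e^6.\<close>

lemma AA_sum:
  assumes e: "e ^ 12 = 1"
  shows "AA e + AA (zeta3 * e) + AA (zeta3 ^ 2 * e) = 0"
proof -
  define h where "h = cst e"
  have "zeta3 ^ 12 = (zeta3 ^ 3) ^ 4" by (simp flip: power_mult)
  then have w: "zeta3 ^ 12 = 1" using zeta3_facts(1) by simp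
  have w3: "cst zeta3 ^ 3 = 1" using zeta3_facts(1) by (simp flip: cst_power)
  have e0: "e \<noteq> 0" using e by auto
  have u: "ev (AP (c * e)) (plane 0 1 (- (h ^ 3 * ss + SS * h ^ 6))) = 0" if "cst c ^ 3 = 1" for c
  proof -
    have "cst c ^ 6 = 1" using that by Groebner_Basis.algebra
    then show ?thesis using that by (simp add: AP_def ev_plane h_def power_mult_distrib)
  qed
  show ?thesis unfolding AA_def
  proof (rule collinear[where a = 0 and b = 1 and c = "- (h ^ 3 * ss + SS * h ^ 6)"])
    have "zeta3 ^ 2 \<noteq> zeta3" using zeta3_facts by (simp add: power2_eq_square)
    then show "px (AP e) \<noteq> px (AP (zeta3 * e))" "px (AP e) \<noteq> px (AP (zeta3 ^ 2 * e))"
      "px (AP (zeta3 * e)) \<noteq> px (AP (zeta3 ^ 2 * e))"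
      using zeta3_facts e0 by (intro AP_px_ne; auto)+
    show "ev (AP e) (plane 0 1 (- (h ^ 3 * ss + SS * h ^ 6))) = 0" using u[of 1] by simp
    show "ev (AP (zeta3 * e)) (plane 0 1 (- (h ^ 3 * ss + SS * h ^ 6))) = 0" using u[of zeta3] w3 by simp
    have "cst (zeta3 ^ 2) ^ 3 = (cst zeta3 ^ 3) ^ 2" unfolding cst_power by (simp flip: power_mult)
    then show "ev (AP (zeta3 ^ 2 * e)) (plane 0 1 (- (h ^ 3 * ss + SS * h ^ 6))) = 0"
      using u[of "zeta3 ^ 2"] w3 by simp
    show "AP e \<in> aff" using e by (rule AP_aff)
    show "AP (zeta3 * e) \<in> aff" using e w by (intro AP_aff) (simp add: power_mult_distrib)
    have "(zeta3 ^ 2) ^ 12 = (zeta3 ^ 12) ^ 2" by (simp flip: power_mult)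
    then show "AP (zeta3 ^ 2 * e) \<in> aff" using e w by (intro AP_aff) (simp add: power_mult_distrib)
  qed simp
qed

text \<open>The tritangent plane of \<open>CP (e ^ 4)\<close>, \<open>AP e\<close> and
  \<open>AP (- e)\<close>; its coefficients are even in e, which accounts for the last two lines
  appearing together.\<close>

definition Mpl :: "complex \<Rightarrow> cfn" where "Mpl e = plane 1 (- (cst e ^ 10)) (cst e ^ 4)"

lemma ev_Mpl:
  assumes "e ^ 12 = 1"
  shows "ev (CP (e ^ 4)) (Mpl e) = 0" "ev (AP e) (Mpl e) = 0" "ev (AP (- e)) (Mpl e) = 0"
proof -
  define h where "h = cst e"
  have h: "h ^ 12 = 1" by (simp add: h_def assms flip: cst_power)
  show "ev (CP (e ^ 4)) (Mpl e) = 0" by (simp add: CP_def Mpl_def ev_plane)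
  show "ev (AP e) (Mpl e) = 0" using h
    by (simp add: AP_def Mpl_def ev_plane flip: h_def) Groebner_Basis.algebra
  show "ev (AP (- e)) (Mpl e) = 0" using h
    by (simp add: AP_def Mpl_def ev_plane flip: h_def) Groebner_Basis.algebra
qed

lemma AA_CC:
  assumes e: "e ^ 12 = 1"
  shows "CC (e ^ 4) + AA e + AA (- e) = 0"
proof -
  have e0: "e \<noteq> 0" using e by auto
  then have en: "e \<noteq> - e" by simp
  have "(e ^ 4) ^ 3 = 1" using e by (simp flip: power_mult)
  moreover have "(- e) ^ 12 = 1" using e by simp
  ultimately show ?thesis unfolding AA_def CC_def
    using ev_Mpl[OF e] e AP_px_ne[OF en] AP_CP_px_ne[of e] AP_CP_px_ne[of "- e"] e0
    by (intro collinear[where a = 1 and b = "- (cst e ^ 10)" and c = "cst e ^ 4"])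
       (auto simp: Mpl_def intro: AP_aff CP_aff dest: sym)
qed

lemma CC_sum: "CC 1 + CC zeta3 + CC (zeta3 ^ 2) = 0"
proof -
  have e: "(zeta3 ^ 2) ^ 3 = (zeta3 ^ 3) ^ 2" by (simp flip: power_mult)
  have n: "zeta3 ^ 2 \<noteq> zeta3" using zeta3_facts by (simp add: power2_eq_square)
  have p: "px (CP e) \<noteq> px (CP f)" if "e \<noteq> f" for e f using that by (simp add: CP_def)
  have z: "ev (CP e) (plane 0 1 0) = 0" for e by (simp add: CP_def ev_plane)
  show ?thesis unfolding CC_def
    by (rule collinear[where a = 0 and b = 1 and c = 0])
       (use zeta3_facts e n in \<open>auto intro!: p z CP_aff\<close>)
qed

section \<open>Common zeros of polynomials in two variables\<close>

definition rhom :: "('a::comm_ring_1 \<Rightarrow> 'b::comm_ring_1) \<Rightarrow> bool" where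
  "rhom h \<longleftrightarrow> h 0 = 0 \<and> h 1 = 1 \<and> (\<forall>a b. h (a + b) = h a + h b) \<and> (\<forall>a b. h (a * b) = h a * h b)"

lemma rhomD: "rhom h \<Longrightarrow> h 0 = 0" "rhom h \<Longrightarrow> h 1 = 1" "rhom h \<Longrightarrow> h (a + b) = h a + h b"
  "rhom h \<Longrightarrow> h (a * b) = h a * h b" "rhom h \<Longrightarrow> h (- a) = - h a" "rhom h \<Longrightarrow> h (a - b) = h a - h b"
  "rhom h \<Longrightarrow> h (a ^ n) = h a ^ n"
proof -
  assume h: "rhom h"
  show "h 0 = 0" "h 1 = 1" "h (a + b) = h a + h b" "h (a * b) = h a * h b"
    using h by (auto simp: rhom_def)
  have n: "h (- b) = - h b" for b
  proof -
    have "h (- b) + h b = h (- b + b)" using h unfolding rhom_def by metis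
    then show ?thesis using h by (simp add: rhom_def eq_neg_iff_add_eq_0)
  qed
  show "h (- a) = - h a" by (rule n)
  have "h (a - b) = h a + h (- b)" using h unfolding rhom_def by (metis add_uminus_conv_diff)
  then show "h (a - b) = h a - h b" by (simp add: n)
  show "h (a ^ n) = h a ^ n" using h by (induction n) (auto simp: rhom_def)
qed

text \<open>Coefficients are mapped by h before evaluation; nesting \<open>heval\<close> evaluates
  polynomials in two variables.\<close>

definition heval :: "('a::comm_ring_1 \<Rightarrow> 'b::comm_ring_1) \<Rightarrow> 'b \<Rightarrow> 'a poly \<Rightarrow> 'b" where
  "heval h x p = poly (map_poly h p) x"

lemma heval_0 [simp]: "heval h x 0 = 0" by (simp add: heval_def)

lemma heval_pCons: "rhom h \<Longrightarrow> heval h x (pCons a p) = h a + x * heval h x p"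
  by (simp add: heval_def map_poly_pCons rhomD)

lemma heval_add: assumes "rhom h" shows "heval h x (p + q) = heval h x p + heval h x q"
proof (induction p arbitrary: q rule: pCons_induct)
  case (pCons a p)
  then show ?case
    by (cases q) (simp add: heval_pCons[OF assms] rhomD[OF assms] algebra_simps)
qed simp

lemma heval_smult: assumes "rhom h" shows "heval h x (smult c p) = h c * heval h x p"
  by (induction p rule: pCons_induct) (simp_all add: heval_pCons[OF assms] rhomD[OF assms] algebra_simps)

lemma heval_mult: assumes "rhom h" shows "heval h x (p * q) = heval h x p * heval h x q"
proof (induction p rule: pCons_induct)
  case (pCons a p)
  then show ?case
    by (simp add: heval_pCons[OF assms] heval_add[OF assms] heval_smult[OF assms] rhomD[OF assms] algebra_simps)
qed simp

lemma rhom_heval: assumes "rhom h" shows "rhom (heval h x)"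
  using heval_add[OF assms] heval_mult[OF assms] heval_pCons[OF assms, of x 1 0] rhomD[OF assms]
  by (simp add: rhom_def one_pCons)

lemma rhom_cst: "rhom cst" by (simp add: rhom_def)

text \<open>C is algebraically closed in C(t): linear factors of r are split off until one of them
  vanishes at z.\<close>

lemma heval_cst_root:
  assumes "r \<noteq> 0" "heval cst z r = 0"
  shows "\<exists>c. z = cst c"
  using assms
proof (induction "degree r" arbitrary: r rule: less_induct)
  case less
  have "degree r \<noteq> 0"
  proof
    assume "degree r = 0"
    then obtain a where "r = [:a:]" by (rule degree_eq_zeroE)
    then show False using less.prems by (simp add: heval_pCons[OF rhom_cst])
  qed
  then obtain c where "poly r c = 0"
    using fundamental_theorem_of_algebra[of r] constant_degree[of r] by auto
  then obtain r' where r': "r = [:- c, 1:] * r'" by (auto simp: poly_eq_0_iff_dvd elim: dvdE)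
  have "(z - cst c) * heval cst z r' = 0"
    using less.prems(2) unfolding r' heval_mult[OF rhom_cst]
    by (simp add: heval_pCons[OF rhom_cst])
  then consider "z = cst c" | "heval cst z r' = 0" by auto
  then show ?case
  proof cases
    case 2
    have "r' \<noteq> 0" using less.prems r' by auto
    then have "degree r' < degree r"
      unfolding r' by (subst degree_mult_eq) auto
    then show ?thesis using less.hyps \<open>r' \<noteq> 0\<close> 2 by blast
  qed auto
qed

text \<open>An element of least degree in the ideal generated by A and B divides both, hence is a
  unit.\<close>

lemma field_poly_bezout:
  fixes A B :: "'a::field poly"
  assumes "Factorial_Ring.irreducible A" "\<not> A dvd B"
  shows "\<exists>u v. u * A + v * B = 1"
proof -
  define P where "P d \<longleftrightarrow> d \<noteq> 0 \<and> (\<exists>u v. d = u * A + v * B)" for d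
  have A: "A = 1 * A + 0 * B" and B: "B = 0 * A + 1 * B" by simp_all
  have "A \<noteq> 0" using assms(1) by auto
  then have "P A" unfolding P_def using A by blast
  then obtain d where d: "P d" "\<And>e. P e \<Longrightarrow> degree d \<le> degree e"
    using ex_has_least_nat[of P A degree] by blast
  obtain u v where uv: "d = u * A + v * B" using d(1) by (auto simp: P_def)
  have dv: "d dvd C" if ex: "\<exists>u v. C = u * A + v * B" for C
  proof (rule ccontr)
    assume n: "\<not> d dvd C"
    obtain u' v' where C: "C = u' * A + v' * B" using ex by blast
    have "C mod d = C - C div d * d" by (simp add: minus_div_mult_eq_mod)
    also have "\<dots> = (u' - C div d * u) * A + (v' - C div d * v) * B"
      by (subst (1) C, subst (2) uv) (simp add: algebra_simps)
    finally have "C mod d = (u' - C div d * u) * A + (v' - C div d * v) * B" .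
    moreover have nz: "C mod d \<noteq> 0" using n by (simp add: mod_eq_0_iff_dvd)
    ultimately have "P (C mod d)" unfolding P_def by blast
    then have "degree d \<le> degree (C mod d)" by (rule d(2))
    moreover have "d \<noteq> 0" using d(1) by (simp add: P_def)
    ultimately show False using degree_mod_less[of d C] nz by simp
  qed
  have "d dvd A" by (rule dv) (use A in blast)
  moreover have "d dvd B" by (rule dv) (use B in blast)
  ultimately have "d dvd 1" using assms by (metis irreducibleD' dvd_trans)
  then obtain k where "1 = d * k" ..
  then have "(k * u) * A + (k * v) * B = 1" unfolding uv by (simp add: algebra_simps)
  then show ?thesis by blast
qed

lemma fract_poly_clear: "\<exists>d q. d \<noteq> 0 \<and> smult (to_fract d) p = fract_poly (q :: complex poly poly)"
proof -
  obtain a b where ab: "fract_content p = Fract a b" "b \<noteq> 0" by (cases "fract_content p") auto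
  have "smult (to_fract b) p = smult (to_fract b) (smult (to_fract a / to_fract b) (fract_poly (primitive_part_fract p)))"
    using content_times_primitive_part_fract[of p] ab(1) by (simp only: Fract_conv_to_fract)
  also have "\<dots> = fract_poly (smult a (primitive_part_fract p))" using ab(2) by simp
  finally show ?thesis using ab(2) by blast
qed

text \<open>Two coprime polynomials in two variables have only finitely many common zeros over the
  algebraically closed field of constants, so a common zero with coordinates in a field of
  functions is constant.\<close>

lemma common_zero_const:
  fixes G H :: "complex poly poly"
  assumes irr: "Factorial_Ring.irreducible G" and nd: "\<not> G dvd H"
    and G: "heval (heval cst p0) q0 G = 0" and H: "heval (heval cst p0) q0 H = 0"
  shows "\<exists>c d. p0 = cst c \<and> q0 = cst d"
proof -
  note rc = rhom_cst
  note r1 = rhom_heval[OF rc, of p0]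
  have "\<exists>r. r \<noteq> 0 \<and> heval cst p0 r = 0"
  proof (cases "degree G = 0")
    case True
    then obtain r where r: "G = [:r:]" by (rule degree_eq_zeroE)
    then have "r \<noteq> 0" using irr by auto
    then show ?thesis using G r by (auto simp: heval_pCons[OF r1])
  next
    case False
    \<comment> \<open>By Gauss's lemma, G of positive degree in q stays irreducible over C(p), where
      a Bezout identity is available. Clearing its denominators leaves a nonzero polynomial in p
      alone that vanishes at \<open>p0\<close>.\<close>
    then have c: "content G = 1" and ir: "Factorial_Ring.irreducible (fract_poly G)"
      using nonconst_poly_irreducible_iff irr by blast+
    have "\<not> fract_poly G dvd fract_poly H" using fract_poly_dvdD c nd by blast
    then obtain u v where uv: "u * fract_poly G + v * fract_poly H = 1"
      using field_poly_bezout[OF ir] by blast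
    obtain d u' where u': "d \<noteq> 0" "smult (to_fract d) u = fract_poly u'" using fract_poly_clear by blast
    obtain e v' where v': "e \<noteq> 0" "smult (to_fract e) v = fract_poly v'" using fract_poly_clear by blast
    have "fract_poly (smult e u' * G + smult d v' * H) =
        smult (to_fract (d * e)) (u * fract_poly G + v * fract_poly H)"
      by (simp add: u'(2)[symmetric] v'(2)[symmetric] smult_add_right mult.commute)
    also have "\<dots> = fract_poly [:d * e:]" unfolding uv by (simp add: map_poly_pCons)
    finally have "smult e u' * G + smult d v' * H = [:d * e:]" by (simp only: fract_poly_eq_iff)
    then have "heval (heval cst p0) q0 [:d * e:] = 0"
      using G H by (metis add.right_neutral heval_add[OF r1] heval_mult[OF r1] mult_zero_right)
    then have "heval cst p0 (d * e) = 0" by (simp add: heval_pCons[OF r1])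
    then show ?thesis using u'(1) v'(1) by (metis mult_eq_0_iff)
  qed
  then obtain c where c: "p0 = cst c" using heval_cst_root by blast
  have ec: "heval cst (cst c) r = cst (poly r c)" for r
    by (induction r rule: pCons_induct) (simp_all add: heval_pCons[OF rc])
  define sp where "sp F = map_poly (\<lambda>r. poly r c) F" for F
  have es: "heval (heval cst p0) q0 F = heval cst q0 (sp F)" for F
  proof -
    define h where "h = heval cst p0"
    have h: "rhom h" "\<And>r. h r = cst (poly r c)" using r1 ec by (simp_all add: h_def c)
    show ?thesis unfolding sp_def h_def[symmetric]
    proof (induction F rule: pCons_induct)
      case (pCons a F)
      then show ?case using h(2)[of a] by (simp add: heval_pCons[OF h(1)] heval_pCons[OF rc] map_poly_pCons)
    qed simp
  qed
  have sd: "[:[:- c, 1:]:] dvd F" if "sp F = 0" for F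
  proof -
    have "[:- c, 1:] dvd coeff F n" for n
    proof -
      have "poly (coeff F n) c = coeff (sp F) n"
        by (simp add: sp_def coeff_map_poly)
      then show ?thesis using that by (simp add: poly_eq_0_iff_dvd)
    qed
    then show ?thesis by (simp add: const_poly_dvd_iff)
  qed
  \<comment> \<open>Were both specializations at p = c zero, p - c would divide G and H; the
    irreducible G would then be associated to p - c and divide H.\<close>
  have "sp G \<noteq> 0 \<or> sp H \<noteq> 0"
  proof (rule ccontr)
    assume "\<not> ?thesis"
    then have d: "[:[:- c, 1:]:] dvd G" "[:[:- c, 1:]:] dvd H" using sd by auto
    have "\<not> [:[:- c, 1:]:] dvd 1" by (simp add: is_unit_const_poly_iff is_unit_iff_degree)
    then have "G dvd [:[:- c, 1:]:]" using irreducibleD'[OF irr d(1)] by blast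
    then show False using d(2) nd dvd_trans by blast
  qed
  then obtain d where "q0 = cst d" using G H heval_cst_root unfolding es by blast
  then show ?thesis using c by blast
qed

lemma irreducible_factor_zero:
  fixes H :: "complex poly poly"
  assumes h: "rhom (h :: complex poly poly \<Rightarrow> 'b::idom)" and "H \<noteq> 0" "h H = 0"
  shows "\<exists>G. Factorial_Ring.irreducible G \<and> G dvd H \<and> h G = 0"
proof -
  have "h (prod_mset A) \<noteq> 0" if "\<And>G. G \<in># A \<Longrightarrow> h G \<noteq> 0" for A
    using that by (induction A) (auto simp: rhomD[OF h])
  moreover have "h (prod_mset (prime_factorization H)) = 0"
  proof -
    have "normalize (prod_mset (prime_factorization H)) = normalize H"
      using assms(2) by (rule prod_mset_prime_factorization_weak)
    then have "H dvd prod_mset (prime_factorization H)" by (metis associated_iff_dvd)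
    then obtain k where "prod_mset (prime_factorization H) = H * k" by (metis dvdE)
    then show ?thesis using assms(3) by (simp add: rhomD[OF h])
  qed
  ultimately obtain G where "G \<in># prime_factorization H" "h G = 0" by blast
  then show ?thesis
    by (metis in_prime_factors_iff prime_elem_imp_irreducible prime_imp_prime_elem)
qed

section \<open>Rational coordinates on the surface\<close>

lemma kc_of_nat: "kc (of_nat m) = of_nat m" by (induction m) simp_all

instance cfn :: ring_char_0
proof
  show "inj (of_nat :: nat \<Rightarrow> cfn)"
    by (rule injI) (metis kc_of_nat kc_simps(8) of_nat_eq_iff)
qed

text \<open>\<open>M0\<close>, \<open>M1\<close>, \<open>M2\<close> and \<open>Uf\<close>,
  \<open>L2\<close>, \<open>L3\<close> are two triples of planes; a plane of one triple meets a
  plane of the other in a line of the surface. \<open>Pi0\<close> contains \<open>AP e\<close> for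
  the three cube roots e of -i, and \<open>Z1\<close>, \<open>Z2\<close>, \<open>Z3\<close> pass
  through one of these lines each.\<close>

definition M0 :: cfn where "M0 = plane 1 (- 1) 1"
definition M1 :: cfn where "M1 = plane 1 (- ww) ww"
definition M2 :: cfn where "M2 = plane 1 (- (ww ^ 2)) (ww ^ 2)"
definition L2 :: cfn where "L2 = plane 0 1 (- SS - ss)"
definition L3 :: cfn where "L3 = plane 0 1 (- SS + ss)"
definition Pi0 :: cfn where "Pi0 = plane 0 1 (SS + II * ss)"
definition Z1 :: cfn where "Z1 = plane 1 1 1"
definition Z2 :: cfn where "Z2 = L2 - kc (1 - II) * M2"
definition Z3 :: cfn where "Z3 = 2 * M1 - kc (1 - II) * L3"

lemma chart_simps:
  "M0 = Xf - Uf + 1" "M1 = Xf - kc ww * Uf + kc ww" "M2 = Xf - kc ww ^ 2 * Uf + kc ww ^ 2"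
  "L2 = Uf - kc SS - kc ss" "L3 = Uf - kc SS + kc ss" "Pi0 = Uf + kc SS + kc II * kc ss"
  "Z1 = Xf + Uf + 1"
  by (simp_all add: M0_def M1_def M2_def L2_def L3_def Pi0_def Z1_def plane_def)

lemma Uf_Y: "kc (aa ^ 2) * Uf = 2 * (Cfn 0 1 - kc (tt ^ 2))"
proof -
  have "(2 :: cfn) = kc 2" by simp
  then have "2 * (Cfn 0 1 - kc (tt ^ 2)) = kc 2 * (Cfn 0 1 - kc (tt ^ 2))" by (simp only:)
  also have "\<dots> = kc (aa ^ 2) * Uf"
    using kfacts(5) by (intro cfn.expand) (simp add: kc_def Uf_def)
  finally show ?thesis ..
qed

lemma Y_sq: "(Cfn 0 1) ^ 2 = Xf ^ 3 + kc b4"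
  by (rule cfn.expand) (simp add: Xf_def kc_def power2_eq_square power3_eq_cube fcub_def)

lemma kc_facts: "kc II ^ 2 = - 1" "kc SS ^ 2 = 3" "2 * kc ww = kc II * kc SS - 1"
  "kc aa ^ 4 = 8 * kc SS - 12" "kc b4 = kc tt ^ 4 + 1" "kc ss = kc aa * kc tt"
proof -
  show "kc II ^ 2 = - 1" "kc SS ^ 2 = 3" using kfacts(1,2) by (simp_all flip: kc_power)
  have "kc (2 * ww) = kc (II * SS - 1)" using kfacts(3) by simp
  then show "2 * kc ww = kc II * kc SS - 1" by simp
  have "kc (aa ^ 4) = kc (8 * SS - 12)" using kfacts(4) by (simp only:)
  then show "kc aa ^ 4 = 8 * kc SS - 12" by simp
  show "kc b4 = kc tt ^ 4 + 1" unfolding kfacts(6) by simp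
  show "kc ss = kc aa * kc tt" by (simp add: ss_def)
qed

lemma surface: "Xf ^ 3 + 1 + (3 - 2 * kc SS) * Uf ^ 2 = Uf * kc ss ^ 2"
proof -
  have u: "kc aa ^ 2 * Uf = 2 * (Cfn 0 1 - kc tt ^ 2)" using Uf_Y by simp
  have "4 * (Xf ^ 3 + 1 + (3 - 2 * kc SS) * Uf ^ 2) = 4 * (Uf * kc ss ^ 2)"
    using u Y_sq kc_facts by Groebner_Basis.algebra
  then show ?thesis unfolding mult_cancel_left by simp
qed

text \<open>The product of the M is x^3 + (1 - u)^3, and L2 L3 = (u - sqrt3)^2 - s^2, so this is the
  equation of the surface. The value of alpha1^4 is what makes the u^2 terms agree.\<close>

lemma cayley_salmon: "Uf * L2 * L3 = - (M0 * M1 * M2)"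
proof -
  have w: "kc ww ^ 2 + kc ww + 1 = 0"
    using ww_sum by (metis kc_power kc_simps(1,2,3))
  show ?thesis unfolding chart_simps using surface w kc_facts(2) by Groebner_Basis.algebra
qed

lemma plane_ne0: "b \<noteq> 0 \<Longrightarrow> plane a b c \<noteq> 0"
  using kfacts(5) by (auto simp: plane_def kc_def Xf_def Uf_def zero_cfn_def plus_cfn_def times_cfn_def)

lemma chart_ne0: "M0 \<noteq> 0" "M2 \<noteq> 0" "L2 \<noteq> 0" "L3 \<noteq> 0" "Pi0 \<noteq> 0" "Z1 \<noteq> 0"
  using zeta3_facts(5) by (auto simp: M0_def M2_def L2_def L3_def Pi0_def Z1_def ww_def intro!: plane_ne0)

text \<open>The surface is rational: the two conic bundles \<open>Uf / M0\<close> and \<open>L2 / M2\<close> give affine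
  coordinates, in which the functions on the surface become rational functions with the single
  denominator \<open>Wp\<close>.\<close>

type_synonym bipoly = "complex poly poly"

definition pp :: "cfn fract" where "pp = to_fract Uf / to_fract M0"
definition qq :: "cfn fract" where "qq = to_fract L2 / to_fract M2"

text \<open>Substituting the coordinates turns a polynomial over C in two variables into a rational
  function on the curve over C(t). \<open>psi\<close> is the corresponding substitution at a
  point.\<close>

definition ph :: "bipoly \<Rightarrow> cfn fract" where
  "ph = heval (heval (\<lambda>c. to_fract (kc (cst c))) pp) qq"

definition psi :: "ratfun ec_point \<Rightarrow> bipoly \<Rightarrow> ratfun" where
  "psi P = heval (heval cst (ev P Uf / ev P M0)) (ev P L2 / ev P M2)"

lemma rhom_kcst: "rhom (\<lambda>c. to_fract (kc (cst c)))" by (simp add: rhom_def)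
lemma rhom_ph: "rhom ph" unfolding ph_def by (intro rhom_heval rhom_kcst)
lemma rhom_psi: "rhom (psi P)" unfolding psi_def by (intro rhom_heval rhom_cst)

definition pv :: bipoly where "pv = [:[:0, 1:]:]"
definition qv :: bipoly where "qv = [:0, 1:]"
definition cv :: "complex \<Rightarrow> bipoly" where "cv c = [:[:c:]:]"

lemma ph_var: "ph pv = pp" "ph qv = qq" "ph (cv c) = to_fract (kc (cst c))"
  by (simp_all add: ph_def pv_def qv_def cv_def heval_pCons rhom_heval rhom_kcst rhomD)

text \<open>Solving the linear equations \<open>U = p M0\<close>, \<open>L2 = q M2\<close> and \<open>p q L3 = - M1\<close>, the last of which comes
  from \<open>U L2 L3 = - M0 M1 M2\<close>, for \<open>U\<close>, \<open>x\<close> and \<open>s\<close> gives \<open>NU / Wp\<close>, \<open>NX / Wp\<close> and \<open>NS / Wp\<close>.\<close>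

definition Bp where "Bp = pv * qv ^ 2"
definition b2 where "b2 = cv 2 * pv * qv - cv zeta3 + Bp * cv (zeta3 ^ 2)"
definition c2 where "c2 = cv 2 * cv sqrt3 * pv * qv - cv zeta3 + Bp * cv (zeta3 ^ 2)"
definition Wp where "Wp = - pv * b2 - (1 - Bp) * (1 + pv)"
definition NU where "NU = - pv * c2 - (1 - Bp) * pv"
definition NX where "NX = pv * b2 - c2 * (1 + pv)"
definition NS where "NS = NU - cv sqrt3 * Wp - qv * (NX + cv (zeta3 ^ 2) * (Wp - NU))"

lemma to_fract_power [simp]: "to_fract (a ^ n) = to_fract a ^ n" by (induction n) simp_all
lemma to_fract_numeral [simp]: "to_fract (numeral n) = numeral n"
  by (metis Fract_of_nat_eq of_nat_numeral to_fract_def)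

text \<open>The left side is the equation of \<open>Pi0\<close> times the denominator. It splits
  because the plane meets the surface in three lines, given by p = -1/2, q = 1 - i and p q = -(1 -
  i)/2.\<close>

lemma chart_denominator:
  fixes p q S i w :: "'a::field_char_0"
  assumes "S ^ 2 = 3" "i ^ 2 = - 1" "2 * w = i * S - 1"
  shows "let B = p * q ^ 2; b = 2 * p * q - w + B * w ^ 2; c = 2 * S * p * q - w + B * w ^ 2;
      W = - p * b - (1 - B) * (1 + p); nu = - p * c - (1 - B) * p; nx = p * b - c * (1 + p);
      ns = nu - S * W - q * (nx + w ^ 2 * (W - nu))
    in 2 * (nu + S * W + i * ns) = S * (1 + i) * (2 * p + 1) * (q - (1 - i)) * (2 * p * q + (1 - i))"
proof -
  have w: "w = (i * S - 1) / 2" using assms(3) by (simp add: field_simps)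
  have S: "S * S = 3" "i * i = - 1" using assms(1,2) by (simp_all add: power2_eq_square)
  have S': "S * (S * z) = 3 * z" "i * (i * z) = - z" for z using S by (simp_all flip: mult.assoc)
  show ?thesis unfolding Let_def power2_eq_square w by (simp add: field_simps S S')
qed

text \<open>The first two parts are Cramer's rule for (1 + p) u - p x = p and (1 - B) x + b u = c,
  with determinant W; s is then read off from the definition of q. The last part expresses W through
  planes alone.\<close>

lemma chart_solve:
  "ph Wp * to_fract Uf = ph NU" "ph Wp * to_fract Xf = ph NX" "ph Wp * to_fract (kc ss) = ph NS"
  "ph Wp * to_fract (Pi0 * M0 * M2 * L3) = - to_fract (kc ((1 + II) * SS) * Z1 * Z2 * Z3) / 2"
proof -
  define x u s S w i where "x = to_fract Xf" and "u = to_fract Uf" and "s = to_fract (kc ss)"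
    and "S = to_fract (kc SS)" and "w = to_fract (kc ww)" and "i = to_fract (kc II)"
  define p q where "p = pp" and "q = qq"
  note d = x_def u_def s_def S_def w_def i_def
  have S2: "S ^ 2 = 3" unfolding d by (simp add: kc_facts(2) flip: to_fract_power)
  have i2: "i ^ 2 = - 1" unfolding d by (simp add: kc_facts(1) flip: to_fract_power)
  have "to_fract (2 * kc ww) = to_fract (kc II * kc SS - 1)" using kc_facts(3) by simp
  then have w2: "2 * w = i * S - 1" unfolding d by simp
  define m0 m1 m2 l2 l3 where "m0 = x - u + 1" and "m1 = x - w * u + w" and "m2 = x - w ^ 2 * u + w ^ 2"
    and "l2 = u - S - s" and "l3 = u - S + s"
  have m: "to_fract M0 = m0" "to_fract M1 = m1" "to_fract M2 = m2" "to_fract L2 = l2" "to_fract L3 = l3"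
    unfolding m0_def m1_def m2_def l2_def l3_def d chart_simps by simp_all
  have ne: "m0 \<noteq> 0" "m2 \<noteq> 0" "l3 \<noteq> 0" using chart_ne0 unfolding m[symmetric] by auto
  have p: "p * m0 = u" and q: "q * m2 = l2"
    using ne unfolding p_def q_def pp_def qq_def m u_def[symmetric] by simp_all
  have "to_fract (Uf * L2 * L3) = to_fract (- (M0 * M1 * M2))" using cayley_salmon by simp
  then have cs: "u * l2 * l3 = - (m0 * m1 * m2)" by (simp add: m u_def)
  have "m0 * m2 * (p * q * l3) = m0 * m2 * (- m1)"
  proof -
    have "m0 * m2 * (p * q * l3) = (p * m0) * (q * m2) * l3" by simp
    then show ?thesis unfolding p q cs by simp
  qed
  then have r3: "p * q * l3 = - m1" using ne unfolding mult_cancel_left by simp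
  define B where "B = p * q ^ 2"
  define b where "b = 2 * p * q - w + B * w ^ 2"
  define c where "c = 2 * S * p * q - w + B * w ^ 2"
  define W where "W = - p * b - (1 - B) * (1 + p)"
  define nu nx ns where "nu = - p * c - (1 - B) * p" and "nx = p * b - c * (1 + p)"
    and "ns = nu - S * W - q * (nx + w ^ 2 * (W - nu))"
  note rh = rhomD[OF rhom_ph]
  have k: "ph (cv zeta3) = w" "ph (cv (zeta3 ^ 2)) = w ^ 2" "ph (cv sqrt3) = S" "ph (cv 2) = 2"
    by (simp_all add: ph_var d ww_def SS_def)
  have pB: "ph Bp = B" by (simp add: Bp_def rh ph_var(1,2) B_def p_def q_def)
  have pb: "ph b2 = b" "ph c2 = c" by (simp_all add: b2_def c2_def rh k pB ph_var(1,2) b_def c_def p_def q_def)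
  have pW: "ph Wp = W" by (simp add: Wp_def rh pB pb ph_var(1,2) W_def p_def)
  have pn: "ph NU = nu" "ph NX = nx"
    by (simp_all add: NU_def NX_def rh pB pb ph_var(1,2) nu_def nx_def p_def)
  have ps: "ph NS = ns" by (simp add: NS_def rh pn pW k ph_var(1,2) ns_def q_def)
  have e1: "(1 + p) * u - p * x = p" using p unfolding m0_def by (simp add: algebra_simps)
  have "u - S - q * m2 = s" using q by (simp add: l2_def)
  then have "p * q * (u - S + (u - S - q * m2)) = - m1" using r3 unfolding l3_def by simp
  then have e2: "(1 - B) * x + b * u = c"
    unfolding m1_def m2_def B_def b_def c_def by (simp add: algebra_simps power2_eq_square)
  have e1': "(1 + p) * u = p + p * x" and e2': "b * u = c - (1 - B) * x"
    using e1 e2 by (simp_all add: algebra_simps)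
  have "W * u = - p * (b * u) - (1 - B) * ((1 + p) * u)" by (simp add: W_def algebra_simps)
  then have U: "W * u = nu" unfolding e1' e2' nu_def by (simp add: algebra_simps)
  have e1'': "p * x = (1 + p) * u - p" and e2'': "(1 - B) * x = c - b * u"
    using e1 e2 by (simp_all add: algebra_simps)
  have "W * x = - b * (p * x) - (1 + p) * ((1 - B) * x)" by (simp add: W_def algebra_simps)
  then have X: "W * x = nx" unfolding e1'' e2'' nx_def by (simp add: algebra_simps)
  have s: "s = u - S - q * (x - w ^ 2 * u + w ^ 2)" using q unfolding m2_def l2_def by simp
  have S': "W * s = ns" unfolding s ns_def U[symmetric] X[symmetric] by (simp add: algebra_simps)
  show "ph Wp * to_fract Uf = ph NU" "ph Wp * to_fract Xf = ph NX" "ph Wp * to_fract (kc ss) = ph NS"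
    using U X S' by (simp_all add: pW pn ps d)
  have "W * (u + S + i * s) = nu + S * W + i * ns" using U S' by (simp add: algebra_simps)
  moreover have "2 * (nu + S * W + i * ns) = S * (1 + i) * (2 * p + 1) * (q - (1 - i)) * (2 * p * q + (1 - i))"
    using chart_denominator[OF S2 i2 w2, of p q]
    unfolding Let_def ns_def nu_def nx_def W_def b_def c_def B_def .
  ultimately have f: "2 * (W * (u + S + i * s)) = S * (1 + i) * (2 * p + 1) * (q - (1 - i)) * (2 * p * q + (1 - i))"
    by simp
  \<comment> \<open>Multiplying each factor by the denominator of p, q or p q turns it into
    \<open>Z1\<close>, \<open>Z2\<close> or, up to sign, \<open>Z3\<close>.\<close>
  have "(2 * p + 1) * m0 = 2 * (p * m0) + m0" by (simp only: algebra_simps mult_1_left)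
  then have z1: "to_fract Z1 = (2 * p + 1) * m0" unfolding p by (simp add: chart_simps m0_def d)
  have z2: "to_fract Z2 = (q - (1 - i)) * m2" using q by (simp add: Z2_def m d algebra_simps)
  have "(2 * p * q + (1 - i)) * l3 = 2 * (p * q * l3) + (1 - i) * l3" by (simp only: distrib_right mult.assoc)
  then have "(2 * p * q + (1 - i)) * l3 = - 2 * m1 + (1 - i) * l3" unfolding r3 by simp
  moreover have "to_fract Z3 = 2 * m1 - (1 - i) * l3" by (simp add: Z3_def m d)
  ultimately have z3: "to_fract Z3 = - ((2 * p * q + (1 - i)) * l3)" by simp
  have "2 * (W * (u + S + i * s) * m0 * m2 * l3) = 2 * (W * (u + S + i * s)) * (m0 * m2 * l3)"
    by (simp only: mult.assoc)
  also have "\<dots> = - ((1 + i) * S * to_fract Z1 * to_fract Z2 * to_fract Z3)"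
    unfolding z1 z2 z3 f by (simp only: mult_ac minus_mult_right[symmetric] minus_mult_left[symmetric] minus_minus)
  finally have "2 * (W * (u + S + i * s) * m0 * m2 * l3) = - ((1 + i) * S * to_fract Z1 * to_fract Z2 * to_fract Z3)" .
  then have "2 * (W * ((u + S + i * s) * m0 * m2 * l3)) = - ((1 + i) * S * to_fract Z1 * to_fract Z2 * to_fract Z3)"
    by (simp only: mult.assoc)
  moreover have "to_fract (Pi0 * M0 * M2 * L3) = (u + S + i * s) * m0 * m2 * l3"
    by (simp add: m) (simp add: chart_simps d)
  moreover have "to_fract (kc ((1 + II) * SS) * Z1 * Z2 * Z3) = (1 + i) * S * to_fract Z1 * to_fract Z2 * to_fract Z3"
    by (simp add: d)
  ultimately show "ph Wp * to_fract (Pi0 * M0 * M2 * L3) = - to_fract (kc ((1 + II) * SS) * Z1 * Z2 * Z3) / 2"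
    unfolding pW by (simp add: field_simps)
qed


text \<open>Elements of C[p, q] with \<open>Wp\<close> inverted. They include t, so t need not be
  treated as a constant.\<close>

definition pol :: "cfn fract \<Rightarrow> bool" where "pol l \<longleftrightarrow> (\<exists>H k. ph H = ph Wp ^ k * l)"

lemma pol_mult: assumes "pol l" "pol l'" shows "pol (l * l')"
proof -
  obtain H k H' k' where "ph H = ph Wp ^ k * l" "ph H' = ph Wp ^ k' * l'" using assms by (auto simp: pol_def)
  then have "ph (H * H') = ph Wp ^ (k + k') * (l * l')"
    by (simp add: rhomD[OF rhom_ph] power_add)
  then show ?thesis unfolding pol_def by blast
qed

lemma pol_add: assumes "pol l" "pol l'" shows "pol (l + l')"
proof -
  obtain H k H' k' where "ph H = ph Wp ^ k * l" "ph H' = ph Wp ^ k' * l'" using assms by (auto simp: pol_def)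
  then have "ph (Wp ^ k' * H + Wp ^ k * H') = ph Wp ^ (k + k') * (l + l')"
    by (simp add: rhomD[OF rhom_ph] power_add algebra_simps)
  then show ?thesis unfolding pol_def by blast
qed

lemma pol_const: "pol (to_fract (kc (cst c)))"
  unfolding pol_def by (rule exI[of _ "cv c"], rule exI[of _ 0]) (simp add: ph_var)

lemma pol_basic: "pol (to_fract Xf)" "pol (to_fract Uf)" "pol (to_fract (kc tt))"
proof -
  have a: "pol l" if "ph Wp * l = ph H" for l H
    unfolding pol_def using that[symmetric] by (intro exI[of _ H] exI[of _ 1]) simp
  show "pol (to_fract Xf)" "pol (to_fract Uf)" using a chart_solve by blast+
  have "pol (to_fract (kc ss))" using a chart_solve(3) by blast
  then have "pol (to_fract (kc (cst (1 / alpha1))) * to_fract (kc ss))" by (intro pol_mult pol_const)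
  moreover have "kc (cst (1 / alpha1)) * kc ss = kc tt"
  proof -
    have "cst (1 / alpha1) * aa = 1" by (simp add: aa_def alpha1_ne0)
    moreover have "cst (1 / alpha1) * ss = cst (1 / alpha1) * aa * tt" by (simp only: ss_def mult.assoc)
    ultimately have "cst (1 / alpha1) * ss = tt" by (simp only: mult_1)
    then show ?thesis by (simp only: flip: kc_simps(4))
  qed
  ultimately show "pol (to_fract (kc tt))" by (simp flip: to_fract_mult)
qed

lemma pol_cpoly: "pol (to_fract (kc (to_fract (d :: complex poly))))"
proof (induction d rule: pCons_induct)
  case 0
  then show ?case using pol_const[of 0] by simp
next
  case (pCons a d)
  have "pCons a d = [:a:] + [:0, 1:] * d" by simp
  then have "to_fract (pCons a d) = cst a + tt * to_fract d"
    unfolding cst_def tt_def by (simp only: to_fract_add to_fract_mult)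
  then show ?case using pCons pol_add pol_mult pol_const pol_basic(3) by simp
qed

text \<open>\<open>M0 * M2\<close> is a denominator of p and q, so values are meaningful wherever it
  does not vanish; clearing it keeps every evaluation inside \<open>cfn\<close>.\<close>

definition has_val :: "cfn fract \<Rightarrow> (ratfun ec_point \<Rightarrow> ratfun) \<Rightarrow> bool" where
  "has_val l k \<longleftrightarrow> (\<exists>N g. l * to_fract (M0 * M2) ^ N = to_fract g \<and>
     (\<forall>P\<in>aff. ev P (M0 * M2) \<noteq> 0 \<longrightarrow> ev P g = ev P (M0 * M2) ^ N * k P))"

lemma has_val_fn: "has_val (to_fract g) (\<lambda>P. ev P g)"
  unfolding has_val_def by (intro exI[of _ 0] exI[of _ g]) simp

lemma has_val_mult: assumes "has_val l k" "has_val l' k'" shows "has_val (l * l') (\<lambda>P. k P * k' P)"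
proof -
  let ?m = "M0 * M2"
  obtain N g N' g' where
    1: "l * to_fract ?m ^ N = to_fract g" "\<And>P. P \<in> aff \<Longrightarrow> ev P ?m \<noteq> 0 \<Longrightarrow> ev P g = ev P ?m ^ N * k P"
    "l' * to_fract ?m ^ N' = to_fract g'" "\<And>P. P \<in> aff \<Longrightarrow> ev P ?m \<noteq> 0 \<Longrightarrow> ev P g' = ev P ?m ^ N' * k' P"
    using assms unfolding has_val_def by metis
  have "l * l' * to_fract ?m ^ (N + N') = (l * to_fract ?m ^ N) * (l' * to_fract ?m ^ N')"
    by (simp add: power_add algebra_simps)
  also have "\<dots> = to_fract (g * g')" unfolding 1 by simp
  finally have a: "l * l' * to_fract ?m ^ (N + N') = to_fract (g * g')" .
  have "ev P (g * g') = ev P ?m ^ (N + N') * (k P * k' P)" if "P \<in> aff" "ev P ?m \<noteq> 0" for P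
    using 1(2,4)[OF that] that(1) by (simp add: ev_mult[of P g g'] power_add)
  with a show ?thesis unfolding has_val_def by blast
qed

lemma has_val_add: assumes "has_val l k" "has_val l' k'" shows "has_val (l + l') (\<lambda>P. k P + k' P)"
proof -
  let ?m = "M0 * M2"
  obtain N g N' g' where
    1: "l * to_fract ?m ^ N = to_fract g" "\<And>P. P \<in> aff \<Longrightarrow> ev P ?m \<noteq> 0 \<Longrightarrow> ev P g = ev P ?m ^ N * k P"
    "l' * to_fract ?m ^ N' = to_fract g'" "\<And>P. P \<in> aff \<Longrightarrow> ev P ?m \<noteq> 0 \<Longrightarrow> ev P g' = ev P ?m ^ N' * k' P"
    using assms unfolding has_val_def by metis
  have "(l + l') * to_fract ?m ^ (N + N') =
      (l * to_fract ?m ^ N) * to_fract ?m ^ N' + (l' * to_fract ?m ^ N') * to_fract ?m ^ N"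
    by (simp only: power_add algebra_simps)
  also have "\<dots> = to_fract (g * ?m ^ N' + g' * ?m ^ N)"
    unfolding 1 by (simp only: to_fract_add to_fract_mult to_fract_power)
  finally have a: "(l + l') * to_fract ?m ^ (N + N') = to_fract (g * ?m ^ N' + g' * ?m ^ N)" .
  have "ev P (g * ?m ^ N' + g' * ?m ^ N) = ev P ?m ^ (N + N') * (k P + k' P)"
    if "P \<in> aff" "ev P ?m \<noteq> 0" for P
  proof -
    have "ev P (g * ?m ^ N' + g' * ?m ^ N) = ev P g * ev P ?m ^ N' + ev P g' * ev P ?m ^ N"
      using that(1) by (simp only: ev_mult ev_power ev_simps)
    then show ?thesis unfolding 1(2,4)[OF that] by (simp only: power_add algebra_simps)
  qed
  with a show ?thesis unfolding has_val_def by blast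
qed

lemma has_val_unique:
  assumes "has_val l k" "has_val l k'" "P \<in> aff" "ev P (M0 * M2) \<noteq> 0"
  shows "k P = k' P"
proof -
  let ?m = "M0 * M2"
  obtain N g N' g' where
    1: "l * to_fract ?m ^ N = to_fract g" "ev P g = ev P ?m ^ N * k P"
    "l * to_fract ?m ^ N' = to_fract g'" "ev P g' = ev P ?m ^ N' * k' P"
    using assms unfolding has_val_def by metis
  have "to_fract (g * ?m ^ N') = l * to_fract ?m ^ N * to_fract ?m ^ N'"
    unfolding 1 by (simp only: to_fract_mult to_fract_power)
  also have "\<dots> = l * to_fract ?m ^ N' * to_fract ?m ^ N" by (simp only: mult_ac)
  also have "\<dots> = to_fract (g' * ?m ^ N)"
    unfolding 1 by (simp only: to_fract_mult to_fract_power)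
  finally have "g * ?m ^ N' = g' * ?m ^ N" by (simp only: to_fract_eq_iff)
  then have "ev P g * ev P ?m ^ N' = ev P g' * ev P ?m ^ N"
    using assms(3) by (metis ev_mult ev_power)
  then have "ev P ?m ^ (N + N') * k P = ev P ?m ^ (N + N') * k' P"
    unfolding 1 by (simp only: power_add mult_ac)
  then show ?thesis using assms(4) by simp
qed

lemma has_val_heval:
  assumes h: "rhom h" "\<And>P. rhom (h' P)" and v: "\<And>a. has_val (h a) (\<lambda>P. h' P a)" and x: "has_val x k"
  shows "has_val (heval h x G) (\<lambda>P. heval (h' P) (k P) G)"
proof (induction G rule: pCons_induct)
  case 0
  then show ?case using has_val_fn[of 0] by simp
next
  case (pCons a G)
  then show ?case using has_val_add[OF v has_val_mult[OF x pCons(2)]] by (simp add: heval_pCons h)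
qed

lemma has_val_ph: "has_val (ph G) (\<lambda>P. psi P G)"
proof -
  let ?m = "M0 * M2"
  have kk: "has_val (to_fract (kc (cst a))) (\<lambda>P. cst a)" for a
    using has_val_fn[of "kc (cst a)"] by simp
  have p: "has_val pp (\<lambda>P. ev P Uf / ev P M0)"
    unfolding has_val_def using chart_ne0
    by (intro exI[of _ 1] exI[of _ "Uf * M2"]) (auto simp: pp_def ev_mult)
  have q: "has_val qq (\<lambda>P. ev P L2 / ev P M2)"
    unfolding has_val_def using chart_ne0
    by (intro exI[of _ 1] exI[of _ "L2 * M0"]) (auto simp: qq_def ev_mult)
  show ?thesis unfolding ph_def psi_def
    by (intro has_val_heval rhom_heval rhom_kcst rhom_cst kk p q)
qed

lemma has_val_power: "has_val l k \<Longrightarrow> has_val (l ^ n) (\<lambda>P. k P ^ n)"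
proof (induction n)
  case 0
  then show ?case using has_val_fn[of 1] by simp
next
  case (Suc n)
  then show ?case using has_val_mult[of l k "l ^ n"] by simp
qed

section \<open>Generation by the lines\<close>

lemma zeta12_facts: "zeta12 ^ 3 = \<i>" "zeta12 ^ 12 = 1" "zeta12 ^ 4 = zeta3" "zeta12 ^ 6 = -1"
  "zeta12 ^ 2 = zeta6"
proof -
  have s: "sqrt3 * sqrt3 = 3" using sqrt3_sq by (simp add: power2_eq_square)
  have s': "sqrt3 * (sqrt3 * z) = 3 * z" for z using s by (simp flip: mult.assoc)
  show 2: "zeta12 ^ 2 = zeta6" unfolding zeta12_def zeta6_def power2_eq_square
    by (simp add: field_simps s s')
  have "zeta12 ^ 3 = zeta12 ^ 2 * zeta12" by (simp add: power3_eq_cube power2_eq_square)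
  also have "\<dots> = \<i>" unfolding 2 unfolding zeta12_def zeta6_def by (simp add: field_simps s s')
  finally show 3: "zeta12 ^ 3 = \<i>" .
  have "zeta12 ^ 12 = (zeta12 ^ 3) ^ 4" by (simp flip: power_mult)
  then show "zeta12 ^ 12 = 1" by (simp add: 3)
  have "zeta12 ^ 4 = zeta12 ^ 3 * zeta12" by (simp flip: power_Suc2)
  also have "\<dots> = zeta3" unfolding 3 unfolding zeta12_def zeta3_def by (simp add: field_simps)
  finally show "zeta12 ^ 4 = zeta3" .
  have "zeta12 ^ 6 = (zeta12 ^ 3) ^ 2" by (simp flip: power_mult)
  then show "zeta12 ^ 6 = -1" by (simp add: 3)
qed

lemma zeta3_pow: "zeta3 ^ 12 = 1" "(zeta3 ^ 2) ^ 12 = 1" "(zeta3 ^ 2) ^ 4 = zeta3 ^ 2" "(zeta3 ^ 2) ^ 10 = zeta3 ^ 2"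
proof -
  have a: "zeta3 ^ (3 * n) = 1" for n by (simp add: power_mult zeta3_facts(1))
  show "zeta3 ^ 12 = 1" using a[of 4] by simp
  show "(zeta3 ^ 2) ^ 12 = 1" using a[of 8] by (simp flip: power_mult)
  have "(zeta3 ^ 2) ^ 4 = zeta3 ^ (6 + 2)" "(zeta3 ^ 2) ^ 10 = zeta3 ^ (18 + 2)"
    by (simp_all flip: power_mult)
  then have "(zeta3 ^ 2) ^ 4 = zeta3 ^ 6 * zeta3 ^ 2" "(zeta3 ^ 2) ^ 10 = zeta3 ^ 18 * zeta3 ^ 2"
    by (simp_all only: power_add)
  moreover have "zeta3 ^ 6 = 1" "zeta3 ^ 18 = 1" using a[of 2] a[of 6] by simp_all
  ultimately show "(zeta3 ^ 2) ^ 4 = zeta3 ^ 2" "(zeta3 ^ 2) ^ 10 = zeta3 ^ 2" by (simp_all only: mult_1_left)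
qed

lemma II_ne: "II \<noteq> 0" "II \<noteq> - 1"
proof -
  have "cst \<i> \<noteq> cst (- 1)" unfolding cst_eq_iff by (simp add: complex_eq_iff)
  then show "II \<noteq> - 1" by (simp add: II_def)
qed (simp add: II_def)

text \<open>An arbitrary subgroup containing the lines. With \<open>all_in_subgroup\<close> as
  conclusion, interpreting this locale is a proof by induction over the Mordell-Weil group.\<close>

locale mw_subgroup =
  fixes M :: "mw set"
  assumes zero_mem: "0 \<in> M" and add_mem: "a \<in> M \<Longrightarrow> b \<in> M \<Longrightarrow> a + b \<in> M"
    and neg_mem: "a \<in> M \<Longrightarrow> - a \<in> M"
    and AA_mem: "e ^ 12 = 1 \<Longrightarrow> AA e \<in> M" and CC_mem: "e ^ 3 = 1 \<Longrightarrow> CC e \<in> M"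
begin

text \<open>Functions with rational zeros only, all in \<open>M\<close>. They are nonzero at every
  point outside \<open>M\<close>, and so play the part of units there.\<close>

definition kn :: "cfn \<Rightarrow> bool" where
  "kn g \<longleftrightarrow> (\<exists>D. isdiv g D \<and> (\<forall>Q\<in>#D. Abs_mw Q \<in> M))"

lemma kn_mult: "kn g \<Longrightarrow> kn h \<Longrightarrow> kn (g * h)"
  unfolding kn_def using isdiv_mult by (metis Un_iff set_mset_union)

lemma kn_kc: "a \<noteq> 0 \<Longrightarrow> kn (kc a)" unfolding kn_def using isdiv_kc by fastforce

lemma kn_power: "kn g \<Longrightarrow> kn (g ^ n)"
  using kn_kc[of 1] by (induction n) (auto intro: kn_mult)

text \<open>Two zeros in \<open>M\<close> suffice, the third being minus their sum.\<close>

lemma kn_plane: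
  assumes "b \<noteq> 0" "P \<in> aff" "Q \<in> aff" "px P \<noteq> px Q"
    "ev P (plane a b c) = 0" "ev Q (plane a b c) = 0" "Abs_mw P \<in> M" "Abs_mw Q \<in> M"
  shows "kn (plane a b c)"
proof -
  have "on_curve 0 b4 P" "on_curve 0 b4 Q" using assms by (auto simp: on_curve_cases)
  then have "Abs_mw (ec_neg (ec_add 0 P Q)) = - (Abs_mw P + Abs_mw Q)"
    by (simp add: plus_mw.abs_eq uminus_mw.abs_eq eq_onp_def on_curve_add)
  also have "\<dots> \<in> M" using assms by (intro neg_mem add_mem)
  finally show ?thesis unfolding kn_def
    using plane_div[OF assms(1-6)] assms(7,8) by auto
qed

lemma kn_Mpl: assumes "e ^ 12 = 1" shows "kn (Mpl e)"
proof -
  have e0: "e \<noteq> 0" using assms by auto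
  have "(e ^ 4) ^ 3 = 1" using assms by (simp flip: power_mult)
  then show ?thesis unfolding Mpl_def
    using assms e0 ev_Mpl[OF assms] AP_CP_px_ne[OF e0] AA_mem[of e] CC_mem[of "e ^ 4"]
    by (intro kn_plane[of _ "AP e" "CP (e ^ 4)"]) (auto simp: AP_aff CP_aff Mpl_def AA_def CC_def)
qed

lemma kn_AP:
  assumes "b \<noteq> 0" "e \<noteq> f" "e ^ 12 = 1" "f ^ 12 = 1"
    "ev (AP e) (plane a b c) = 0" "ev (AP f) (plane a b c) = 0"
  shows "kn (plane a b c)"
  using assms AA_mem[of e] AA_mem[of f]
  by (intro kn_plane[of _ "AP e" "AP f"]) (auto simp: AP_aff AA_def AP_px_ne)

lemma ev_AP_plane: "ev (AP e) (plane a b c) =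
  a * (cst e * ss + (SS - 1) * cst e ^ 4) + b * (cst e ^ 3 * ss + SS * cst e ^ 6) + c"
  by (simp add: ev_plane AP_def)

lemma kn_chart: "kn M0" "kn M2" "kn L3" "kn Pi0" "kn Z1" "kn Z2" "kn Z3"
proof -
  have w: "cst (zeta3 ^ 2) = ww ^ 2" by (simp add: ww_def)
  have I: "cst \<i> = II" by (simp add: II_def)
  have "M0 = Mpl 1" by (simp add: M0_def Mpl_def)
  then show "kn M0" using kn_Mpl[of 1] by simp
  have w4: "(ww ^ 2) ^ 4 = ww ^ 2" "(ww ^ 2) ^ 10 = ww ^ 2" using ww_cube by Groebner_Basis.algebra+
  have "M2 = Mpl (zeta3 ^ 2)" unfolding M2_def Mpl_def
    unfolding w w4 ..
  then show "kn M2" using kn_Mpl[OF zeta3_pow(2)] by simp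
  have "II ^ 4 = 1" "II ^ 10 = - 1" "II ^ 3 = - II" "II ^ 6 = - 1" using kfacts(1) by Groebner_Basis.algebra+
  note I4 = this
  have "Z1 = Mpl \<i>" unfolding Z1_def Mpl_def I by (simp add: I4)
  moreover have i12: "\<i> ^ 12 = 1" by simp
  ultimately show "kn Z1" using kn_Mpl[of \<i>] by simp
  have w3: "ww ^ 3 = 1" by (rule ww_cube)
  have w6: "ww ^ 6 = 1" using w3 by Groebner_Basis.algebra
  show "kn L3" unfolding L3_def
  proof (rule kn_AP[of _ "- 1" "- zeta3"])
    show "ev (AP (- 1)) (plane 0 1 (- SS + ss)) = 0" "ev (AP (- zeta3)) (plane 0 1 (- SS + ss)) = 0"
      using w3 w6 by (simp_all add: ev_AP_plane flip: ww_def)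
  qed (use zeta3_facts zeta3_pow in auto)
  let ?z = "cst zeta12"
  have z: "?z ^ 3 = II" "?z ^ 4 = ww" "?z ^ 6 = - 1" "2 * ?z = II + SS"
    using zeta12_facts(1,3,4) by (simp_all add: II_def ww_def SS_def flip: cst_power) (simp add: zeta12_def)
  have zi: "\<i> \<noteq> - zeta12" "zeta3 ^ 2 \<noteq> - zeta12"
  proof -
    show "\<i> \<noteq> - zeta12" by (auto simp: zeta12_def complex_eq_iff)
    show "zeta3 ^ 2 \<noteq> - zeta12"
    proof
      assume h: "zeta3 ^ 2 = - zeta12"
      have "zeta3 ^ 6 = (zeta3 ^ 2) ^ 3" by (simp flip: power_mult)
      also have "\<dots> = - \<i>" unfolding h using zeta12_facts(1) by simp
      finally have "zeta3 ^ 6 = - \<i>" .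
      moreover have "zeta3 ^ 6 = (zeta3 ^ 3) ^ 2" by (simp flip: power_mult)
      ultimately have "1 = - \<i>" using zeta3_facts(1) by simp
      then show False by (auto simp: complex_eq_iff)
    qed
  qed
  show "kn Pi0" unfolding Pi0_def
  proof (rule kn_AP[of _ "\<i>" "- zeta12"])
    show "ev (AP \<i>) (plane 0 1 (SS + II * ss)) = 0"
      unfolding ev_AP_plane I by (simp add: I4)
    show "ev (AP (- zeta12)) (plane 0 1 (SS + II * ss)) = 0"
      using z by (simp add: ev_AP_plane)
  qed (use zi zeta12_facts in auto)
  have S1: "SS \<noteq> 1" using kfacts(2) by auto
  have I0: "II \<noteq> 0" "II \<noteq> -1" by (rule II_ne)+
  show "kn Z2"
  proof -
    let ?b = "1 + (1 - II) * ww ^ 2" and ?c = "- SS - ss - (1 - II) * ww ^ 2"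
    have e: "Z2 = plane (- (1 - II)) ?b ?c"
      by (simp add: Z2_def L2_def M2_def plane_def algebra_simps)
    have "2 * ?b = (1 - SS) * (1 + II)" using kfacts(1,2,3) by Groebner_Basis.algebra
    then have b: "?b \<noteq> 0" using S1 I0 by (auto simp: add_eq_0_iff)
    show ?thesis unfolding e
    proof (rule kn_AP[OF b, of "zeta3 ^ 2" "- zeta12"])
      show "ev (AP (zeta3 ^ 2)) (plane (- (1 - II)) ?b ?c) = 0"
        unfolding ev_AP_plane w using kfacts(1,2,3) w3 by Groebner_Basis.algebra
      show "ev (AP (- zeta12)) (plane (- (1 - II)) ?b ?c) = 0"
        unfolding ev_AP_plane cst_simps power_minus_even even_numeral using kfacts(1,2,3) z by Groebner_Basis.algebra
    qed (use zi zeta12_facts zeta3_pow in auto)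
  qed
  show "kn Z3"
  proof -
    let ?b = "- 2 * ww - (1 - II)" and ?c = "2 * ww - (1 - II) * (- SS + ss)"
    have "(2::cfn) = kc 2" by simp
    then have e: "Z3 = plane 2 ?b ?c"
      unfolding Z3_def L3_def M1_def plane_def
      by (simp only: kc_simps) (simp add: algebra_simps)
    have "?b = II * (1 - SS)" using kfacts(1,2,3) by Groebner_Basis.algebra
    then have b: "?b \<noteq> 0" using S1 I0 by auto
    \<comment> \<open>The third cube root of -i, besides i and \<open>- zeta12\<close>;
      \<open>AP f\<close> is the line that \<open>Z3\<close> shares with \<open>Pi0\<close>.\<close>
    define f where "f = (sqrt3 - \<i>) / 2"
    have f2: "2 * cst f = SS - II" by (simp add: f_def SS_def II_def)
    have f3: "cst f ^ 3 = - II"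
    proof -
      have "8 * cst f ^ 3 = 8 * (- II)" using f2 kfacts(1,2) by Groebner_Basis.algebra
      then show ?thesis unfolding mult_cancel_left by simp
    qed
    have "cst (f ^ 12) = (cst f ^ 3) ^ 4" by (simp flip: power_mult)
    also have "\<dots> = cst 1" unfolding f3 using I4 by simp
    finally have f12: "f ^ 12 = 1" by (simp only: cst_eq_iff)
    have fw: "- zeta3 \<noteq> f"
    proof
      assume "- zeta3 = f"
      then have "cst f ^ 3 = - (ww ^ 3)" by (simp add: ww_def flip: \<open>- zeta3 = f\<close>)
      then have "II = 1" using f3 w3 by simp
      then show False using kfacts(1) by simp
    qed
    show ?thesis unfolding e
    proof (rule kn_AP[OF b, of "- zeta3" f])
      show "ev (AP (- zeta3)) (plane 2 ?b ?c) = 0"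
        unfolding ev_AP_plane cst_simps ww_def[symmetric] using kfacts(1,2,3) w3 by Groebner_Basis.algebra
      show "ev (AP f) (plane 2 ?b ?c) = 0"
        unfolding ev_AP_plane using kfacts(1,2,3) f2 f3 by Groebner_Basis.algebra
    qed (use fw f12 zeta3_pow in auto)
  qed
qed


lemma principal_in_subgroup:
  assumes "isdiv g (D + {#P#})" "\<forall>Q\<in>#D. Abs_mw Q \<in> M"
  shows "Abs_mw P \<in> M"
proof -
  let ?D = "D + {#P#}"
  have aff: "set_mset ?D \<subseteq> aff" using assms(1) unfolding isdiv_def by blast
  then have oc: "on_curve 0 b4 Q" if "Q \<in># ?D" for Q using that by (auto simp: on_curve_cases)
  have "image_mset Rep_mw (image_mset Abs_mw ?D) = image_mset id ?D"
    unfolding multiset.map_comp using oc by (intro image_mset_cong) (simp add: Abs_mw_inverse)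
  then have "prin (image_mset Rep_mw (image_mset Abs_mw ?D))"
    using assms(1) unfolding prin_def by auto
  then have "sum_mset (image_mset Abs_mw ?D) = 0" by (rule prin_sum_mset)
  then have e: "Abs_mw P = - sum_mset (image_mset Abs_mw D)" by (simp add: eq_neg_iff_add_eq_0)
  have "sum_mset (image_mset Abs_mw E) \<in> M" if "\<forall>Q\<in>#E. Abs_mw Q \<in> M" for E
    using that by (induction E) (auto intro: zero_mem add_mem)
  then show ?thesis unfolding e using assms(2) by (intro neg_mem) blast
qed

lemma ph_psi_eq:
  assumes "ph H = ph G ^ k * to_fract f" "P \<in> aff" "ev P (M0 * M2) \<noteq> 0"
  shows "psi P H = psi P G ^ k * ev P f"
  using has_val_unique[OF has_val_ph[of H, unfolded assms(1)]
     has_val_mult[OF has_val_power[OF has_val_ph[of G], of k] has_val_fn[of f]] assms(2,3)] .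

text \<open>A denominator of x is a polynomial in t, hence itself a function of p and q; it costs
  only the constant factor \<open>kc c\<close>.\<close>

lemma pol_linear:
  assumes "pol (to_fract F)"
  shows "\<exists>H k c. c \<noteq> 0 \<and> ph H = ph Wp ^ k * to_fract (kc c * (F - kc x))"
proof -
  obtain n d where x: "x = Fract n d" "d \<noteq> 0" by (cases x) auto
  then have e: "kc (to_fract d) * kc x = kc (to_fract n)"
    by (simp add: Fract_conv_to_fract flip: kc_simps(4))
  have "pol (to_fract (kc (to_fract d)) * to_fract F + to_fract (kc (cst (- 1))) * to_fract (kc (to_fract n)))"
    by (intro pol_add pol_mult pol_cpoly pol_const assms)
  also have "to_fract (kc (to_fract d)) * to_fract F + to_fract (kc (cst (- 1))) * to_fract (kc (to_fract n))
      = to_fract (kc (to_fract d) * (F - kc x))"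
    by (simp add: right_diff_distrib e flip: to_fract_mult to_fract_diff)
  finally have "pol (to_fract (kc (to_fract d) * (F - kc x)))" .
  then show ?thesis unfolding pol_def using x(2) by (metis to_fract_eq_0_iff)
qed

theorem aff_in_subgroup:
  assumes P: "P \<in> aff"
  shows "Abs_mw P \<in> M"
proof (rule ccontr)
  assume nM: "Abs_mw P \<notin> M"
  have oc: "on_curve 0 b4 P" using P by (auto simp: on_curve_cases)
  have "Abs_mw (ec_neg P) = - Abs_mw P" using oc by (simp add: uminus_mw.abs_eq eq_onp_def)
  then have nM': "Abs_mw (ec_neg P) \<notin> M" using nM neg_mem by (metis minus_minus)
  have nP: "ec_neg P \<in> aff" using P by simp
  \<comment> \<open>The assumption to be refuted is what places P and -P inside the chart: no known
    function vanishes there.\<close>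
  have kn_ev: "ev P g \<noteq> 0" "ev (ec_neg P) g \<noteq> 0" "g \<noteq> 0" if kg: "kn g" for g
  proof -
    obtain D where D: "isdiv g D" "\<forall>Q\<in>#D. Abs_mw Q \<in> M" using kg by (auto simp: kn_def)
    then have "count D P = 0" "count D (ec_neg P) = 0" using nM nM' by (auto simp: not_in_iff)
    then have "ordP P g = 0" "ordP (ec_neg P) g = 0" using D(1) P nP unfolding isdiv_def by metis+
    then show "ev P g \<noteq> 0" "ev (ec_neg P) g \<noteq> 0" "g \<noteq> 0"
      using D(1) P nP by (auto simp: ordP_eq_0_iff isdiv_def)
  qed
  define num where "num = kc ((1 + II) * SS) * Z1 * Z2 * Z3"
  define den where "den = 2 * (Pi0 * M0 * M2 * L3)"
  \<comment> \<open>\<open>Wp\<close> is a quotient of known functions, hence invertible at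
    P.\<close>
  have W: "ph Wp * to_fract den = to_fract (- num)"
  proof -
    have "ph Wp * to_fract den = 2 * (ph Wp * to_fract (Pi0 * M0 * M2 * L3))" by (simp add: den_def)
    then show ?thesis unfolding chart_solve(4) num_def by simp
  qed
  have "(1 + II) * SS \<noteq> 0" using kfacts(2) II_ne by (auto simp: add_eq_0_iff)
  then have kn_num: "kn num" unfolding num_def by (intro kn_mult kn_kc kn_chart)
  have "(2::cfn) = kc 2" by simp
  then have kn_den: "kn den" unfolding den_def by (metis kn_mult kn_chart kn_kc zero_neq_numeral)
  have kn_m: "kn (M0 * M2)" by (intro kn_mult kn_chart)
  note evm = kn_ev(1)[OF kn_m] and evm' = kn_ev(2)[OF kn_m]
  have "ph Wp \<noteq> 0" using W kn_ev(3)[OF kn_num] by auto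
  have psiW: "psi P Wp \<noteq> 0"
  proof
    assume z: "psi P Wp = 0"
    have "psi P Wp * ev P den = ev P (- num)"
      using has_val_unique[OF has_val_mult[OF has_val_ph[of Wp] has_val_fn[of den]] _ P evm, of "\<lambda>P. ev P (- num)"]
        has_val_fn[of "- num"] unfolding W by simp
    then show False using z kn_ev(1)[OF kn_num] by simp
  qed
  obtain H k c where H: "c \<noteq> 0" "ph H = ph Wp ^ k * to_fract (kc c * (Xf - kc (px P)))"
    using pol_linear[OF pol_basic(1)] by blast
  define Yf where "Yf = Cfn 0 1"
  have "Yf = kc (aa ^ 2 / 2) * Uf + kc tt * kc tt"
  proof -
    have "Yf = kc (aa ^ 2 / 2) * Uf + kc (tt ^ 2)" unfolding Yf_def using kfacts(5)
      by (intro cfn.expand) (simp add: kc_def Uf_def)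
    then show ?thesis by (simp add: power2_eq_square)
  qed
  then have "to_fract Yf = to_fract (kc (cst (alpha1 ^ 2 / 2))) * to_fract Uf + to_fract (kc tt) * to_fract (kc tt)"
    by (simp add: aa_def)
  then have "pol (to_fract Yf)" by (metis pol_add pol_mult pol_const pol_basic(2,3))
  then obtain H' k' c' where H': "c' \<noteq> 0" "ph H' = ph Wp ^ k' * to_fract (kc c' * (Yf - kc (py P)))"
    using pol_linear by blast
  have X: "Xf - kc (px P) = Cfn [:- px P, 1:] 0" by (rule cfn.expand) (simp add: Xf_def kc_def)
  then have dX: "isdiv (Xf - kc (px P)) {#P, ec_neg P#}" using isdiv_vert[OF P] by simp
  have evY: "ev P (Yf - kc (py P)) = 0" "ev (ec_neg P) (Yf - kc (py P)) \<noteq> 0"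
    using affE(3)[OF P] by (auto simp: Yf_def ev_def kc_def)
  have "H \<noteq> 0"
  proof
    assume "H = 0"
    then have "ph H = 0" by (simp add: rhomD[OF rhom_ph])
    moreover have "Xf - kc (px P) \<noteq> 0" using dX by (auto simp: isdiv_def)
    ultimately show False using H \<open>ph Wp \<noteq> 0\<close> by simp
  qed
  moreover have "psi P H = 0" using ph_psi_eq[OF H(2) P evm] by simp
  ultimately obtain G where G: "Factorial_Ring.irreducible G" "G dvd H" "psi P G = 0"
    using irreducible_factor_zero[OF rhom_psi] by blast
  have "G dvd H'"
  proof (rule ccontr)
    assume "\<not> G dvd H'"
    moreover have "psi P H' = 0" using ph_psi_eq[OF H'(2) P evm] evY by simp
    ultimately obtain a b where ab: "ev P Uf / ev P M0 = cst a" "ev P L2 / ev P M2 = cst b"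
      using common_zero_const[OF G(1)] G(3) unfolding psi_def by blast
    \<comment> \<open>All polynomials in p and q would take constant values at P, and so would s =
      \<open>NS / Wp\<close>, whereas t is not constant.\<close>
    have cc: "heval cst (cst a) r = cst (poly r a)" for r
      by (induction r rule: pCons_induct) (simp_all add: heval_pCons[OF rhom_cst])
    have "\<exists>z. psi P F = cst z" for F
    proof (induction F rule: pCons_induct)
      case (pCons r F)
      then obtain z where "psi P F = cst z" by blast
      then have "psi P (pCons r F) = cst (poly r a + b * z)"
        unfolding psi_def ab by (simp add: heval_pCons[OF rhom_heval[OF rhom_cst]] cc)
      then show ?case by blast
    qed (auto simp: psi_def intro: exI[of _ 0])
    then obtain z1 z2 where z: "psi P NS = cst z1" "psi P Wp = cst z2" by metis
    have "psi P NS = psi P Wp ^ 1 * ev P (kc ss)"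
      by (rule ph_psi_eq[OF _ P evm]) (simp add: chart_solve(3))
    then have "cst z1 = cst z2 * ss" using z by simp
    moreover have "z2 \<noteq> 0" using psiW z by auto
    ultimately have "tt = cst (z1 / (z2 * alpha1))"
      using alpha1_ne0 by (simp add: ss_def aa_def field_simps)
    then show False using tt_ne_cst by blast
  qed
  then obtain K' where K': "H' = G * K'" ..
  obtain K where K: "H = G * K" using G(2) ..
  obtain N g where g: "ph G * to_fract (M0 * M2) ^ N = to_fract g" "ev P g = ev P (M0 * M2) ^ N * psi P G"
    using has_val_ph[of G] P evm unfolding has_val_def by blast
  \<comment> \<open>Clearing the denominators \<open>Wp\<close> and \<open>M0 * M2\<close> turns the
    factorization of \<open>HH\<close> into one of functions on the curve, up to a known factor
    A.\<close>
  have cof: "\<exists>h A. g * h = A * f \<and> kn A"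
    if KK: "HH = G * KK" and HH: "ph HH = ph Wp ^ n * to_fract (kc e * f)" and e: "e \<noteq> 0" for HH KK n e f
  proof -
    obtain N' h where h: "ph KK * to_fract (M0 * M2) ^ N' = to_fract h"
      using has_val_ph[of KK] unfolding has_val_def by blast
    have "to_fract (g * h * den ^ n) = ph HH * to_fract (M0 * M2) ^ (N + N') * to_fract den ^ n"
      unfolding KK by (simp only: g(1)[symmetric] h[symmetric] rhomD[OF rhom_ph] power_add to_fract_mult
        to_fract_power mult_ac)
    also have "\<dots> = (ph Wp * to_fract den) ^ n * to_fract (kc e * f) * to_fract (M0 * M2) ^ (N + N')"
      unfolding HH by (simp only: power_mult_distrib mult_ac)
    also have "\<dots> = to_fract ((- num) ^ n * (kc e * f) * (M0 * M2) ^ (N + N'))"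
      unfolding W by (simp only: to_fract_mult to_fract_power)
    finally have "g * h * den ^ n = (- num) ^ n * (kc e * f) * (M0 * M2) ^ (N + N')"
      by (simp only: to_fract_eq_iff)
    then have "g * (h * den ^ n) = ((- num) ^ n * kc e * (M0 * M2) ^ (N + N')) * f"
      by (simp only: mult_ac)
    moreover have "kn (- num)"
      using kn_mult[OF kn_kc[of "- 1"] kn_num] by simp
    then have "kn ((- num) ^ n * kc e * (M0 * M2) ^ (N + N'))"
      by (intro kn_mult kn_power kn_kc e kn_m)
    ultimately show ?thesis by blast
  qed
  obtain h A where h: "g * h = A * (Xf - kc (px P))" "kn A" using cof[OF K H(2,1)] by blast
  obtain h' A' where h': "g * h' = A' * (Yf - kc (py P))" "kn A'" using cof[OF K' H'(2,1)] by blast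
  obtain D where D: "isdiv A D" "\<forall>Q\<in>#D. Abs_mw Q \<in> M" using h(2) by (auto simp: kn_def)
  have "isdiv (g * h) (D + {#P, ec_neg P#})" unfolding h by (rule isdiv_mult[OF D(1) dX])
  then obtain E F where EF: "D + {#P, ec_neg P#} = E + F" "isdiv g E" using isdiv_sub by metis
  have "ev P g = 0" using g(2) G(3) by simp
  then have "ordP P g \<noteq> 0" using P EF(2) by (simp add: ordP_eq_0_iff isdiv_def)
  then have cP: "count E P \<noteq> 0" using EF(2) P unfolding isdiv_def by metis
  have "ev (ec_neg P) g * ev (ec_neg P) h' = ev (ec_neg P) A' * ev (ec_neg P) (Yf - kc (py P))"
    using arg_cong[OF h'(1), of "ev (ec_neg P)"] nP by (simp only: ev_mult)
  then have "ev (ec_neg P) g \<noteq> 0" using kn_ev(2)[OF h'(2)] evY(2) by auto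
  then have "ordP (ec_neg P) g = 0" using nP EF(2) by (simp add: ordP_eq_0_iff isdiv_def)
  then have cN: "count E (ec_neg P) = 0" using EF(2) nP unfolding isdiv_def by metis
  have cD: "count D P = 0" using D(2) nM by (auto simp: not_in_iff)
  have "count E Q \<le> count (D + {#P, ec_neg P#}) Q" for Q unfolding EF by simp
  note cE = this
  \<comment> \<open>As P is not in \<open>M\<close>, it does not occur in D; so P is a simple zero
    of g, and all other zeros of g come from D.\<close>
  have "count E P \<le> 1" using cE[of P] cD neg_ne[OF P] by simp
  then have cP1: "count E P = 1" using cP by linarith
  define E' where "E' = E - {#P#}"
  have E: "E = E' + {#P#}" using cP by (simp add: E'_def)
  have "Abs_mw Q \<in> M" if Q: "Q \<in># E'" for Q
  proof -
    have "Q \<noteq> P" using cP1 Q E by (auto simp flip: count_greater_zero_iff)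
    moreover have "Q \<noteq> ec_neg P" using cN Q E by (auto simp flip: count_greater_zero_iff split: if_splits)
    ultimately have "count E Q \<le> count D Q" using cE[of Q] by simp
    moreover have "count E Q > 0" using Q E by simp
    ultimately have "count D Q > 0" by linarith
    then show ?thesis using D(2) by simp
  qed
  then have "Abs_mw P \<in> M" using principal_in_subgroup[of g E' P] EF(2) E by simp
  then show False using nM by simp
qed

theorem all_in_subgroup: "x \<in> M"
proof -
  have "Rep_mw x = PtInf \<or> Rep_mw x \<in> aff" using Rep_mw[of x] by (simp add: on_curve_cases)
  then show ?thesis
    using aff_in_subgroup[of "Rep_mw x"] zero_mem
    by (metis Rep_mw_inverse zero_mw.abs_eq)
qed

end

section \<open>Linear independence\<close>

definition nm :: "nat \<Rightarrow> 'a::ab_group_add \<Rightarrow> 'a" where "nm n x = ((+) x ^^ n) 0"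

lemma nm_simps [simp]: "nm 0 x = 0" "nm (Suc n) x = x + nm n x" by (simp_all add: nm_def)
lemma nm_add: "nm (m + n) x = nm m x + nm n x" by (induction m) (simp_all add: add.assoc)
lemma nm_distrib: "nm n (x + y) = nm n x + nm n y" by (induction n) (simp_all add: algebra_simps)
lemma nm_minus: "nm n (- x) = - nm n x" by (induction n) simp_all
lemma nm_mult: "nm (m * n) x = nm m (nm n x)" by (induction m) (simp_all add: nm_add)
lemma nm_zero [simp]: "nm n 0 = 0" by (induction n) simp_all

definition zm :: "int \<Rightarrow> 'a::ab_group_add \<Rightarrow> 'a" where "zm n x = nm (nat n) x - nm (nat (- n)) x"

lemma zm_diff: "zm (int a - int b) x = nm a x - nm b x"
proof (cases "b \<le> a")
  case True
  then have "nm a x = nm (a - b) x + nm b x" by (simp flip: nm_add)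
  moreover have "nat (int a - int b) = a - b" "nat (- (int a - int b)) = 0" using True by auto
  ultimately show ?thesis by (simp add: zm_def)
next
  case False
  then have "nm b x = nm (b - a) x + nm a x" by (simp flip: nm_add)
  moreover have "nat (int a - int b) = 0" "nat (- (int a - int b)) = b - a" using False by auto
  ultimately show ?thesis by (simp add: zm_def)
qed

lemma zm_0 [simp]: "zm 0 x = 0" by (simp add: zm_def)
lemma zm_1 [simp]: "zm 1 x = x" by (simp add: zm_def)
lemma zm_zero [simp]: "zm n 0 = 0" by (simp add: zm_def)
lemma zm_add: "zm (m + n) x = zm m x + zm n x"
proof -
  obtain a b where m: "m = int a - int b" using int_diff_cases by blast
  obtain c d where n: "n = int c - int d" using int_diff_cases by blast
  have "m + n = int (a + c) - int (b + d)" by (simp add: m n)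
  then show ?thesis by (simp only: m n zm_diff nm_add) simp
qed
lemma zm_minus_left: "zm (- n) x = - zm n x" by (simp add: zm_def)
lemma zm_distrib: "zm n (x + y) = zm n x + zm n y" by (simp add: zm_def nm_distrib)
lemma zm_minus: "zm n (- x) = - zm n x" by (simp add: zm_def nm_minus)
lemma zm_diff_left: "zm (m - n) x = zm m x - zm n x"
  using zm_add[of m "- n" x] by (simp add: zm_minus_left)
lemma zm_diff_right: "zm n (x - y) = zm n x - zm n y"
  using zm_distrib[of n x "- y"] by (simp add: zm_minus)
lemma zm_mult: "zm (m * n) x = zm m (zm n x)"
proof -
  obtain a b where m: "m = int a - int b" using int_diff_cases by blast
  have nat: "zm (int k * n) x = nm k (zm n x)" for k
    by (induction k) (simp_all add: zm_add distrib_right)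
  have "m * n = int a * n - int b * n" by (simp add: m algebra_simps)
  then show ?thesis by (simp only: zm_diff_left nat) (simp add: m zm_diff)
qed

lemma additive_zm:
  assumes "\<And>x y. f (x + y) = f x + f y"
  shows "f (zm n x) = zm n (f x)"
proof -
  have f0: "f 0 = 0" using assms[of 0 0] by simp
  have n: "f (nm k x) = nm k (f x)" for k by (induction k) (simp_all add: f0 assms)
  have "f (u - v) = f u - f v" for u v using assms[of "u - v" v] by (simp add: algebra_simps)
  then show ?thesis by (simp add: zm_def n)
qed

section \<open>Automorphisms of the Mordell-Weil group\<close>

lemma rhom_field:
  assumes "rhom (h :: ratfun \<Rightarrow> ratfun)"
  shows "h x = 0 \<longleftrightarrow> x = 0" "h (x / y) = h x / h y" "h (numeral n) = numeral n"
proof -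
  note r = rhomD[OF assms]
  have inv: "h x * h (inverse x) = 1" if "x \<noteq> 0" for x
    using that by (metis r(2,4) right_inverse)
  show z: "h x = 0 \<longleftrightarrow> x = 0" for x using inv[of x] r(1) by (metis mult_zero_left zero_neq_one)
  show "h (x / y) = h x / h y"
  proof (cases "y = 0")
    case False
    have "h (x / y) * h y = h x" using False by (simp flip: r(4))
    then show ?thesis using z[of y] False by (simp add: field_simps)
  qed (simp add: r)
  have "h (of_nat k) = of_nat k" for k by (induction k) (simp_all add: r)
  from this[of "numeral n"] show "h (numeral n) = numeral n" by simp
qed

lemma ec_add_hom:
  assumes "rhom (h :: ratfun \<Rightarrow> ratfun)"
  shows "ec_add 0 (map_ec_point h P) (map_ec_point h Q) = map_ec_point h (ec_add 0 P Q)"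
proof (cases P; cases Q)
  fix x1 y1 x2 y2 assume PQ: "P = Pt x1 y1" "Q = Pt x2 y2"
  note r = rhomD[OF assms] rhom_field[OF assms]
  have i: "h x = h y \<longleftrightarrow> x = y" for x y using r(8)[of "x - y"] r(6)[of x y] by simp
  have m: "h y2 = - h y1 \<longleftrightarrow> y2 = - y1" using i[of y2 "- y1"] r(5) by simp
  show ?thesis unfolding PQ by (simp add: i m line_point_def Let_def r)
qed simp_all

text \<open>Scaling x by w preserves the curve and multiplies slopes by 1/w = w^2.\<close>

lemma ec_add_scale:
  assumes "w ^ 3 = (1::ratfun)"
  defines "s \<equiv> (\<lambda>P. case P of PtInf \<Rightarrow> PtInf | Pt x y \<Rightarrow> Pt (w * x) y)"
  shows "ec_add 0 (s P) (s Q) = s (ec_add 0 P Q)"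
proof (cases P; cases Q)
  fix x1 y1 x2 y2 assume PQ: "P = Pt x1 y1" "Q = Pt x2 y2"
  have w0: "w \<noteq> 0" using assms(1) by auto
  have lp: "line_point (w ^ 2 * l) (w * x1) y1 (w * x2) = s (line_point l x1 y1 x2)" for l
  proof -
    have e1: "(w ^ 2 * l) ^ 2 - w * x1 - w * x2 = w * (l ^ 2 - x1 - x2)"
      using assms(1) by Groebner_Basis.algebra
    have e2: "w ^ 2 * l * (w * x1 - w * z) = l * (x1 - z)" for z
      using assms(1) by Groebner_Basis.algebra
    show ?thesis unfolding s_def line_point_def Let_def e1 e2 by simp
  qed
  have c: "(y2 - y1) / (w * x2 - w * x1) = w ^ 2 * ((y2 - y1) / (x2 - x1))" if "x1 \<noteq> x2"
  proof -
    have e: "w ^ 2 * (w * x2 - w * x1) = x2 - x1" using assms(1) by Groebner_Basis.algebra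
    have "w ^ 2 * ((y2 - y1) / (x2 - x1)) = (w ^ 2 * (y2 - y1)) / (w ^ 2 * (w * x2 - w * x1))"
      unfolding e by simp
    then show ?thesis using w0 by simp
  qed
  have t: "3 * (w * x1) ^ 2 / (2 * y1) = w ^ 2 * (3 * x1 ^ 2 / (2 * y1))"
    by (simp add: power_mult_distrib)
  have sP: "s (Pt x y) = Pt (w * x) y" for x y by (simp add: s_def)
  consider "x1 \<noteq> x2" | "x1 = x2" "y2 = - y1" | "x1 = x2" "y2 \<noteq> - y1" by blast
  then show ?thesis
  proof cases
    case 1
    then have "ec_add 0 (s P) (s Q) = line_point ((y2 - y1) / (w * x2 - w * x1)) (w * x1) y1 (w * x2)"
      using w0 by (simp add: PQ sP)
    then show ?thesis unfolding c[OF 1] lp using 1 by (simp add: PQ)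
  next
    case 2
    then show ?thesis by (simp add: PQ s_def)
  next
    case 3
    then have "ec_add 0 (s P) (s Q) = line_point (3 * (w * x1) ^ 2 / (2 * y1)) (w * x1) y1 (w * x2)"
      by (simp add: PQ sP)
    then show ?thesis unfolding t lp using 3 by (simp add: PQ)
  qed
qed (simp_all add: s_def)

lift_definition om :: "mw \<Rightarrow> mw" is "\<lambda>P. case P of PtInf \<Rightarrow> PtInf | Pt x y \<Rightarrow> Pt (ww * x) y"
  using ww_cube by (auto simp: on_curve_def power_mult_distrib split: ec_point.splits)

lemma om_add: "om (x + y) = om x + om y"
  by transfer (simp add: ec_add_scale[OF ww_cube])

lemma aff_Abs: "P \<in> aff \<Longrightarrow> eq_onp (on_curve 0 b4) P P"
  by (simp add: eq_onp_def on_curve_cases)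

lemma om_AA: assumes "e ^ 12 = 1" shows "om (AA e) = AA (zeta3 * e)"
proof -
  have "ww ^ 4 = ww" "ww ^ 6 = 1" using ww_cube by Groebner_Basis.algebra+
  then have "(case AP e of PtInf \<Rightarrow> PtInf | Pt x y \<Rightarrow> Pt (ww * x) y) = AP (zeta3 * e)"
    using ww_cube by (simp add: AP_def QP_def power_mult_distrib algebra_simps flip: ww_def)
  then show ?thesis unfolding AA_def by (simp add: om.abs_eq aff_Abs AP_aff assms)
qed

lemma om_CC: assumes "e ^ 3 = 1" shows "om (CC e) = CC (zeta3 * e)"
proof -
  have "(case CP e of PtInf \<Rightarrow> PtInf | Pt x y \<Rightarrow> Pt (ww * x) y) = CP (zeta3 * e)"
    by (simp add: CP_def QP_def flip: ww_def)
  then show ?thesis unfolding CC_def by (simp add: om.abs_eq aff_Abs CP_aff assms)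
qed

text \<open>The automorphism t -> it of C(t). The reduced fraction only serves to make it a
  function; \<open>tau_Fract\<close> shows that any representation gives the same result.\<close>

definition tau :: "ratfun \<Rightarrow> ratfun" where
  "tau z = Fract (pcompose (fst (quot_of_fract z)) [:0, \<i>:])
     (pcompose (snd (quot_of_fract z)) [:0, \<i>:])"

lemma pcompose_i_ne0: "d \<noteq> 0 \<Longrightarrow> pcompose d [:0, \<i>:] \<noteq> 0"
  by (simp add: pcompose_eq_0_iff)

lemma tau_Fract:
  assumes "d \<noteq> 0"
  shows "tau (Fract n d) = Fract (pcompose n [:0, \<i>:]) (pcompose d [:0, \<i>:])"
proof -
  let ?z = "Fract n d"
  let ?n = "fst (quot_of_fract ?z)" and ?d = "snd (quot_of_fract ?z)"
  have "Fract ?n ?d = ?z" by simp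
  then have "?n * d = n * ?d" using assms by (subst (asm) eq_fract) auto
  then have "pcompose ?n [:0, \<i>:] * pcompose d [:0, \<i>:] = pcompose n [:0, \<i>:] * pcompose ?d [:0, \<i>:]"
    by (metis pcompose_mult)
  then show ?thesis unfolding tau_def using assms
    by (subst eq_fract) (auto simp: pcompose_i_ne0)
qed

lemma rhom_tau: "rhom tau"
proof -
  have "tau (a + b) = tau a + tau b \<and> tau (a * b) = tau a * tau b" for a b
  proof (cases a; cases b)
    fix n d n' d'
    assume h: "a = Fract n d" "d \<noteq> 0" "b = Fract n' d'" "d' \<noteq> 0"
    then show ?thesis
      by (simp add: tau_Fract pcompose_i_ne0 pcompose_add pcompose_mult)
  qed
  moreover have "tau 0 = 0" "tau 1 = 1"
    using tau_Fract[of 1 0] tau_Fract[of 1 1] by (simp_all add: fract_collapse pcompose_1)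
  ultimately show ?thesis by (simp add: rhom_def)
qed

lemma tau_to_fract: "tau (to_fract p) = to_fract (pcompose p [:0, \<i>:])"
  using tau_Fract[of 1 p] by (simp add: to_fract_def pcompose_1)

lemma tau_simps: "tau (cst c) = cst c" "tau tt = II * tt" "tau b4 = b4"
proof -
  show 1: "tau (cst c) = cst c" for c by (simp add: cst_def tau_to_fract pcompose_pCons)
  have "tau tt = to_fract ([:\<i>:] * [:0, 1:])" by (simp add: tt_def tau_to_fract pcompose_pCons)
  then show 2: "tau tt = II * tt" unfolding II_def cst_def tt_def by (simp only: to_fract_mult)
  have "II ^ 4 = 1" using kfacts(1) by Groebner_Basis.algebra
  then show "tau b4 = b4" unfolding kfacts(6) by (simp add: rhomD[OF rhom_tau] 2 power_mult_distrib)
qed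

lift_definition ta :: "mw \<Rightarrow> mw" is "map_ec_point tau"
proof -
  fix P :: "ratfun ec_point"
  assume "on_curve 0 b4 P"
  moreover have "y ^ 2 = x ^ 3 + b4 \<Longrightarrow> tau y ^ 2 = tau x ^ 3 + b4" for x y
    using tau_simps(3) by (metis rhomD(3,7)[OF rhom_tau])
  ultimately show "on_curve 0 b4 (map_ec_point tau P)"
    by (cases P) (auto simp: on_curve_def)
qed

lemma ta_add: "ta (x + y) = ta x + ta y"
  by transfer (simp add: ec_add_hom[OF rhom_tau])

lemma ta_om: "ta (om x) = om (ta x)"
  by transfer (auto simp: rhomD[OF rhom_tau] tau_simps ww_def split: ec_point.splits)

text \<open>The term t^2 of y changes sign under t -> it, which accounts for the negative; the
  factor i of s is absorbed into e.\<close>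

lemma ta_AA: assumes "e ^ 12 = 1" shows "ta (AA e) = - AA (\<i> * e)"
proof -
  have "II ^ 3 = - II" "II ^ 4 = 1" "II ^ 6 = - 1" "II * II = - 1"
    using kfacts(1) by Groebner_Basis.algebra+
  note I = this kfacts(1)
  have "map_ec_point tau (AP e) = ec_neg (AP (\<i> * e))"
    using I by (simp add: AP_def QP_def rhomD[OF rhom_tau] rhom_field[OF rhom_tau] tau_simps ss_def aa_def
      SS_def power_mult_distrib algebra_simps add_divide_distrib diff_divide_distrib flip: II_def)
  moreover have "(\<i> * e) ^ 12 = 1" using assms by (simp add: power_mult_distrib)
  ultimately show ?thesis unfolding AA_def
    using assms by (simp add: ta.abs_eq uminus_mw.abs_eq aff_Abs AP_aff)
qed

lemma ta_CC: assumes "e ^ 3 = 1" shows "ta (CC e) = - CC e"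
proof -
  have I: "II ^ 2 = - 1" using kfacts(1) .
  have "map_ec_point tau (CP e) = ec_neg (CP e)"
    using I by (simp add: CP_def QP_def rhomD[OF rhom_tau] tau_simps power_mult_distrib rhom_field[OF rhom_tau])
  then show ?thesis unfolding CC_def
    using assms by (simp add: ta.abs_eq uminus_mw.abs_eq aff_Abs CP_aff)
qed

text \<open>For a line this is the coplanarity of its \<open>om\<close>-orbit. The solutions form a
  subgroup, so the relation extends to every point.\<close>

lemma om_sum: "x + om x + om (om x) = 0"
proof -
  have om0: "om 0 = 0" using om_add[of 0 0] by simp
  have omm: "om (- a) = - om a" for a
    using om_add[of a "- a"] om0 by (metis add.right_inverse add_eq_0_iff)
  interpret mw_subgroup "{x. x + om x + om (om x) = 0}"
  proof
    show "0 \<in> {x. x + om x + om (om x) = 0}" by (simp add: om0)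
    fix a b assume h: "a \<in> {x. x + om x + om (om x) = 0}"
    then have "a + om a + om (om a) = 0" by simp
    moreover have "- a + om (- a) + om (om (- a)) = - (a + om a + om (om a))" unfolding omm by simp
    ultimately show "- a \<in> {x. x + om x + om (om x) = 0}" by (simp only: mem_Collect_eq minus_zero)
    assume h': "b \<in> {x. x + om x + om (om x) = 0}"
    have "a + b + om (a + b) + om (om (a + b)) = (a + om a + om (om a)) + (b + om b + om (om b))"
      by (simp add: om_add algebra_simps)
    also have "\<dots> = 0" using h h' by simp
    finally show "a + b \<in> {x. x + om x + om (om x) = 0}" by (simp only: mem_Collect_eq)
  next
    fix e :: complex assume e: "e ^ 12 = 1"
    then have "(zeta3 * e) ^ 12 = 1" using zeta3_pow by (simp add: power_mult_distrib)
    then show "AA e \<in> {x. x + om x + om (om x) = 0}"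
      using AA_sum[OF e] e by (simp add: om_AA power2_eq_square mult.assoc)
  next
    fix e :: complex assume e: "e ^ 3 = 1"
    then have e': "(zeta3 * e) ^ 3 = 1" using zeta3_facts by (simp add: power_mult_distrib)
    have z: "zeta3 ^ 3 = 1" "zeta3 ^ 2 + zeta3 + 1 = 0" using zeta3_facts by auto
    have "(e - 1) * (e - zeta3) * (e - zeta3 ^ 2) = e ^ 3 - 1" using z by Groebner_Basis.algebra
    then have "e = 1 \<or> e = zeta3 \<or> e = zeta3 ^ 2" using e by auto
    moreover have "zeta3 * zeta3 = zeta3 ^ 2" "zeta3 * zeta3 ^ 2 = 1"
      using z by (simp_all add: power2_eq_square power3_eq_cube mult.assoc)
    ultimately have "CC e + CC (zeta3 * e) + CC (zeta3 * (zeta3 * e)) = 0"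
      using CC_sum by (auto simp: add.assoc add.commute add.left_commute)
    then show "CC e \<in> {x. x + om x + om (om x) = 0}"
      using e e' by (simp add: om_CC)
  qed
  show ?thesis using all_in_subgroup by blast
qed

lemma om_om: "om (om x) = - x - om x"
  using om_sum[of x] by (simp add: add_eq_0_iff)


section \<open>Reduction at a root of t^4 + 1\<close>

definition t0 :: complex where "t0 = csqrt \<i>"

lemma t0_sq: "t0 ^ 2 = \<i>" unfolding t0_def by (rule power2_csqrt)

text \<open>A relation, because z may have a pole at \<open>t0\<close>; uniqueness is
  \<open>val_unique\<close>.\<close>

definition val :: "ratfun \<Rightarrow> complex \<Rightarrow> bool" where
  "val z v \<longleftrightarrow> (\<exists>n d. z = Fract n d \<and> poly d t0 \<noteq> 0 \<and> poly n t0 = v * poly d t0)"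

lemma val_unique: assumes "val z v" "val z v'" shows "v = v'"
proof -
  obtain n d n' d' where h: "z = Fract n d" "poly d t0 \<noteq> 0" "poly n t0 = v * poly d t0"
    "z = Fract n' d'" "poly d' t0 \<noteq> 0" "poly n' t0 = v' * poly d' t0"
    using assms unfolding val_def by metis
  then have "n * d' = n' * d" by (metis eq_fract(1) poly_0)
  then have "poly n t0 * poly d' t0 = poly n' t0 * poly d t0" by (metis poly_mult)
  then show ?thesis using h by simp
qed

lemma val_to_fract: "val (to_fract p) (poly p t0)"
  unfolding val_def to_fract_def by (intro exI[of _ p] exI[of _ 1]) simp

lemma val_cst: "val (cst c) c" using val_to_fract[of "[:c:]"] by (simp add: cst_def)
lemma val_tt: "val tt t0" using val_to_fract[of "[:0, 1:]"] by (simp add: tt_def)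
lemma val_numeral: "val (numeral n) (numeral n)" using val_cst[of "numeral n"] by simp

lemma val_add: assumes "val z v" "val z' v'" shows "val (z + z') (v + v')"
proof -
  obtain n d n' d' where h: "z = Fract n d" "poly d t0 \<noteq> 0" "poly n t0 = v * poly d t0"
    "z' = Fract n' d'" "poly d' t0 \<noteq> 0" "poly n' t0 = v' * poly d' t0"
    using assms unfolding val_def by metis
  then have "d \<noteq> 0" "d' \<noteq> 0" by auto
  then show ?thesis unfolding val_def using h
    by (intro exI[of _ "n * d' + n' * d"] exI[of _ "d * d'"]) (auto simp: algebra_simps)
qed

lemma val_mult: assumes "val z v" "val z' v'" shows "val (z * z') (v * v')"
proof -
  obtain n d n' d' where h: "z = Fract n d" "poly d t0 \<noteq> 0" "poly n t0 = v * poly d t0"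
    "z' = Fract n' d'" "poly d' t0 \<noteq> 0" "poly n' t0 = v' * poly d' t0"
    using assms unfolding val_def by metis
  then show ?thesis unfolding val_def by (intro exI[of _ "n * n'"] exI[of _ "d * d'"]) auto
qed

lemma val_diff: assumes "val z v" "val z' v'" shows "val (z - z') (v - v')"
  using val_add[OF assms(1) val_mult[OF val_cst[of "- 1"] assms(2)]] by simp

lemma val_divide: assumes "val z v" "val z' v'" "v' \<noteq> 0" shows "val (z / z') (v / v')"
proof -
  obtain n d n' d' where h: "z = Fract n d" "poly d t0 \<noteq> 0" "poly n t0 = v * poly d t0"
    "z' = Fract n' d'" "poly d' t0 \<noteq> 0" "poly n' t0 = v' * poly d' t0"
    using assms unfolding val_def by metis
  then show ?thesis unfolding val_def using assms(3)
    by (intro exI[of _ "n * d'"] exI[of _ "d * n'"]) auto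
qed

lemma val_power: "val z v \<Longrightarrow> val (z ^ n) (v ^ n)"
  using val_cst[of 1] by (induction n) (auto intro: val_mult)

lemma val_b4: "val b4 0"
proof -
  have "val (tt ^ 4 + cst 1) (t0 ^ 4 + 1)" by (intro val_add val_power val_tt val_cst)
  moreover have "t0 ^ 4 = (t0 ^ 2) ^ 2" by (simp flip: power_mult)
  ultimately show ?thesis using kfacts(6) t0_sq by simp
qed

definition xval :: "mw \<Rightarrow> complex \<Rightarrow> bool" where
  "xval x v \<longleftrightarrow> (\<exists>a b. Rep_mw x = Pt a b \<and> val a v)"

text \<open>At a root of \<open>t^4 + 1\<close> the reduced curve is the cusp \<open>y^2 = x^3\<close>, whose smooth points form
  an additive group with parameter \<open>x / y\<close>; doubling a point divides the value of \<open>x\<close> by 4.\<close>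

lemma xval_double:
  assumes "xval x v" "v \<noteq> 0"
  shows "xval (x + x) (v / 4)"
proof -
  obtain a b where ab: "Rep_mw x = Pt a b" "val a v" using assms(1) by (auto simp: xval_def)
  have P: "Pt a b \<in> aff" using Rep_mw[of x] ab(1) by (simp add: on_curve_cases)
  have b: "b ^ 2 = a ^ 3 + b4" using affE(2)[OF P] by simp
  have nb: "b \<noteq> - b" using neg_ne[OF P] by auto
  have "Rep_mw (x + x) = line_point (3 * a ^ 2 / (2 * b)) a b a"
    using ab(1) nb by (simp add: plus_mw.rep_eq)
  moreover have "val ((3 * a ^ 2 / (2 * b)) ^ 2 - a - a) (v / 4)"
  proof -
    have e: "(3 * a ^ 2 / (2 * b)) ^ 2 - a - a = 9 * a ^ 4 / (4 * (a ^ 3 + b4)) - a - a"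
      unfolding b[symmetric] by (simp add: power_divide power_mult_distrib flip: power_mult)
    have v9: "val (9 * a ^ 4 / (4 * (a ^ 3 + b4)) - a - a) (9 * v ^ 4 / (4 * (v ^ 3 + 0)) - v - v)"
      using assms(2)
      by (intro val_diff val_divide val_mult val_numeral val_power val_add val_b4 ab(2)) simp
    have eq: "9 * v ^ 4 / (4 * (v ^ 3 + 0)) - v - v = v / 4"
      using assms(2) by (simp add: field_simps power4_eq_xxxx power3_eq_cube)
    from v9 show ?thesis unfolding e eq .
  qed
  ultimately show ?thesis by (auto simp: xval_def line_point_def Let_def)
qed

text \<open>The multiples by 2^k have the distinct values v / 4^k, so there are infinitely many of
  them; a torsion point has only finitely many multiples.\<close>

lemma not_torsion:
  assumes "xval x v" "v \<noteq> 0" "zm N x = 0"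
  shows "N = 0"
proof (rule ccontr)
  assume N: "N \<noteq> 0"
  define m where "m = nat \<bar>N\<bar>"
  have m: "m > 0" using N by (simp add: m_def)
  have nm0: "nm m x = 0" using assms(3) N by (auto simp: zm_def m_def abs_if split: if_splits)
  have pv: "xval (nm (2 ^ k) x) (v / 4 ^ k)" for k
  proof (induction k)
    case 0 then show ?case using assms(1) by simp
  next
    case (Suc k)
    have "xval (nm (2 ^ k) x + nm (2 ^ k) x) (v / 4 ^ k / 4)"
      using xval_double[OF Suc] assms(2) by simp
    moreover have "nm (2 ^ Suc k) x = nm (2 ^ k) x + nm (2 ^ k) x" by (simp add: mult_2 nm_add)
    ultimately show ?case by (simp add: mult.commute)
  qed
  have red: "nm k x = nm (k mod m) x" for k
  proof -
    have "nm k x = nm (k div m * m + k mod m) x" by simp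
    then show ?thesis unfolding nm_add nm_mult nm0 by simp
  qed
  have "range (\<lambda>k. nm (2 ^ k) x) \<subseteq> (\<lambda>k. nm k x) ` {..<m}"
  proof clarify
    fix k show "nm (2 ^ k) x \<in> (\<lambda>k. nm k x) ` {..<m}"
      using red[of "2 ^ k"] m by (intro image_eqI[of _ _ "2 ^ k mod m"]) auto
  qed
  then have "finite (range (\<lambda>k. nm (2 ^ k) x))" by (rule finite_subset) simp
  moreover have "inj (\<lambda>k::nat. nm (2 ^ k) x)"
  proof (rule injI)
    fix i j :: nat assume "nm (2 ^ i) x = nm (2 ^ j) x"
    then obtain a b where "Rep_mw (nm (2 ^ j) x) = Pt a b" "val a (v / 4 ^ i)" "val a (v / 4 ^ j)"
      using pv[of i] pv[of j] unfolding xval_def by auto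
    then have "v / 4 ^ i = v / 4 ^ j" using val_unique by blast
    then have "(4::complex) ^ i = 4 ^ j" using assms(2) by (simp add: field_simps)
    then have "(4::nat) ^ i = 4 ^ j" by (metis of_nat_eq_iff of_nat_numeral of_nat_power)
    then show "i = j" by simp
  qed
  ultimately show False using finite_imageD by (metis infinite_UNIV_nat)
qed

text \<open>The complex multiplication \<open>om\<close> makes the Mordell-Weil group a module over the Eisenstein
  integers, in which \<open>act u v\<close> is multiplication by \<open>u + v zeta3\<close>.\<close>

definition act :: "int \<Rightarrow> int \<Rightarrow> mw \<Rightarrow> mw" where "act u v x = zm u x + zm v (om x)"

lemma om_zm: "om (zm n x) = zm n (om x)" by (rule additive_zm[where f = om, OF om_add])

lemma act_add: "act u v (x + y) = act u v x + act u v y"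
  by (simp add: act_def om_add zm_distrib)
lemma act_add_left: "act (u + u') (v + v') x = act u v x + act u' v' x"
  by (simp add: act_def zm_add)
lemma act_minus: "act (- u) (- v) x = - act u v x" "act u v (- x) = - act u v x"
proof -
  have "om (- x) = - om x" using om_add[of x "- x"] om_add[of 0 0] by (metis add.right_inverse add_eq_0_iff add_cancel_right_right)
  then show "act (- u) (- v) x = - act u v x" "act u v (- x) = - act u v x"
    by (simp_all add: act_def zm_minus zm_minus_left)
qed
lemma act_act: "act u v (act u' v' x) = act (u * u' - v * v') (u * v' + v * u' - v * v') x"
proof -
  have "act u v (act u' v' x) = zm (u * u') x + zm (u * v') (om x) + zm (v * u') (om x) + zm (v * v') (om (om x))"
    by (simp only: act_def om_add om_zm zm_distrib zm_mult add.assoc)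
  then show ?thesis unfolding om_om
    by (simp add: act_def zm_add zm_diff_left zm_diff_right zm_minus algebra_simps)
qed

text \<open>Applying the conjugate u - v - v zeta3 of u + v zeta3 leaves an integer multiple, by the
  norm u^2 - u v + v^2.\<close>

lemma act_not_torsion:
  assumes "xval x w" "w \<noteq> 0" "act u v x = 0"
  shows "u = 0 \<and> v = 0"
proof -
  have "act (u - v) (- v) (act u v x) = 0" using assms(3) by (simp add: act_def om_zm om_add[of 0 0, simplified])
  then have "act (u * u - u * v + v * v) 0 x = 0" unfolding act_act by (simp add: algebra_simps)
  then have "u * u - u * v + v * v = 0" using not_torsion[OF assms(1,2)] by (simp add: act_def)
  then have "(2 * u - v) ^ 2 + 3 * v ^ 2 = 0" by (simp add: power2_eq_square algebra_simps)
  then have "v ^ 2 = 0" "(2 * u - v) ^ 2 = 0"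
    using zero_le_power2[of "2 * u - v"] zero_le_power2[of v] by linarith+
  then show ?thesis by simp
qed


lemma Rep_CC: "e ^ 3 = 1 \<Longrightarrow> Rep_mw (CC e) = CP e"
  using CP_aff[of e] by (simp add: CC_def Abs_mw_inverse on_curve_cases)
lemma Rep_AA: "e ^ 12 = 1 \<Longrightarrow> Rep_mw (AA e) = AP e"
  using AP_aff[of e] by (simp add: AA_def Abs_mw_inverse on_curve_cases)

lemma xval_CC: "xval (CC 1) (- 1)"
  using val_cst[of "- 1"] by (auto simp: xval_def Rep_CC CP_def QP_def)

lemma t0_ne0: "t0 \<noteq> 0" using t0_sq by auto

lemma val_consts: "val ss (alpha1 * t0)" "val SS sqrt3" "val aa alpha1"
  unfolding ss_def aa_def SS_def by (intro val_mult val_cst val_tt)+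

text \<open>As \<open>alpha1\<close> is real, a vanishing value would give an equation whose real
  part is 24 sqrt3 = 40. The point is a difference because \<open>ta\<close> composed with itself
  maps it to its negative.\<close>

lemma xval_D: "\<exists>v. v \<noteq> 0 \<and> xval (AA 1 - AA (- 1)) v"
proof -
  define x1 x2 where "x1 = ss + (SS - cst 1)" and "x2 = (SS - cst 1) - ss"
  define y1 y2 where "y1 = aa ^ 2 * (ss + SS) / 2 + tt ^ 2" and "y2 = aa ^ 2 * (SS - ss) / 2 + tt ^ 2"
  have R: "Rep_mw (AA 1) = Pt x1 y1" "Rep_mw (- AA (- 1)) = Pt x2 (- y2)"
    by (simp_all add: Rep_AA uminus_mw.rep_eq AP_def QP_def x1_def x2_def y1_def y2_def algebra_simps)
  define vx1 vx2 where "vx1 = alpha1 * t0 + (sqrt3 - 1)" and "vx2 = (sqrt3 - 1) - alpha1 * t0"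
  define vy1 vy2 where "vy1 = alpha1 ^ 2 * (alpha1 * t0 + sqrt3) / 2 + t0 ^ 2"
    and "vy2 = alpha1 ^ 2 * (sqrt3 - alpha1 * t0) / 2 + t0 ^ 2"
  have v: "val x1 vx1" "val x2 vx2" unfolding x1_def x2_def vx1_def vx2_def
    by (intro val_add val_diff val_consts val_cst)+
  have v': "val y1 vy1" "val y2 vy2" unfolding y1_def y2_def vy1_def vy2_def
    by (intro val_add val_diff val_consts val_mult val_divide val_power val_tt val_numeral; simp)+
  have ne: "vx2 - vx1 \<noteq> 0" using alpha1_ne0 t0_ne0 by (simp add: vx1_def vx2_def)
  then have n: "x1 \<noteq> x2" using v val_unique by auto
  define l where "l = (cst 0 - y2 - y1) / (x2 - x1)"
  define v where "v = ((0 - vy2 - vy1) / (vx2 - vx1)) ^ 2 - vx1 - vx2"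
  have "Rep_mw (AA 1 - AA (- 1)) = line_point l x1 y1 x2"
    unfolding minus_mw_def plus_mw.rep_eq R using n by (simp add: l_def)
  moreover have "val (l ^ 2 - x1 - x2) v" unfolding l_def v_def
    by (intro val_diff val_power val_divide v v' val_cst ne)
  ultimately have "xval (AA 1 - AA (- 1)) v" by (auto simp: xval_def line_point_def Let_def)
  moreover have "v \<noteq> 0"
  proof
    assume "v = 0"
    then have "(vy2 + vy1) ^ 2 = (vx1 + vx2) * (vx2 - vx1) ^ 2"
    proof -
      have "((0 - vy2 - vy1) / (vx2 - vx1)) ^ 2 = vx1 + vx2" using \<open>v = 0\<close> unfolding v_def
        by (metis diff_diff_eq eq_iff_diff_eq_0)
      then have "(0 - vy2 - vy1) ^ 2 = (vx1 + vx2) * (vx2 - vx1) ^ 2"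
        unfolding power_divide using ne by (simp only: divide_eq_eq power_eq_0_iff) simp
      moreover have "(0 - vy2 - vy1) ^ 2 = (vy2 + vy1) ^ 2" by (simp add: power2_eq_square algebra_simps)
      ultimately show ?thesis by simp
    qed
    moreover have "vy2 + vy1 = alpha1 ^ 2 * sqrt3 + 2 * \<i>"
      unfolding vy1_def vy2_def t0_sq by (simp add: algebra_simps add_divide_distrib diff_divide_distrib)
    moreover have "(vx2 - vx1) ^ 2 = 4 * alpha1 ^ 2 * \<i>"
    proof -
      have "vx2 - vx1 = - 2 * (alpha1 * t0)" by (simp add: vx1_def vx2_def)
      then show ?thesis by (simp add: power_mult_distrib t0_sq)
    qed
    moreover have "vx1 + vx2 = 2 * (sqrt3 - 1)" by (simp add: vx1_def vx2_def)
    ultimately have q1: "(alpha1 ^ 2 * sqrt3 + 2 * \<i>) ^ 2 = 2 * (sqrt3 - 1) * (4 * alpha1 ^ 2 * \<i>)" by simp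
    have q2: "(alpha1 ^ 2 * sqrt3 + 2 * \<i>) ^ 2 = 3 * alpha1 ^ 4 - 4 + 4 * alpha1 ^ 2 * sqrt3 * \<i>"
    proof -
      have "(a ^ 2 * s + 2 * j) ^ 2 = 3 * a ^ 4 - 4 + 4 * a ^ 2 * s * j" if "s ^ 2 = 3" "j ^ 2 = - 1"
        for a s j :: complex using that by (simp add: power2_sum power_mult_distrib flip: power_mult)
      from this[OF sqrt3_sq] show ?thesis by simp
    qed
    from q1 have e: "3 * (8 * sqrt3 - 12) - 4 = \<i> * (4 * alpha1 ^ 2 * (sqrt3 - 2))"
      unfolding q2 alpha1_pow4 by (simp add: algebra_simps)
    obtain A where A: "alpha1 = complex_of_real A" unfolding alpha1_def by blast
    have "Re (3 * (8 * sqrt3 - 12) - 4) = Re (\<i> * (4 * alpha1 ^ 2 * (sqrt3 - 2)))" unfolding e ..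
    then have "24 * sqrt 3 - 40 = 0" by (simp add: A power2_eq_square)
    then have "sqrt 3 = 5 / 3" by simp
    then have "(3::real) = (5 / 3) ^ 2" by (metis real_sqrt_pow2 zero_le_numeral)
    then show False by (simp add: power2_eq_square)
  qed
  ultimately show ?thesis by blast
qed

text \<open>Otherwise the exponent of 3 would be even on the left and odd on the right.\<close>

lemma int_sq_eq_3_sq:
  fixes x y :: int
  assumes "x ^ 2 = 3 * y ^ 2"
  shows "y = 0"
proof (rule ccontr)
  assume y: "y \<noteq> 0"
  have p: "prime_elem (3 :: int)" by simp
  have x: "x \<noteq> 0" using assms y by auto
  have "2 * multiplicity 3 x = multiplicity 3 (x ^ 2)"
    using p x by (simp add: prime_elem_multiplicity_power_distrib)
  also have "\<dots> = 1 + 2 * multiplicity 3 y"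
    using p y by (simp add: assms prime_elem_multiplicity_mult_distrib prime_elem_multiplicity_power_distrib)
  finally show False by presburger
qed

text \<open>The hypotheses say m^2 + n^2 = 0 for m = p + q zeta3 and n = r + s zeta3, so this
  expresses that -1 is not a square in Q(zeta3). Writing 2 m = x + q sqrt(-3) separates the two
  components.\<close>

lemma eisenstein_sum_squares:
  fixes p q r s :: int
  assumes "p * p - q * q + (r * r - s * s) = 0" "p * q + q * p - q * q + (r * s + s * r - s * s) = 0"
  shows "p = 0 \<and> q = 0 \<and> r = 0 \<and> s = 0"
proof -
  define x z where "x = 2 * p - q" and "z = 2 * r - s"
  have 1: "x ^ 2 - 3 * q ^ 2 + (z ^ 2 - 3 * s ^ 2) = 0"
    using assms by (simp add: x_def z_def power2_eq_square algebra_simps)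
  have 2: "x * q + z * s = 0" using assms by (simp add: x_def z_def algebra_simps)
  have "(z ^ 2 - 3 * q ^ 2) * (s ^ 2 + q ^ 2) = 0" using 1 2 by Groebner_Basis.algebra
  then consider "z ^ 2 = 3 * q ^ 2" | "s ^ 2 + q ^ 2 = 0" by auto
  then have "q = 0 \<and> s = 0 \<and> x = 0 \<and> z = 0"
  proof cases
    case 1
    then have q: "q = 0" by (rule int_sq_eq_3_sq)
    then have z: "z = 0" using 1 by simp
    then have s: "x ^ 2 = 3 * s ^ 2" using \<open>x ^ 2 - 3 * q ^ 2 + (z ^ 2 - 3 * s ^ 2) = 0\<close> q by simp
    then have "s = 0" by (rule int_sq_eq_3_sq)
    then show ?thesis using q z s by simp
  next
    case 2
    then have "s = 0" "q = 0" by (simp_all add: sum_power2_eq_zero_iff)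
    then show ?thesis using 1 \<open>x ^ 2 - 3 * q ^ 2 + (z ^ 2 - 3 * s ^ 2) = 0\<close> by (simp add: sum_power2_eq_zero_iff)
  qed
  then show ?thesis by (simp add: x_def z_def)
qed

lemma ta_act: "ta (act u v x) = act u v (ta x)"
  by (simp add: act_def ta_add ta_om additive_zm[where f = ta, OF ta_add])

lemma sum3_zero: assumes "x + y + z = (0 :: mw)" shows "y = - x - z"
proof -
  have "y + (x + z) = 0" using assms by (simp add: ac_simps)
  then have "y = - (x + z)" by (simp only: eq_neg_iff_add_eq_0)
  then show ?thesis by simp
qed

text \<open>Minus the image of the relation under \<open>ta\<close>, which sends \<open>AA 1\<close>
  to minus \<open>AA\<close> at i, and \<open>AA\<close> at i to - AA (-1) = CC 1 + AA 1.\<close>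

lemma ta_relation:
  assumes "act a1 a2 (CC 1) + act m1 m2 (AA 1) + act n1 n2 (AA \<i>) = 0"
  shows "act (a1 - n1) (a2 - n2) (CC 1) + act (- n1) (- n2) (AA 1) + act m1 m2 (AA \<i>) = 0"
proof -
  have "CC 1 + AA 1 + AA (- 1) = 0" using AA_CC[of 1] by simp
  then have m: "- AA (- 1) = CC 1 + AA 1" by (metis add.commute minus_unique)
  have t: "ta (CC 1) = - CC 1" "ta (AA 1) = - AA \<i>" "ta (AA \<i>) = CC 1 + AA 1"
    using ta_CC[of 1] ta_AA[of 1] ta_AA[of "\<i>"] m by simp_all
  have "ta 0 = 0" using ta_add[of 0 0] by simp
  then have "ta (act a1 a2 (CC 1) + act m1 m2 (AA 1) + act n1 n2 (AA \<i>)) = 0" unfolding assms .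
  then have e: "- act a1 a2 (CC 1) - act m1 m2 (AA \<i>) + (act n1 n2 (CC 1) + act n1 n2 (AA 1)) = 0"
    by (simp add: ta_add ta_act t act_minus act_add)
  have "act (a1 - n1) (a2 - n2) (CC 1) = act a1 a2 (CC 1) - act n1 n2 (CC 1)"
    using act_add_left[of a1 "- n1" a2 "- n2" "CC 1"] by (simp add: act_minus)
  then have "act (a1 - n1) (a2 - n2) (CC 1) + act (- n1) (- n2) (AA 1) + act m1 m2 (AA \<i>)
      = - (- act a1 a2 (CC 1) - act m1 m2 (AA \<i>) + (act n1 n2 (CC 1) + act n1 n2 (AA 1)))"
    by (simp add: act_minus)
  then show ?thesis unfolding e by simp
qed

text \<open>Two applications of \<open>ta_relation\<close> fix \<open>CC 1\<close> and negate
  \<open>?D\<close> and its companion \<open>?E\<close>, so adding the outcome to the original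
  relation isolates \<open>CC 1\<close>. What remains gives (m^2 + n^2) \<open>?D\<close> =
  0.\<close>

lemma eisenstein_independent:
  assumes R: "act a1 a2 (CC 1) + act m1 m2 (AA 1) + act n1 n2 (AA \<i>) = 0"
  shows "a1 = 0 \<and> a2 = 0 \<and> m1 = 0 \<and> m2 = 0 \<and> n1 = 0 \<and> n2 = 0"
proof -
  let ?c = "CC 1" and ?a = "AA 1" and ?d = "AA \<i>"
  let ?D = "AA 1 - AA (- 1)"
  note R1 = ta_relation[OF R]
  note R2 = ta_relation[OF R1]
  have "act (a1 + (a1 - n1 - m1)) (a2 + (a2 - n2 - m2)) ?c =
      act a1 a2 ?c + act (a1 - n1 - m1) (a2 - n2 - m2) ?c" by (rule act_add_left)
  also have "\<dots> = (act a1 a2 ?c + act m1 m2 ?a + act n1 n2 ?d) +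
      (act (a1 - n1 - m1) (a2 - n2 - m2) ?c + act (- m1) (- m2) ?a + act (- n1) (- n2) ?d)"
    by (simp add: act_minus)
  finally have "act (a1 + (a1 - n1 - m1)) (a2 + (a2 - n2 - m2)) ?c =
      (act a1 a2 ?c + act m1 m2 ?a + act n1 n2 ?d) +
      (act (a1 - n1 - m1) (a2 - n2 - m2) ?c + act (- m1) (- m2) ?a + act (- n1) (- n2) ?d)" .
  then have "act (a1 + (a1 - n1 - m1)) (a2 + (a2 - n2 - m2)) ?c = 0" unfolding R R2 by simp
  from act_not_torsion[OF xval_CC _ this]
  have s: "2 * a1 = m1 + n1" "2 * a2 = m2 + n2" by auto
  have "?c + ?a + AA (- 1) = 0" using AA_CC[of 1] by simp
  then have D: "?D = ?c + ?a + ?a" by (simp add: algebra_simps add_eq_0_iff)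
  have "CC 1 + ?d + AA (- \<i>) = 0" using AA_CC[of "\<i>"] by simp
  have two: "act (2 * u) (2 * v) x = act u v x + act u v x" for u v x
    using act_add_left[of u u v v x] by simp
  \<comment> \<open>Doubling the relation lets \<open>CC 1\<close> be absorbed into CC 1 + 2 AA 1
    and its analogue at i, which \<open>ta\<close> permutes up to sign.\<close>
  have rel: "act p q ?D + act r s (?c + ?d + ?d) = 0"
    if "act e1 e2 ?c + act p q ?a + act r s ?d = 0" "2 * e1 = p + r" "2 * e2 = q + s" for e1 e2 p q r s
  proof -
    have "act p q ?c + act r s ?c = act (2 * e1) (2 * e2) ?c" unfolding that(2,3) by (simp add: act_add_left)
    also have "\<dots> = act e1 e2 ?c + act e1 e2 ?c" by (rule two)
    finally have x: "act p q ?c + act r s ?c = act e1 e2 ?c + act e1 e2 ?c" .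
    have "act p q ?D + act r s (?c + ?d + ?d) = (act p q ?c + act r s ?c) + (act p q ?a + act p q ?a)
        + (act r s ?d + act r s ?d)"
      unfolding D act_add by (simp add: algebra_simps)
    also have "\<dots> = (act e1 e2 ?c + act p q ?a + act r s ?d) + (act e1 e2 ?c + act p q ?a + act r s ?d)"
      unfolding x by (simp add: algebra_simps)
    finally show ?thesis unfolding that(1) by simp
  qed
  let ?E = "?c + ?d + ?d"
  have r1: "act m1 m2 ?D + act n1 n2 ?E = 0" by (rule rel[OF R s])
  have r2: "act (- n1) (- n2) ?D + act m1 m2 ?E = 0" by (rule rel[OF R1]) (use s in auto)
  have r1': "act m1 m2 ?D = - act n1 n2 ?E" using r1 by (simp only: eq_neg_iff_add_eq_0)
  have "act m1 m2 ?E - act n1 n2 ?D = 0" using r2 by (simp only: act_minus(1)) simp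
  then have r2': "act m1 m2 ?E = act n1 n2 ?D" by (simp only: right_minus_eq)
  have "act m1 m2 (act m1 m2 ?D) = - act m1 m2 (act n1 n2 ?E)" by (simp only: r1' act_minus(2))
  also have "act m1 m2 (act n1 n2 ?E) = act n1 n2 (act m1 m2 ?E)"
    unfolding act_act by (simp only: mult.commute add.commute)
  also have "\<dots> = act n1 n2 (act n1 n2 ?D)" by (simp only: r2')
  finally have "act m1 m2 (act m1 m2 ?D) + act n1 n2 (act n1 n2 ?D) = 0" by (simp only: eq_neg_iff_add_eq_0)
  then have "act (m1 * m1 - m2 * m2 + (n1 * n1 - n2 * n2))
      (m1 * m2 + m2 * m1 - m2 * m2 + (n1 * n2 + n2 * n1 - n2 * n2)) ?D = 0"
    unfolding act_act act_add_left .
  then have "m1 = 0 \<and> m2 = 0 \<and> n1 = 0 \<and> n2 = 0"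
    using xval_D act_not_torsion eisenstein_sum_squares by blast
  then show ?thesis using s by simp
qed

text \<open>Over Z[zeta3] the six points lie in the span of \<open>CC 1\<close>, \<open>AA 1\<close>
  and \<open>AA\<close> at i. The resulting coefficients depend on n1, ..., n6 by an invertible
  integral substitution.\<close>

theorem generators_independent:
  assumes "zm n1 (CC 1) + zm n2 (CC zeta3) + zm n3 (AA 1) + zm n4 (AA zeta12) + zm n5 (AA zeta6) + zm n6 (AA \<i>) = 0"
  shows "n1 = 0 \<and> n2 = 0 \<and> n3 = 0 \<and> n4 = 0 \<and> n5 = 0 \<and> n6 = 0"
proof -
  let ?c = "CC 1" and ?a = "AA 1" and ?d = "AA \<i>"
  have w: "CC zeta3 = om ?c" using om_CC[of 1] by simp
  have zi: "zeta3 * \<i> = - zeta12" by (simp add: zeta3_def zeta12_def field_simps)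
  have 1: "AA zeta12 = - om ?c - om ?d"
    using sum3_zero[OF AA_CC[OF zeta12_facts(2)]] om_AA[of "\<i>"]
    by (simp add: zeta12_facts w zi)
  have "(zeta12 ^ 2) ^ 12 = (zeta12 ^ 12) ^ 2" "(zeta12 ^ 2) ^ 4 = (zeta12 ^ 4) ^ 2" by (simp_all flip: power_mult)
  then have 6: "zeta6 ^ 12 = 1" "zeta6 ^ 4 = zeta3 ^ 2" by (simp_all add: zeta12_facts)
  have z6: "zeta6 = zeta3 + 1" by (simp add: zeta6_def zeta3_def field_simps)
  have "(zeta3 + 1) + zeta3 ^ 2 = 0" using zeta3_facts(4) by (simp only: ac_simps)
  then have m6: "- zeta6 = zeta3 ^ 2" unfolding z6 by (rule minus_unique)
  have cc: "CC (zeta3 ^ 2) = om (om ?c)" and aa: "AA (zeta3 ^ 2) = om (om ?a)"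
    using om_CC[of 1] om_CC[OF zeta3_facts(1)] om_AA[of 1] om_AA[OF zeta3_pow(1)] by (simp_all add: power2_eq_square)
  have 2: "AA zeta6 = ?c + om ?c + ?a + om ?a"
    using sum3_zero[OF AA_CC[OF 6(1)]] unfolding 6(2) m6 cc aa om_om by (simp add: algebra_simps)
  have "act (n1 + n5) (n2 - n4 + n5) ?c + act (n3 + n5) n5 ?a + act n6 (- n4) ?d = 0"
    using assms unfolding w 1 2
    by (simp add: act_def zm_add zm_diff_left zm_minus_left zm_diff_right zm_distrib zm_minus algebra_simps)
  from eisenstein_independent[OF this] show ?thesis by auto
qed

section \<open>The minimal polynomial\<close>

text \<open>A root of \<open>g4\<close> in \<open>Q(i, alpha1)\<close>, found numerically. That it is a root is seen by descending
  the tower of quadratic extensions, eliminating \<open>a\<close> first, then \<open>a\<^sup>2\<close>, then the remaining square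
  roots.\<close>

definition theta :: complex where
  "theta = (2 + sqrt3) / 4 - alpha1 ^ 2 / 8 + \<i> * (1 / 4 + (2 + sqrt3) / 8 * alpha1 ^ 2)
     + alpha1 * ((1 + sqrt3) / 8 - (3 + sqrt3) / 16 * alpha1 ^ 2
       + \<i> * ((3 + sqrt3) / 8 + (1 + sqrt3) / 16 * alpha1 ^ 2))"

lemma theta_quadratic:
  fixes S i a :: "'a::field_char_0"
  assumes S: "S * S = 3" and i: "i * i = - 1" and a: "a ^ 4 = 8 * S - 12"
    and x: "16 * x = 4 * (2 + S) - 2 * a ^ 2 + i * (4 + 2 * (2 + S) * a ^ 2)
     + a * (2 * (1 + S) - (3 + S) * a ^ 2 + i * (2 * (3 + S) + (1 + S) * a ^ 2))"
  shows "2 * (4 * x ^ 2 - 2 * (2 + S + i) * x + (3 + S + i + i * S))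
     = a ^ 2 * (2 * (i * (2 + S) - 1) * x + (1 + S - 3 * i - i * S))"
proof -
  define b where "b = a * a"
  have b: "b * b = 8 * S - 12" using a by (simp add: b_def power4_eq_xxxx mult.assoc)
  have r: "S * (S * z) = 3 * z" "i * (i * z) = - z" "b * (b * z) = (8 * S - 12) * z" for z
    using S i b by (simp_all flip: mult.assoc)
  \<comment> \<open>Even and odd part in a, so that squaring \<open>16 * x - A\<close> leaves only
    even powers of a.\<close>
  define A B where "A = 4 * (2 + S) - 2 * b + i * (4 + 2 * (2 + S) * b)"
    and "B = 2 * (1 + S) - (3 + S) * b + i * (2 * (3 + S) + (1 + S) * b)"
  have x': "16 * x = A + a * B" unfolding x A_def B_def b_def power2_eq_square by simp
  have "(16 * x - A) * (16 * x - A) = b * (B * B)" unfolding x' b_def by (simp add: algebra_simps)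
  moreover have "(16 * x - A) * (16 * x - A) = 256 * (x * x) - 32 * A * x + A * A" by (simp add: algebra_simps)
  ultimately have "256 * (x * x) - 32 * A * x + A * A = b * (B * B)" by simp
  then have e: "256 * (x * x) - 32 * A * x + (A * A - b * (B * B)) = 0" by (simp add: add_diff_eq)
  have V: "A * A - b * (B * B) = 64 * (3 + S + i + i * S) - 32 * (b * (1 + S - 3 * i - i * S))"
    unfolding A_def B_def by (simp add: algebra_simps S i b r)
  then have "32 * (2 * (4 * x ^ 2 - 2 * (2 + S + i) * x + (3 + S + i + i * S)))
     - 32 * (b * (2 * (i * (2 + S) - 1) * x + (1 + S - 3 * i - i * S))) = 0"
    using e unfolding V unfolding A_def power2_eq_square by (simp add: algebra_simps)
  then have "32 * (2 * (4 * x ^ 2 - 2 * (2 + S + i) * x + (3 + S + i + i * S)))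
     = 32 * (b * (2 * (i * (2 + S) - 1) * x + (1 + S - 3 * i - i * S)))" by (simp only: right_minus_eq)
  then show ?thesis unfolding mult_cancel_left b_def power2_eq_square by simp
qed

lemma theta_quartic:
  fixes S i a x :: "'a::field_char_0"
  assumes S: "S * S = 3" and i: "i * i = - 1" and a: "a ^ 4 = 8 * S - 12"
    and x: "2 * (4 * x ^ 2 - 2 * (2 + S + i) * x + (3 + S + i + i * S))
     = a ^ 2 * (2 * (i * (2 + S) - 1) * x + (1 + S - 3 * i - i * S))" (is "2 * ?X = _ * ?R")
  shows "(2 * x ^ 4 - 2 * (2 + S) * x ^ 3 + (9 + 3 * S) * x ^ 2 - 4 * (1 + S) * x + (1 + S))
     + i * (- 2 * x ^ 3 + (3 + 3 * S) * x ^ 2 - 4 * (1 + S) * x + (3 + S)) = 0" (is "?G = 0")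
proof -
  have r: "S * (S * z) = 3 * z" "i * (i * z) = - z" for z using S i by (simp_all flip: mult.assoc)
  have "(2 * ?X) * (2 * ?X) = a ^ 4 * (?R * ?R)"
    unfolding x by (simp add: power4_eq_xxxx power2_eq_square)
  then have "(2 * ?X) * (2 * ?X) - (8 * S - 12) * (?R * ?R) = 0" unfolding a by (simp only: right_minus_eq)
  moreover have "(2 * ?X) * (2 * ?X) - (8 * S - 12) * (?R * ?R) = 32 * ?G"
    unfolding power2_eq_square power3_eq_cube power4_eq_xxxx by (simp add: algebra_simps S i r)
  ultimately have "32 * ?G = 0" by (simp only:)
  then show ?thesis unfolding mult_eq_0_iff by simp
qed

lemma theta_degree16:
  fixes S i x :: "'a::field_char_0"
  assumes S: "S * S = 3" and i: "i * i = - 1"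
    and x: "(2 * x ^ 4 - 2 * (2 + S) * x ^ 3 + (9 + 3 * S) * x ^ 2 - 4 * (1 + S) * x + (1 + S))
     + i * (- 2 * x ^ 3 + (3 + 3 * S) * x ^ 2 - 4 * (1 + S) * x + (3 + S)) = 0" (is "?p + i * ?q = 0")
  shows "x ^ 16 - 8 * x ^ 15 + 38 * x ^ 14 - 120 * x ^ 13 + 272 * x ^ 12 - 436 * x ^ 11 + 472 * x ^ 10
    - 264 * x ^ 9 - 62 * x ^ 8 + 216 * x ^ 7 - 128 * x ^ 6 - 8 * x ^ 5 + 56 * x ^ 4 - 48 * x ^ 3
    + 32 * x ^ 2 - 16 * x + 4 = 0"
proof -
  have r: "S * (S * z) = 3 * z" for z using S by (simp flip: mult.assoc)
  \<comment> \<open>4 (u + sqrt3 v) is the product with the conjugate under i -> -i. Its norm from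
    Q(sqrt3), u^2 - 3 v^2, is the polynomial of degree 16.\<close>
  define u v where "u = x ^ 8 - 4 * x ^ 7 + 17 * x ^ 6 - 34 * x ^ 5 + 61 * x ^ 4 - 68 * x ^ 3 + 50 * x ^ 2 - 20 * x + 4"
    and "v = - 2 * x ^ 7 + 7 * x ^ 6 - 22 * x ^ 5 + 35 * x ^ 4 - 40 * x ^ 3 + 28 * x ^ 2 - 12 * x + 2"
  have "(?p + i * ?q) * (?p - i * ?q) = ?p * ?p - (i * i) * (?q * ?q)" by (simp only: algebra_simps)
  then have "?p * ?p + ?q * ?q = 0" unfolding x i by simp
  moreover have "?p * ?p + ?q * ?q = 4 * (u + S * v)"
    unfolding u_def v_def by (simp add: algebra_simps S r power_numeral_even power_numeral_odd)
  ultimately have "4 * (u + S * v) = 0" by (simp only:)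
  then have uv: "u + S * v = 0" unfolding mult_eq_0_iff by simp
  have "(u + S * v) * (u - S * v) = u * u - S * S * (v * v)" by (simp add: algebra_simps)
  then have "u * u - 3 * (v * v) = 0" unfolding S uv by simp
  then show ?thesis unfolding u_def v_def
    by (simp add: algebra_simps power_numeral_even power_numeral_odd)
qed


section \<open>Gauss's lemma and irreducibility at the prime 2\<close>

abbreviation rat_poly_of_int :: "int poly \<Rightarrow> rat poly" where "rat_poly_of_int \<equiv> map_poly of_int"

lemma rpi_simps: "rat_poly_of_int (smult c p) = smult (of_int c) (rat_poly_of_int p)"
  "rat_poly_of_int (pCons c p) = pCons (of_int c) (rat_poly_of_int p)"
  "rat_poly_of_int (p + q) = rat_poly_of_int p + rat_poly_of_int q"
  "rat_poly_of_int (p * q) = rat_poly_of_int p * rat_poly_of_int q"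
  "degree (rat_poly_of_int p) = degree p"
  "rat_poly_of_int p = rat_poly_of_int q \<longleftrightarrow> p = q"
proof -
  show 1: "rat_poly_of_int (smult c p) = smult (of_int c) (rat_poly_of_int p)" for c p
    by (simp add: poly_eq_iff coeff_map_poly)
  show "rat_poly_of_int (pCons c p) = pCons (of_int c) (rat_poly_of_int p)"
    by (simp add: map_poly_pCons)
  show "rat_poly_of_int (p + q) = rat_poly_of_int p + rat_poly_of_int q"
    by (simp add: poly_eq_iff coeff_map_poly)
  show "rat_poly_of_int (p * q) = rat_poly_of_int p * rat_poly_of_int q"
    by (simp add: poly_eq_iff coeff_map_poly coeff_mult)
  show "degree (rat_poly_of_int p) = degree p"
    by (rule degree_map_poly) simp
  show "rat_poly_of_int p = rat_poly_of_int q \<longleftrightarrow> p = q"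
    by (simp add: poly_eq_iff coeff_map_poly)
qed

lemma clear_denominators: "\<exists>m A. m \<noteq> 0 \<and> smult (of_int m) p = rat_poly_of_int A"
proof (induction p rule: pCons_induct)
  case 0
  then show ?case by (intro exI[of _ 1] exI[of _ 0]) simp
next
  case (pCons c p)
  then obtain m A where mA: "m \<noteq> 0" "smult (of_int m) p = rat_poly_of_int A" by blast
  obtain u v where q: "quotient_of c = (u, v)" by force
  then have v: "v \<noteq> 0" "c = of_int u / of_int v"
    using quotient_of_denom_pos[OF q] quotient_of_div[OF q] by auto
  have "smult (of_int (m * v)) (pCons c p) = rat_poly_of_int (pCons (m * u) (smult v A))"
    using v mA(2)[symmetric] by (simp add: rpi_simps mult.commute)
  then show ?case using mA(1) v(1) by (metis mult_eq_0_iff)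
qed

text \<open>The contents of the cleared factors multiply to the absolute value of m n, so the
  primitive parts multiply to g up to sign.\<close>

lemma gauss_factor:
  fixes a b :: "rat poly" and g :: "int poly"
  assumes ab: "a * b = rat_poly_of_int g" and g: "content g = 1"
  shows "\<exists>A B. A * B = g \<and> degree A = degree a \<and> degree B = degree b"
proof -
  obtain m A where A: "m \<noteq> 0" "smult (of_int m) a = rat_poly_of_int A" using clear_denominators by blast
  obtain n B where B: "n \<noteq> 0" "smult (of_int n) b = rat_poly_of_int B" using clear_denominators by blast
  have "rat_poly_of_int (A * B) = rat_poly_of_int (smult (m * n) g)"
    by (simp add: rpi_simps ab[symmetric] A(2)[symmetric] B(2)[symmetric] mult.commute)
  then have AB: "A * B = smult (m * n) g" by (simp only: rpi_simps(6))
  define c where "c = content A * content B"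
  have c: "c = \<bar>m * n\<bar>"
    using arg_cong[OF AB, of content] g by (simp add: content_mult c_def)
  then have c0: "c \<noteq> 0" using A(1) B(1) by simp
  let ?A = "primitive_part A" and ?B = "primitive_part B"
  have "smult c (?A * ?B) = smult (content A) ?A * smult (content B) ?B"
    by (simp only: mult_smult_left mult_smult_right smult_smult c_def mult.commute[of "content A"])
  also have "\<dots> = A * B" by (simp only: content_times_primitive_part)
  also have "\<dots> = smult c (smult (sgn (m * n)) g)"
    unfolding AB c by (simp only: smult_smult abs_mult_sgn)
  finally have "smult c (?A * ?B) = smult c (smult (sgn (m * n)) g)" .
  then have e: "?A * ?B = smult (sgn (m * n)) g" using smult_cancel[OF c0] by blast
  have "sgn (m * n) * sgn (m * n) = 1" using A(1) B(1) by (simp add: sgn_mult sgn_if)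
  then have "(smult (sgn (m * n)) ?A) * ?B = g" using e by simp
  moreover have "degree ?A = degree a"
    using A rpi_simps(5)[of A] by (metis degree_primitive_part degree_smult_eq of_int_eq_0_iff)
  moreover have "degree ?B = degree b"
    using B rpi_simps(5)[of B] by (metis degree_primitive_part degree_smult_eq of_int_eq_0_iff)
  moreover have "sgn (m * n) \<noteq> 0" using A(1) B(1) by (simp add: sgn_eq_0_iff)
  ultimately show ?thesis by (metis degree_smult_eq)
qed

definition g4i :: "int poly" where
  "g4i = [:4, -16, 32, -48, 56, -8, -128, 216, -62, -264, 472, -436, 272, -120, 38, -8, 1:]"

lemma g4_int: "g4 = rat_poly_of_int g4i" by (simp add: g4_def g4i_def rpi_simps)

lemma degree_g4i: "degree g4i = 16" by (simp add: g4i_def)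

lemma coeff_g4i:
  "coeff g4i 16 = 1" "n < 16 \<Longrightarrow> even (coeff g4i n)"
  "1 \<le> n \<Longrightarrow> n < 8 \<Longrightarrow> 4 dvd coeff g4i n" "coeff g4i 0 = 4"
  "coeff g4i 8 = -62"
proof -
  define L :: "int list" where
    "L = [4, -16, 32, -48, 56, -8, -128, 216, -62, -264, 472, -436, 272, -120, 38, -8, 1]"
  have c: "coeff g4i k = nth_default 0 L k" for k
  proof -
    have "g4i = Poly L" by (simp add: g4i_def L_def)
    then have "coeff g4i k = coeff (Poly L) k" by (rule arg_cong)
    then show ?thesis unfolding coeff_Poly_eq .
  qed
  show "coeff g4i 16 = 1" "coeff g4i 0 = 4" "coeff g4i 8 = -62"
    by (simp_all add: c L_def nth_default_def)
  have "list_all (\<lambda>k. even (nth_default 0 L k)) [0..<16]"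
    "list_all (\<lambda>k. 4 dvd nth_default 0 L k) [1..<8]"
    unfolding L_def by (simp_all add: upt_rec nth_default_def)
  then show "n < 16 \<Longrightarrow> even (coeff g4i n)" "1 \<le> n \<Longrightarrow> n < 8 \<Longrightarrow> 4 dvd coeff g4i n"
    by (auto simp: c list_all_iff)
qed

text \<open>The Newton polygon of \<open>g4\<close> at 2 has slope 1/8 and its residual polynomial \<open>y^2 + y + 1\<close> is
  irreducible modulo 2. In terms of a factorization: all lower coefficients of both factors are
  even, and comparing the coefficient of the smaller degree modulo 4 gives a contradiction.\<close>

lemma lower_coeffs_even:
  fixes A B :: "int poly"
  assumes AB: "\<And>n. n < degree A + degree B \<Longrightarrow> even (coeff (A * B) n)"
    and lc: "odd (lead_coeff A)" "odd (lead_coeff B)"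
  shows "n < degree A \<Longrightarrow> even (coeff A n)"
    "n < degree B \<Longrightarrow> even (coeff B n)"
proof -
  \<comment> \<open>Modulo 2 the product is a monomial: the lowest odd coefficients of A and B
    produce an odd coefficient at i + j, which can only be the leading one.\<close>
  define i where "i = (LEAST k. odd (coeff A k))"
  define j where "j = (LEAST k. odd (coeff B k))"
  have i: "odd (coeff A i)" "\<And>k. k < i \<Longrightarrow> even (coeff A k)" "i \<le> degree A"
    unfolding i_def using LeastI[of "\<lambda>k. odd (coeff A k)", OF lc(1)]
      not_less_Least[of _ "\<lambda>k. odd (coeff A k)"] Least_le[of "\<lambda>k. odd (coeff A k)", OF lc(1)]
    by blast+
  have j: "odd (coeff B j)" "\<And>k. k < j \<Longrightarrow> even (coeff B k)" "j \<le> degree B"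
    unfolding j_def using LeastI[of "\<lambda>k. odd (coeff B k)", OF lc(2)]
      not_less_Least[of _ "\<lambda>k. odd (coeff B k)"] Least_le[of "\<lambda>k. odd (coeff B k)", OF lc(2)]
    by blast+
  have "coeff (A * B) (i + j) = (\<Sum>k\<le>i + j. coeff A k * coeff B (i + j - k))"
    by (rule coeff_mult)
  also have "\<dots> = coeff A i * coeff B j +
      (\<Sum>k\<in>{..i + j} - {i}. coeff A k * coeff B (i + j - k))"
    by (subst sum.remove[of _ i]) auto
  finally have "odd (coeff (A * B) (i + j))"
  proof -
    assume e: "coeff (A * B) (i + j) = coeff A i * coeff B j +
      (\<Sum>k\<in>{..i + j} - {i}. coeff A k * coeff B (i + j - k))"
    have "even (coeff A k * coeff B (i + j - k))" if "k \<in> {..i + j} - {i}" for k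
    proof (cases "k < i")
      case False
      then have "i + j - k < j" using that by auto
      then show ?thesis using j(2) by simp
    qed (simp add: i(2))
    then have "even (\<Sum>k\<in>{..i + j} - {i}. coeff A k * coeff B (i + j - k))"
      by (rule dvd_sum)
    then show ?thesis unfolding e using i(1) j(1) by simp
  qed
  then have "\<not> i + j < degree A + degree B" using AB by blast
  then have "i = degree A" "j = degree B" using i(3) j(3) by auto
  then show "n < degree A \<Longrightarrow> even (coeff A n)"
    "n < degree B \<Longrightarrow> even (coeff B n)" using i(2) j(2) by auto
qed

lemma g4i_no_factor:
  assumes AB: "A * B = g4i" and d: "1 \<le> degree A" "degree A \<le> degree B"
  shows False
proof -
  let ?a = "degree A" and ?b = "degree B"
  have n0: "A \<noteq> 0" "B \<noteq> 0" using AB by (auto simp: g4i_def)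
  have deg: "?a + ?b = 16" using degree_mult_eq[OF n0] degree_g4i AB by simp
  have "lead_coeff A * lead_coeff B = 1"
    using lead_coeff_mult[of A B] AB degree_g4i coeff_g4i(1) by simp
  then have lc: "\<bar>lead_coeff A\<bar> = 1" "\<bar>lead_coeff B\<bar> = 1" by (auto simp: zmult_eq_1_iff)
  then have lco: "odd (lead_coeff A)" "odd (lead_coeff B)" by (auto simp: abs_if split: if_splits)
  have "even (coeff (A * B) n)" if "n < ?a + ?b" for n
    using that deg coeff_g4i(2) AB by simp
  then have ev: "\<And>n. n < ?a \<Longrightarrow> even (coeff A n)" "\<And>n. n < ?b \<Longrightarrow> even (coeff B n)"
    using lower_coeffs_even[of A B] lco by blast+
  have "coeff A 0 * coeff B 0 = 4" using AB coeff_g4i(4) by (metis mult_poly_0 coeff_mult_0)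
  moreover obtain u where u: "coeff A 0 = 2 * u" using ev(1)[of 0] d by (auto elim: evenE)
  moreover obtain v where v: "coeff B 0 = 2 * v" using ev(2)[of 0] d by (auto elim: evenE)
  ultimately have "u * v = 1" by simp
  then have uv: "\<bar>u\<bar> = 1" "\<bar>v\<bar> = 1" by (auto simp: zmult_eq_1_iff)
  have dv4: "4 dvd coeff A k * coeff B (?a - k)" if "k < ?a" "?a - k < ?b" for k
    using mult_dvd_mono[OF ev(1)[OF that(1)] ev(2)[OF that(2)]] by simp
  have c: "coeff g4i ?a = lead_coeff A * (2 * v) + (\<Sum>k<?a. coeff A k * coeff B (?a - k))"
    unfolding AB[symmetric] coeff_mult by (simp add: v flip: lessThan_Suc_atMost)
  show False
  proof (cases "?a = ?b")
    case False
    then have "4 dvd (\<Sum>k<?a. coeff A k * coeff B (?a - k))"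
      using d by (intro dvd_sum dv4) auto
    moreover have "4 dvd coeff g4i ?a" using d deg False by (intro coeff_g4i(3)) auto
    ultimately have "4 dvd lead_coeff A * (2 * v)" unfolding c by (simp add: dvd_add_left_iff)
    then show False using lc(1) uv(2) by (auto simp: abs_if split: if_splits)
  next
    case True
    then have a8: "?a = 8" "?b = 8" using deg by auto
    have "(\<Sum>k<?a. coeff A k * coeff B (?a - k)) =
        2 * u * lead_coeff B + (\<Sum>k\<in>{..<?a} - {0}. coeff A k * coeff B (?a - k))"
      using a8 u by (subst sum.remove[of _ 0]) auto
    moreover have "4 dvd (\<Sum>k\<in>{..<?a} - {0}. coeff A k * coeff B (?a - k))"
      using a8 by (intro dvd_sum dv4) auto
    \<comment> \<open>For equal degrees two terms of the form 2 * odd appear and add up to a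
      multiple of 4, whereas the middle coefficient -62 is 2 modulo 4.\<close>
    moreover have "4 dvd lead_coeff A * (2 * v) + 2 * u * lead_coeff B"
    proof -
      have "odd u" "odd v" using uv by (metis abs_1 dvd_abs_iff odd_one)+
      then have "even (lead_coeff A * v + u * lead_coeff B)" using lco by simp
      then have "2 * 2 dvd 2 * (lead_coeff A * v + u * lead_coeff B)" by (rule mult_dvd_mono[OF dvd_refl])
      then show ?thesis by (simp add: algebra_simps)
    qed
    ultimately have "4 dvd lead_coeff A * (2 * v) + (2 * u * lead_coeff B +
        (\<Sum>k\<in>{..<?a} - {0}. coeff A k * coeff B (?a - k)))"
      and "(\<Sum>k<?a. coeff A k * coeff B (?a - k)) =
        2 * u * lead_coeff B + (\<Sum>k\<in>{..<?a} - {0}. coeff A k * coeff B (?a - k))"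
      unfolding add.assoc[symmetric] by (blast intro: dvd_add)+
    then have "4 dvd coeff g4i ?a" unfolding c by simp
    then show False unfolding a8 coeff_g4i(5) by simp
  qed
qed

lemma irreducible_g4: "Factorial_Ring.irreducible g4"
proof (rule Factorial_Ring.irreducibleI)
  show "g4 \<noteq> 0" by (simp add: g4_def)
  show "\<not> g4 dvd 1" by (simp add: g4_def is_unit_iff_degree)
  fix a b assume ab: "g4 = a * b"
  have n0: "a \<noteq> 0" "b \<noteq> 0" using ab by (auto simp: g4_def)
  have "content g4i dvd coeff g4i 16" by (rule content_dvd_coeff)
  then have "is_unit (content g4i)" by (simp add: coeff_g4i)
  then have "content g4i = 1" using normalize_content[of g4i] is_unit_normalize by metis
  then obtain A B where AB: "A * B = g4i" "degree A = degree a"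
    "degree B = degree b"
    using gauss_factor[of a b g4i] ab g4_int by auto
  have "degree A = 0 \<or> degree B = 0"
    using g4i_no_factor[of A B] g4i_no_factor[of B A] AB(1)
    by (metis One_nat_def Suc_leI gr0I linear mult.commute)
  then show "a dvd 1 \<or> b dvd 1" using n0 AB(2,3) by (auto simp: is_unit_iff_degree)
qed

section \<open>The splitting field\<close>

lemma complex_ring_simps [simp]:
  "carrier complex_ring = UNIV" "x \<otimes>\<^bsub>complex_ring\<^esub> y = x * y" "x \<oplus>\<^bsub>complex_ring\<^esub> y = x + y"
  "\<one>\<^bsub>complex_ring\<^esub> = 1" "\<zero>\<^bsub>complex_ring\<^esub> = 0"
  by (simp_all add: ring_of_type_algebra_def)

lemma complex_ring_inv: "\<ominus>\<^bsub>complex_ring\<^esub> x = - x" "x \<noteq> 0 \<Longrightarrow> inv\<^bsub>complex_ring\<^esub> x = inverse x"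
proof -
  interpret field "complex_ring :: complex ring" by (rule field_from_type_algebra)
  show "\<ominus>\<^bsub>complex_ring\<^esub> x = - x" by (rule minus_equality) auto
  show "x \<noteq> 0 \<Longrightarrow> inv\<^bsub>complex_ring\<^esub> x = inverse x" by (rule inv_unique'[symmetric]) auto
qed

definition csub :: "complex set \<Rightarrow> bool" where
  "csub F \<longleftrightarrow> 1 \<in> F \<and> (\<forall>x\<in>F. \<forall>y\<in>F. x - y \<in> F \<and> x * y \<in> F) \<and> (\<forall>x\<in>F. inverse x \<in> F)"

lemma csubD:
  assumes "csub F"
  shows "1 \<in> F" "0 \<in> F" "x \<in> F \<Longrightarrow> y \<in> F \<Longrightarrow> x + y \<in> F" "x \<in> F \<Longrightarrow> y \<in> F \<Longrightarrow> x - y \<in> F"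
    "x \<in> F \<Longrightarrow> y \<in> F \<Longrightarrow> x * y \<in> F" "x \<in> F \<Longrightarrow> - x \<in> F" "x \<in> F \<Longrightarrow> inverse x \<in> F"
    "x \<in> F \<Longrightarrow> y \<in> F \<Longrightarrow> x / y \<in> F" "x \<in> F \<Longrightarrow> x ^ n \<in> F" "of_nat n \<in> F" "numeral m \<in> F" "of_rat q \<in> F"
proof -
  show 1: "1 \<in> F" and d: "\<And>x y. x \<in> F \<Longrightarrow> y \<in> F \<Longrightarrow> x - y \<in> F" and m: "\<And>x y. x \<in> F \<Longrightarrow> y \<in> F \<Longrightarrow> x * y \<in> F"
    and i: "\<And>x. x \<in> F \<Longrightarrow> inverse x \<in> F" using assms by (auto simp: csub_def)
  show 0: "0 \<in> F" using d[OF 1 1] by simp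
  show n: "- x \<in> F" if "x \<in> F" for x using d[OF 0 that] by simp
  show a: "x + y \<in> F" if "x \<in> F" "y \<in> F" for x y using d[OF that(1) n[OF that(2)]] by simp
  show dv: "x / y \<in> F" if "x \<in> F" "y \<in> F" for x y
    using m[OF that(1) i[OF that(2)]] by (simp add: divide_inverse)
  show "x ^ n \<in> F" if "x \<in> F" using that 1 m by (induction n) auto
  show on: "of_nat n \<in> F" for n using 0 1 a by (induction n) auto
  from on[of "numeral m"] show "numeral m \<in> F" by simp
  have oi: "of_int k \<in> F" for k using on n by (cases k rule: int_cases2) auto
  obtain u v where q: "quotient_of q = (u, v)" by force
  then have "of_rat q = (of_int u / of_int v :: complex)"
    using quotient_of_div[OF q] by (simp add: of_rat_divide)
  then show "of_rat q \<in> F" using dv oi by simp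
qed

lemma subfield_iff_csub: "subfield F complex_ring \<longleftrightarrow> csub F"
proof -
  interpret field "complex_ring :: complex ring" by (rule field_from_type_algebra)
  show ?thesis
  proof
    assume h: "subfield F complex_ring"
    note s = subringE[OF subfieldE(1)[OF h]]
    have "inverse x \<in> F" if "x \<in> F" for x
      using subfield_m_inv(1)[OF h, of x] that s(2) complex_ring_inv(2)[of x] by (cases "x = 0") auto
    moreover have "x - y \<in> F" if "x \<in> F" "y \<in> F" for x y
      using s(7)[OF that(1) s(5)[OF that(2)]] by (simp add: complex_ring_inv)
    ultimately show "csub F" using s(3,6) by (simp add: csub_def)
  next
    assume h: "csub F"
    note c = csubD[OF h]
    show "subfield F complex_ring"
    proof (rule subfieldI')
      show "subring F complex_ring"
        by (rule subringI) (use c in \<open>auto simp: complex_ring_inv\<close>)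
      show "inv\<^bsub>complex_ring\<^esub> k \<in> F" if "k \<in> F - {\<zero>\<^bsub>complex_ring\<^esub>}" for k
        using that c(7) by (simp add: complex_ring_inv)
    qed
  qed
qed

section \<open>The field generated by the root\<close>

lemma rhom_of_rat: "rhom (of_rat :: rat \<Rightarrow> complex)"
  by (simp add: rhom_def of_rat_add of_rat_mult)

definition evq :: "rat poly \<Rightarrow> complex" where "evq = heval of_rat theta"

lemma rhom_evq: "rhom evq" unfolding evq_def by (rule rhom_heval[OF rhom_of_rat])

lemma evq_pCons: "evq (pCons c p) = of_rat c + theta * evq p"
  by (simp add: evq_def heval_pCons[OF rhom_of_rat])

lemma evq_0 [simp]: "evq 0 = 0" by (simp add: evq_def)


lemma sqrt3_mult: "sqrt3 * sqrt3 = 3" using sqrt3_sq by (simp add: power2_eq_square)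

lemma theta_root: "evq g4 = 0"
proof -
  have i: "\<i> * \<i> = (- 1 :: complex)" by simp
  have x: "16 * theta = 4 * (2 + sqrt3) - 2 * alpha1 ^ 2 + \<i> * (4 + 2 * (2 + sqrt3) * alpha1 ^ 2)
     + alpha1 * (2 * (1 + sqrt3) - (3 + sqrt3) * alpha1 ^ 2 + \<i> * (2 * (3 + sqrt3) + (1 + sqrt3) * alpha1 ^ 2))"
    unfolding theta_def by (simp add: field_simps)
  note theta_degree16[OF sqrt3_mult i theta_quartic[OF sqrt3_mult i alpha1_pow4
    theta_quadratic[OF sqrt3_mult i alpha1_pow4 x]]]
  moreover have "evq g4 = theta ^ 16 - 8 * theta ^ 15 + 38 * theta ^ 14 - 120 * theta ^ 13 + 272 * theta ^ 12
     - 436 * theta ^ 11 + 472 * theta ^ 10 - 264 * theta ^ 9 - 62 * theta ^ 8 + 216 * theta ^ 7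
     - 128 * theta ^ 6 - 8 * theta ^ 5 + 56 * theta ^ 4 - 48 * theta ^ 3 + 32 * theta ^ 2 - 16 * theta + 4"
    unfolding g4_def evq_pCons evq_0 by (simp add: algebra_simps of_rat_neg_numeral_eq eval_nat_numeral)
  ultimately show ?thesis by simp
qed

text \<open>A polynomial not divisible by the irreducible \<open>g4\<close> is coprime to it, and a
  Bezout identity evaluated at \<open>theta\<close> excludes a common zero.\<close>

lemma evq_eq_0_iff: "evq p = 0 \<longleftrightarrow> g4 dvd p"
proof
  assume h: "evq p = 0"
  show "g4 dvd p"
  proof (rule ccontr)
    assume "\<not> g4 dvd p"
    then obtain u v where "u * g4 + v * p = 1" using field_poly_bezout[OF irreducible_g4] by blast
    then have "evq (u * g4 + v * p) = 1" by (simp add: rhomD[OF rhom_evq])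
    then show False using h theta_root by (simp add: rhomD[OF rhom_evq])
  qed
qed (auto simp: rhomD[OF rhom_evq] theta_root)

definition K4 :: "complex set" where "K4 = range evq"

lemma csub_K4: "csub K4"
  unfolding csub_def
proof (intro conjI ballI)
  note r = rhomD[OF rhom_evq]
  show "1 \<in> K4" unfolding K4_def using r(2) by (metis rangeI)
  fix x y assume "x \<in> K4" "y \<in> K4"
  then obtain p q where "x = evq p" "y = evq q" by (auto simp: K4_def)
  then show "x - y \<in> K4" "x * y \<in> K4" unfolding K4_def using r(4,6) by (metis rangeI)+
next
  note r = rhomD[OF rhom_evq]
  fix x assume "x \<in> K4"
  then obtain p where p: "x = evq p" by (auto simp: K4_def)
  show "inverse x \<in> K4"
  proof (cases "x = 0")
    case True
    then show ?thesis using \<open>x \<in> K4\<close> by simp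
  next
    case False
    then have "\<not> g4 dvd p" using p evq_eq_0_iff by simp
    then obtain u v where "u * g4 + v * p = 1" using field_poly_bezout[OF irreducible_g4] by blast
    then have "evq (u * g4 + v * p) = 1" by (simp add: r)
    then have "evq v * x = 1" by (simp add: r theta_root p)
    then have "inverse x = evq v" using False by (simp add: field_simps)
    then show ?thesis by (simp add: K4_def)
  qed
qed

lemma degree_g4: "degree g4 = 16" by (simp add: g4_def)

text \<open>The fields \<open>Q(theta)\<close> and \<open>Q(i, alpha1)\<close> agree because the first has dimension 16 and the
  second is spanned by 16 elements.\<close>

interpretation qv: vector_space "\<lambda>(r::rat) (z::complex). of_rat r * z"
  by unfold_locales (simp_all add: of_rat_add of_rat_mult algebra_simps)

definition basis16 :: "complex set" where "basis16 = (\<lambda>(a, b). \<i> ^ a * alpha1 ^ b) ` ({..<2} \<times> {..<8})"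

lemma finite_basis16: "finite basis16" "card basis16 \<le> 16"
proof -
  show "finite basis16" by (simp add: basis16_def)
  have "card basis16 \<le> card ({..<2::nat} \<times> {..<8::nat})" unfolding basis16_def by (rule card_image_le) simp
  then show "card basis16 \<le> 16" by simp
qed

lemma basis16_mem: "a < 2 \<Longrightarrow> b < 8 \<Longrightarrow> \<i> ^ a * alpha1 ^ b \<in> qv.span basis16"
  by (intro qv.span_base) (auto simp: basis16_def)

text \<open>The square of alpha1^4 + 12 = 8 sqrt3; it is the reason why eight powers of
  \<open>alpha1\<close> suffice in \<open>basis16\<close>.\<close>

lemma alpha1_pow8: "alpha1 ^ 8 = 48 - 24 * alpha1 ^ 4"
proof -
  have "alpha1 ^ 8 = (alpha1 ^ 4) ^ 2" by (simp flip: power_mult)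
  then show ?thesis unfolding alpha1_pow4 using sqrt3_mult by (simp add: power2_eq_square algebra_simps)
qed

lemma span_scale': "z \<in> qv.span B \<Longrightarrow> of_rat r * z \<in> qv.span B" by (rule qv.span_scale)

lemma span16_mult_closed:
  assumes "\<And>b. b \<in> basis16 \<Longrightarrow> c * b \<in> qv.span basis16" "z \<in> qv.span basis16"
  shows "c * z \<in> qv.span basis16"
  using assms(2)
proof (induction rule: qv.span_induct_alt)
  case base
  then show ?case using qv.span_zero by simp
next
  case (step r b z)
  then show ?case using assms(1)[of b] qv.span_add span_scale'[of "c * b" basis16 r]
    by (simp add: algebra_simps)
qed

lemma span16_i: "z \<in> qv.span basis16 \<Longrightarrow> \<i> * z \<in> qv.span basis16"
proof (rule span16_mult_closed)
  fix z assume "z \<in> basis16"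
  then obtain a b where ab: "z = \<i> ^ a * alpha1 ^ b" "a < 2" "b < 8" by (auto simp: basis16_def)
  show "\<i> * z \<in> qv.span basis16"
  proof (cases "a = 0")
    case True
    then show ?thesis using basis16_mem[of 1 b] ab by simp
  next
    case False
    then have "\<i> * z = of_rat (- 1) * (\<i> ^ 0 * alpha1 ^ b)" using ab by (simp add: less_2_cases_iff of_rat_minus)
    also have "\<dots> \<in> qv.span basis16" using ab(3) by (intro span_scale' basis16_mem) auto
    finally show ?thesis .
  qed
qed

lemma span16_alpha: "z \<in> qv.span basis16 \<Longrightarrow> alpha1 * z \<in> qv.span basis16"
proof (rule span16_mult_closed)
  fix z assume "z \<in> basis16"
  then obtain a b where ab: "z = \<i> ^ a * alpha1 ^ b" "a < 2" "b < 8" by (auto simp: basis16_def)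
  show "alpha1 * z \<in> qv.span basis16"
  proof (cases "b = 7")
    case False
    then show ?thesis using basis16_mem[of a "Suc b"] ab by (simp add: mult.left_commute)
  next
    case True
    then have "alpha1 * z = \<i> ^ a * alpha1 ^ 8" using ab by (simp add: eval_nat_numeral)
    also have "\<dots> = of_rat 48 * (\<i> ^ a * alpha1 ^ 0) - of_rat 24 * (\<i> ^ a * alpha1 ^ 4)"
      unfolding alpha1_pow8 by (simp add: algebra_simps)
    also have "\<dots> \<in> qv.span basis16"
      using ab(2) by (intro qv.span_diff span_scale' basis16_mem) auto
    finally show ?thesis .
  qed
qed

text \<open>The multiplier ring of the span. Closure under products is immediate, and applying a
  multiplier to 1 shows that it lies in the span.\<close>

definition V16 :: "complex set" where "V16 = {c. \<forall>z\<in>qv.span basis16. c * z \<in> qv.span basis16}"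

lemma V16_closed: "of_rat r \<in> V16" "x \<in> V16 \<Longrightarrow> y \<in> V16 \<Longrightarrow> x + y \<in> V16" "x \<in> V16 \<Longrightarrow> y \<in> V16 \<Longrightarrow> x - y \<in> V16"
  "x \<in> V16 \<Longrightarrow> y \<in> V16 \<Longrightarrow> x * y \<in> V16" "\<i> \<in> V16" "alpha1 \<in> V16"
  using span16_i span16_alpha
  by (auto simp: V16_def qv.span_add qv.span_diff distrib_right left_diff_distrib mult.assoc span_scale')

lemma V16_power: "x \<in> V16 \<Longrightarrow> x ^ n \<in> V16"
  using V16_closed(1)[of 1] by (induction n) (auto intro: V16_closed)

lemma V16_span: "x \<in> V16 \<Longrightarrow> x \<in> qv.span basis16"
  using basis16_mem[of 0 0] unfolding V16_def by force

lemma sqrt3_alpha: "sqrt3 = (alpha1 ^ 4 + 12) / 8" using alpha1_pow4 by simp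

lemma theta_V16: "theta \<in> V16"
proof -
  have n: "numeral k \<in> V16" "1 / numeral k \<in> V16" for k
    using V16_closed(1)[of "numeral k"] V16_closed(1)[of "1 / numeral k"] by (simp_all add: of_rat_divide)
  have o: "1 \<in> V16" using V16_closed(1)[of 1] by simp
  have dv: "x / numeral k \<in> V16" if "x \<in> V16" for x k
    using V16_closed(4)[OF that n(2)[of k]] by simp
  have s: "sqrt3 \<in> V16" unfolding sqrt3_alpha by (intro dv V16_closed V16_power n)
  show ?thesis unfolding theta_def by (intro dv V16_closed V16_power n s o)
qed

definition pows :: "complex set" where "pows = (\<lambda>k. theta ^ k) ` {..<16}"

lemma evq_sum_pows:
  "(\<Sum>k<n. of_rat (c k) * theta ^ k) = evq (\<Sum>k<n. monom (c k) k)"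
proof -
  have m: "evq (monom a k) = of_rat a * theta ^ k" for a k
    by (induction k) (simp_all add: Polynomial.monom_Suc evq_pCons Polynomial.monom_0)
  have "evq (\<Sum>k\<in>A. f k) = (\<Sum>k\<in>A. evq (f k))" if "finite A" for f :: "nat \<Rightarrow> rat poly" and A
    using that by (induction A rule: finite_induct) (auto simp: rhomD[OF rhom_evq])
  then show ?thesis by (simp add: m)
qed

text \<open>A relation is a polynomial of degree at most 15 that \<open>g4\<close> divides.\<close>

lemma pows_zero:
  assumes "(\<Sum>k<16. of_rat (c k) * theta ^ k) = 0" "k < 16"
  shows "c k = 0"
proof -
  let ?p = "\<Sum>k<16. monom (c k) k"
  have co: "coeff ?p n = (if n < 16 then c n else 0)" for n
    by (simp add: coeff_sum sum.delta if_distrib cong: if_cong)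
  have "g4 dvd ?p" using assms(1) unfolding evq_sum_pows evq_eq_0_iff .
  moreover have "degree ?p \<le> 15" by (rule degree_le) (simp add: co)
  ultimately have "?p = 0" using dvd_imp_degree_le[of g4 ?p] degree_g4 by fastforce
  then show ?thesis using co[of k] assms(2) by simp
qed

lemma pows_inj: "inj_on (\<lambda>k. theta ^ k) {..<16}"
proof (rule inj_onI, rule ccontr)
  fix i j :: nat assume h: "i \<in> {..<16}" "j \<in> {..<16}" "theta ^ i = theta ^ j" "i \<noteq> j"
  define c where "c k = (if k = i then 1 else if k = j then - 1 else (0::rat))" for k
  have "(\<Sum>k<16. of_rat (c k) * theta ^ k) = (\<Sum>k\<in>{i, j}. of_rat (c k) * theta ^ k)"
    using h by (intro sum.mono_neutral_right) (auto simp: c_def)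
  also have "\<dots> = 0" using h(3,4) by (simp add: c_def of_rat_minus)
  finally have "c i = 0" using pows_zero h(1) by blast
  then show False by (simp add: c_def)
qed

lemma pows_independent: "\<not> qv.dependent pows"
proof (rule qv.independent_if_scalars_zero)
  show "finite pows" by (simp add: pows_def)
  fix f x assume h: "(\<Sum>x\<in>pows. of_rat (f x) * x) = 0" "x \<in> pows"
  then have "(\<Sum>k<16. of_rat (f (theta ^ k)) * theta ^ k) = 0"
    unfolding pows_def by (subst (asm) sum.reindex[OF pows_inj]) simp
  then show "f x = 0" using pows_zero h(2) by (auto simp: pows_def)
qed

lemma span_pows_K4: "qv.span pows \<subseteq> K4"
proof
  fix z assume "z \<in> qv.span pows"
  then show "z \<in> K4"
  proof (induction rule: qv.span_induct_alt)
    case base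
    show ?case using csubD(2)[OF csub_K4] .
  next
    case (step c x y)
    then obtain k where "x = theta ^ k" by (auto simp: pows_def)
    moreover have "theta \<in> K4" unfolding K4_def by (rule range_eqI[of _ _ "[:0, 1:]"]) (simp add: evq_pCons)
    ultimately show ?case using step csubD[OF csub_K4] by auto
  qed
qed

text \<open>Sixteen independent powers of \<open>theta\<close> in a space spanned by at most sixteen
  elements must span it. This puts i and \<open>alpha1\<close> into Q(theta) without explicit
  formulas.\<close>

lemma span16_K4: "qv.span basis16 \<subseteq> K4"
proof
  fix z assume z: "z \<in> qv.span basis16"
  have p: "pows \<subseteq> qv.span basis16" using theta_V16 V16_power V16_span by (auto simp: pows_def)
  have c: "card pows = 16" unfolding pows_def by (simp add: card_image[OF pows_inj])
  have "z \<in> qv.span pows"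
  proof (rule ccontr)
    assume n: "z \<notin> qv.span pows"
    then have "\<not> qv.dependent (insert z pows)" using pows_independent by (simp add: qv.independent_insert)
    then have "card (insert z pows) \<le> card basis16"
      using qv.independent_span_bound[OF finite_basis16(1)] p z by blast
    moreover have "z \<notin> pows" using n qv.span_base by blast
    ultimately show False using c finite_basis16(2) by (simp add: pows_def)
  qed
  then show "z \<in> K4" using span_pows_K4 by blast
qed

lemma K4_gens: "\<i> \<in> K4" "alpha1 \<in> K4" "sqrt3 \<in> K4"
proof -
  have V: "x \<in> K4" if "x \<in> V16" for x using V16_span[OF that] span16_K4 by blast
  show "\<i> \<in> K4" and a: "alpha1 \<in> K4" using V V16_closed(5,6) by blast+
  show "sqrt3 \<in> K4" unfolding sqrt3_alpha by (intro csubD[OF csub_K4] a)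
qed

lemma K4_consts: "zeta3 \<in> K4" "zeta12 \<in> K4" "zeta6 \<in> K4"
  unfolding zeta3_def zeta12_def zeta6_def by (intro csubD[OF csub_K4] K4_gens)+

lemma K4_minimal:
  assumes F: "csub F" and "\<i> \<in> F" "alpha1 \<in> F"
  shows "K4 \<subseteq> F"
proof
  note c = csubD[OF F]
  have s: "sqrt3 \<in> F" unfolding sqrt3_alpha by (intro c assms)
  have t: "theta \<in> F" unfolding theta_def by (intro c assms s)
  fix z assume "z \<in> K4"
  then obtain p where "z = evq p" by (auto simp: K4_def)
  moreover have "evq p \<in> F" by (induction p rule: pCons_induct) (auto simp: evq_pCons intro!: c t)
  ultimately show "z \<in> F" by simp
qed

lemma generate_field_K4: "generate_field complex_ring (\<rat> \<union> {zeta12, alpha1}) \<subseteq> K4"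
proof -
  interpret field "complex_ring :: complex ring" by (rule field_from_type_algebra)
  have "\<rat> \<subseteq> K4" using csubD(12)[OF csub_K4] by (auto elim: Rats_cases)
  then show ?thesis
    using csub_K4 K4_gens K4_consts by (intro generate_field_min_subfield1) (auto simp: subfield_iff_csub)
qed

text \<open>\<open>dimension\<close> is built by adjoining one vector at a time, so the induction
  runs along the spans \<open>E n\<close> of the first n powers of \<open>theta\<close>.\<close>

lemma degree_K4: "has_degree_over_rat K4 16"
proof -
  interpret field "complex_ring :: complex ring" by (rule field_from_type_algebra)
  define E where "E n = {z. \<exists>c. z = (\<Sum>k<n. of_rat (c k) * theta ^ k)}" for n :: nat
  have "dimension n \<rat> (E n)" if "n \<le> 16" for n
    using that
  proof (induction n)
    case 0
    have "E 0 = {\<zero>\<^bsub>complex_ring\<^esub>}" by (simp add: E_def)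
    then show ?case using zero_dim[of \<rat>] by simp
  next
    case (Suc n)
    have "theta ^ n \<notin> E n"
    proof
      assume "theta ^ n \<in> E n"
      then obtain c where c: "theta ^ n = (\<Sum>k<n. of_rat (c k) * theta ^ k)" by (auto simp: E_def)
      define d where "d k = (if k < n then c k else if k = n then - 1 else 0)" for k
      have "(\<Sum>k<16. of_rat (d k) * theta ^ k) = (\<Sum>k<Suc n. of_rat (d k) * theta ^ k)"
        using Suc.prems by (intro sum.mono_neutral_right) (auto simp: d_def)
      also have "\<dots> = 0" using c by (simp add: d_def of_rat_minus)
      finally have "d n = 0" using pows_zero Suc.prems by simp
      then show False by (simp add: d_def)
    qed
    moreover have "line_extension \<rat> (theta ^ n) (E n) = E (Suc n)"
    proof -
      have "z \<in> E (Suc n) \<longleftrightarrow> (\<exists>k\<in>\<rat>. \<exists>v\<in>E n. z = k * theta ^ n + v)" for z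
      proof
        assume "z \<in> E (Suc n)"
        then obtain c where "z = (\<Sum>k<n. of_rat (c k) * theta ^ k) + of_rat (c n) * theta ^ n" by (auto simp: E_def)
        then show "\<exists>k\<in>\<rat>. \<exists>v\<in>E n. z = k * theta ^ n + v"
          by (intro bexI[of _ "of_rat (c n)"] bexI[of _ "\<Sum>k<n. of_rat (c k) * theta ^ k"]) (auto simp: E_def)
      next
        assume "\<exists>k\<in>\<rat>. \<exists>v\<in>E n. z = k * theta ^ n + v"
        then obtain r c where z: "z = of_rat r * theta ^ n + (\<Sum>k<n. of_rat (c k) * theta ^ k)"
          by (auto simp: E_def elim!: Rats_cases)
        define d where "d k = (if k = n then r else c k)" for k
        have "z = (\<Sum>k<Suc n. of_rat (d k) * theta ^ k)" unfolding z by (simp add: d_def)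
        then show "z \<in> E (Suc n)" unfolding E_def by blast
      qed
      then show ?thesis unfolding line_extension_def set_add_def' r_coset_def by auto
    qed
    ultimately show ?case using Suc.IH Suc.prems Suc_dim[of "theta ^ n" "E n" n \<rat>] by simp
  qed
  moreover have "E 16 = K4"
  proof
    show "E 16 \<subseteq> K4" by (auto simp: E_def evq_sum_pows K4_def)
    show "K4 \<subseteq> E 16"
    proof
      fix z assume "z \<in> K4"
      then obtain p where p: "z = evq p" by (auto simp: K4_def)
      let ?r = "p mod g4"
      have "p = p div g4 * g4 + ?r" by simp
      then have "evq p = evq ?r" using theta_root by (metis add_0 mult_zero_right rhomD(3,4)[OF rhom_evq])
      moreover have "?r = (\<Sum>k<16. Polynomial.monom (Polynomial.coeff ?r k) k)"
      proof (rule poly_eqI)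
        fix n
        have "g4 \<noteq> 0" by (simp add: g4_def)
        then have "?r = 0 \<or> Polynomial.degree ?r < 16" using degree_mod_less[of g4 p] degree_g4 by simp
        then have "Polynomial.coeff ?r n = 0" if "\<not> n < 16" using that by (auto intro: coeff_eq_0)
        then show "Polynomial.coeff ?r n = Polynomial.coeff (\<Sum>k<16. Polynomial.monom (Polynomial.coeff ?r k) k) n"
          by (simp add: coeff_sum sum.delta if_distrib cong: if_cong)
      qed
      ultimately have "z = (\<Sum>k<16. of_rat (Polynomial.coeff ?r k) * theta ^ k)"
        unfolding p evq_sum_pows by metis
      then show "z \<in> E 16" unfolding E_def by blast
    qed
  qed
  ultimately show ?thesis unfolding has_degree_over_rat_def by (metis order_refl)
qed

lemma min_poly_K4: "defining_min_poly K4 g4"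
  unfolding defining_min_poly_def
proof
  show "Factorial_Ring.irreducible g4" by (rule irreducible_g4)
  let ?R = "ring_of_type_algebra :: rat poly ring"
  let ?S = "complex_ring \<lparr> carrier := K4 \<rparr>"
  interpret C: field "complex_ring :: complex ring" by (rule field_from_type_algebra)
  interpret R: cring ?R by (rule cring_from_type_algebra)
  have "subring K4 complex_ring" using csub_K4 by (intro subfieldE(1)) (simp add: subfield_iff_csub)
  then interpret S: ring ?S by (rule C.subring_is_ring)
  note r = rhomD[OF rhom_evq]
  have h: "evq \<in> ring_hom ?R ?S"
    by (rule ring_hom_memI) (auto simp: ring_of_type_algebra_def K4_def r)
  interpret H: ring_hom_ring ?R ?S evq
    by (intro ring_hom_ringI2 h R.ring_axioms S.ring_axioms)
  have "evq ` carrier ?R = carrier ?S" by (simp add: ring_of_type_algebra_def K4_def)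
  moreover have "a_kernel ?R ?S evq = PIdl\<^bsub>?R\<^esub> g4"
  proof -
    have "{r. g4 dvd r} = {x * g4 |x. True}" by (auto elim!: dvdE simp: mult.commute)
    moreover have "a_kernel ?R ?S evq = {r. g4 dvd r}"
      unfolding a_kernel_def' by (simp add: ring_of_type_algebra_def evq_eq_0_iff)
    moreover have "PIdl\<^bsub>?R\<^esub> g4 = {x * g4 |x. True}"
      unfolding cgenideal_def by (simp add: ring_of_type_algebra_def)
    ultimately show ?thesis by simp
  qed
  ultimately show "?R Quot (PIdl\<^bsub>?R\<^esub> g4) \<simeq> ?S" using H.FactRing_iso by (simp only:)
qed

section \<open>The Mordell-Weil lattice\<close>

lemma to_fract_pCons: "to_fract (pCons a p) = cst a + tt * to_fract p"
proof -
  have "pCons a p = [:a:] + [:0, 1:] * p" by simp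
  then show ?thesis unfolding cst_def tt_def by (simp only: to_fract_add to_fract_mult)
qed

lemma Fract_one: "Fract p 1 = to_fract p" by (simp add: to_fract_def)

lemma AP_poly: "AP e = Pt (of_poly [:e ^ 4 * (sqrt3 - 1), e * alpha1:])
    (of_poly [:sqrt3 * alpha1 ^ 2 * e ^ 6 / 2, e ^ 3 * alpha1 ^ 3 / 2, 1:])"
  by (simp add: AP_def QP_def Fract_one to_fract_pCons ss_def aa_def SS_def algebra_simps
      add_divide_distrib power2_eq_square power3_eq_cube)

lemma CP_poly: "CP e = Pt (of_poly [:- e:]) (of_poly [:0, 0, 1:])"
  by (simp add: CP_def QP_def Fract_one to_fract_pCons power2_eq_square)

lemma zeta6_facts: "zeta6 ^ 3 = - 1" "zeta6 ^ 4 = zeta3 ^ 2" "zeta6 ^ 6 = 1" "zeta6 ^ 12 = 1"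
proof -
  have "zeta6 ^ 3 = zeta12 ^ 6" "zeta6 ^ 4 = (zeta12 ^ 4) ^ 2" "zeta6 ^ 6 = zeta12 ^ 12"
    "zeta6 ^ 12 = (zeta12 ^ 12) ^ 2"
    unfolding zeta12_facts(5)[symmetric] by (simp_all flip: power_mult)
  then show "zeta6 ^ 3 = - 1" "zeta6 ^ 4 = zeta3 ^ 2" "zeta6 ^ 6 = 1" "zeta6 ^ 12 = 1"
    by (simp_all add: zeta12_facts)
qed

lemma i_facts: "\<i> ^ 3 = - \<i>" "\<i> ^ 4 = 1" "\<i> ^ 6 = - 1" "\<i> ^ 12 = 1"
  by (simp_all add: eval_nat_numeral)

lemma points: "P1 = CP 1" "P2 = CP zeta3" "P3 = AP 1" "P4 = AP zeta12" "P5 = AP zeta6" "P6 = AP \<i>"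
proof -
  show "P1 = CP 1" "P2 = CP zeta3" by (simp_all add: P1_def P2_def CP_poly)
  show "P3 = AP 1" "P4 = AP zeta12" "P5 = AP zeta6" "P6 = AP \<i>"
    by (simp_all add: P3_def P4_def P5_def P6_def AP_poly zeta12_facts zeta6_facts i_facts)
qed

section \<open>The six points as a basis\<close>

definition gl :: "mw list" where "gl = [CC 1, CC zeta3, AA 1, AA zeta12, AA zeta6, AA \<i>]"

lemma length_gl [simp]: "length gl = 6" by (simp add: gl_def)

lemma gen_pow12: "a \<in> {1, zeta12, zeta6, \<i>} \<Longrightarrow> a ^ 12 = 1"
  using zeta12_facts zeta6_facts i_facts by auto

lemma Rep_gl: "map Rep_mw gl = [P1, P2, P3, P4, P5, P6]"
  using gen_pow12 zeta3_facts(1) by (simp add: gl_def Rep_AA Rep_CC points)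

lemma cube_roots: assumes "z ^ 3 = (1::complex)" shows "z \<in> {1, zeta3, zeta3 ^ 2}"
proof -
  have "(z - 1) * ((z - zeta3) * (z - zeta3 ^ 2)) = z ^ 3 - 1 - (zeta3 ^ 2 + zeta3 + 1) * (z ^ 2 - z)
      + (zeta3 ^ 3 - 1) * (z - 1)"
    by (simp add: eval_nat_numeral algebra_simps)
  then show ?thesis using assms zeta3_facts by simp
qed

text \<open>The cube of e is a fourth root of unity, and 1, \<open>zeta12\<close>,
  \<open>zeta6\<close>, i have the cubes 1, i, -1, -i.\<close>

lemma roots_12:
  assumes "e ^ 12 = 1"
  obtains a where "a \<in> {1, zeta12, zeta6, \<i>}" "e \<in> {a, zeta3 * a, zeta3 ^ 2 * a}"
proof -
  have "(e ^ 3) ^ 4 = 1" using assms by (simp flip: power_mult)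
  moreover have "(e ^ 3) ^ 4 - 1 = (e ^ 3 - 1) * ((e ^ 3 + 1) * ((e ^ 3 - \<i>) * (e ^ 3 + \<i>)))"
    by (simp add: eval_nat_numeral algebra_simps)
  ultimately have "e ^ 3 \<in> {1, - 1, \<i>, - \<i>}" by (auto simp: eq_neg_iff_add_eq_0)
  then obtain a where a: "a \<in> {1, zeta12, zeta6, \<i>}" "e ^ 3 = a ^ 3"
    using zeta12_facts(1) zeta6_facts(1) i_facts(1) by (metis insertCI insertE power_one singletonD)
  have "a \<noteq> 0" using gen_pow12[OF a(1)] by auto
  then have "e / a \<in> {1, zeta3, zeta3 ^ 2}" using a(2) by (intro cube_roots) (simp add: power_divide)
  then have "e \<in> {a, zeta3 * a, zeta3 ^ 2 * a}" using \<open>a \<noteq> 0\<close> by (auto simp: field_simps)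
  then show ?thesis using that a(1) by blast
qed

text \<open>Opposite parameters come from \<open>AA_CC\<close>. For each of the four representatives
  a, one of zeta3 a and zeta3^2 a is minus a representative, and \<open>AA_sum\<close> supplies the
  remaining one.\<close>

lemma mw_subgroupI:
  assumes M: "0 \<in> M" "\<And>a b. a \<in> M \<Longrightarrow> b \<in> M \<Longrightarrow> a + b \<in> M" "\<And>a. a \<in> M \<Longrightarrow> - a \<in> M"
    and g: "set gl \<subseteq> M"
  shows "mw_subgroup M"
proof -
  have t: "z \<in> M" if "x + y + z = 0" "x \<in> M" "y \<in> M" for x y z
  proof -
    have "z = - (x + y)" using that(1) by (metis add_eq_0_iff)
    then show ?thesis using M(2)[of x y] M(3)[of "x + y"] that(2,3) by simp
  qed
  have t': "y \<in> M" if "x + y + z = 0" "x \<in> M" "z \<in> M" for x y z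
    using t[of x z y] that by (simp add: ac_simps)
  have C: "CC e \<in> M" if "e ^ 3 = 1" for e
    using cube_roots[OF that] t[OF CC_sum] g by (auto simp: gl_def)
  have A: "AA a \<in> M" if "a \<in> {1, zeta12, zeta6, \<i>}" for a using that g by (auto simp: gl_def)
  have N: "AA (- a) \<in> M" if "a \<in> {1, zeta12, zeta6, \<i>}" for a
  proof -
    have p: "a ^ 12 = 1" using that by (rule gen_pow12)
    then have "CC (a ^ 4) \<in> M" by (intro C) (simp flip: power_mult)
    then show ?thesis using t[OF AA_CC[OF p]] A[OF that] by blast
  qed
  note z = zeta12_facts
  have q: "zeta12 * zeta12 = zeta6" "zeta6 * zeta12 = \<i>" "zeta12 * (zeta12 * x) = zeta6 * x" for x
    using z(1,5) by (simp_all add: eval_nat_numeral mult.assoc[symmetric])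
  have m: "zeta3 * zeta6 = - 1" "zeta3 ^ 2 = - zeta6" "zeta3 * \<i> = - zeta12" "zeta3 ^ 2 * zeta12 = - \<i>"
  proof -
    have "zeta3 * zeta6 = zeta12 ^ 6" unfolding z(3,5)[symmetric] by (simp flip: power_add)
    then show "zeta3 * zeta6 = - 1" by (simp add: z)
    have "zeta3 ^ 2 = zeta12 ^ 6 * zeta12 ^ 2" unfolding z(3)[symmetric] by (simp flip: power_mult power_add)
    then show b: "zeta3 ^ 2 = - zeta6" by (simp add: z)
    have "zeta3 * \<i> = zeta12 ^ 6 * zeta12" unfolding z(1,3)[symmetric] by (simp flip: power_Suc2 power_add)
    then show "zeta3 * \<i> = - zeta12" by (simp add: z)
    show "zeta3 ^ 2 * zeta12 = - \<i>" unfolding b using q by simp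
  qed
  have "AA e \<in> M" if e: "e ^ 12 = 1" for e
  proof -
    obtain a where a: "a \<in> {1, zeta12, zeta6, \<i>}" "e \<in> {a, zeta3 * a, zeta3 ^ 2 * a}"
      using roots_12[OF e] by blast
    have p: "a ^ 12 = 1" using a(1) by (rule gen_pow12)
    have "AA (zeta3 * a) \<in> M \<and> AA (zeta3 ^ 2 * a) \<in> M"
    proof -
      have "zeta3 ^ 2 * 1 = - zeta6" "zeta3 ^ 2 * zeta12 = - \<i>" "zeta3 * zeta6 = - 1" "zeta3 * \<i> = - zeta12"
        using m by simp_all
      then have "AA (zeta3 * a) \<in> M \<or> AA (zeta3 ^ 2 * a) \<in> M" using a(1) N by (metis insertCI insertE singletonD)
      then show ?thesis using t[OF AA_sum[OF p]] t'[OF AA_sum[OF p]] A[OF a(1)] by blast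
    qed
    then show ?thesis using a A by auto
  qed
  then show ?thesis using M C by unfold_locales auto
qed

lemma gl_independent:
  assumes "(\<Sum>i<6. zm (n i) (gl ! i)) = 0" "i < 6"
  shows "n i = 0"
proof -
  have "zm (n 0) (CC 1) + zm (n 1) (CC zeta3) + zm (n 2) (AA 1) + zm (n 3) (AA zeta12)
      + zm (n 4) (AA zeta6) + zm (n 5) (AA \<i>) = 0"
    using assms(1) by (simp add: gl_def eval_nat_numeral)
  from generators_independent[OF this] show ?thesis using assms(2)
    by (auto simp: eval_nat_numeral less_Suc_eq)
qed

lemma gl_spans: "\<exists>n. x = (\<Sum>i<6. zm (n i) (gl ! i))"
proof -
  let ?M = "{x. \<exists>n. x = (\<Sum>i<6. zm (n i) (gl ! i))}"
  have "mw_subgroup ?M"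
  proof (rule mw_subgroupI)
    show "0 \<in> ?M" by (auto intro!: exI[of _ "\<lambda>_. 0"])
    show "a + b \<in> ?M" if ab: "a \<in> ?M" "b \<in> ?M" for a b
    proof -
      obtain n m where "a = (\<Sum>i<6. zm (n i) (gl ! i))" "b = (\<Sum>i<6. zm (m i) (gl ! i))" using ab by blast
      then have "a + b = (\<Sum>i<6. zm (n i + m i) (gl ! i))" by (simp add: zm_add sum.distrib)
      then show ?thesis by (auto intro: exI[of _ "\<lambda>i. n i + m i"])
    qed
    show "- a \<in> ?M" if aM: "a \<in> ?M" for a
    proof -
      obtain n where "a = (\<Sum>i<6. zm (n i) (gl ! i))" using aM by blast
      then have "- a = (\<Sum>i<6. zm (- n i) (gl ! i))" by (simp add: zm_minus_left sum_negf)
      then show ?thesis by (auto intro: exI[of _ "\<lambda>i. - n i"])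
    qed
    show "set gl \<subseteq> ?M"
    proof
      fix x assume "x \<in> set gl"
      then obtain j where j: "j < 6" "x = gl ! j" by (auto simp: in_set_conv_nth)
      have "(\<Sum>i<6. zm (if i = j then 1 else 0) (gl ! i)) = (\<Sum>i<6. if i = j then gl ! i else 0)"
        by (rule sum.cong) auto
      then show "x \<in> ?M" using j by (auto intro!: exI[of _ "\<lambda>i. if i = j then 1 else 0"])
    qed
  qed
  then have "x \<in> ?M" by (rule mw_subgroup.all_in_subgroup)
  then show ?thesis by blast
qed

lemma distinct_gl: "distinct gl"
proof (rule ccontr)
  assume "\<not> distinct gl"
  then obtain j k where jk: "j < 6" "k < 6" "j \<noteq> k" "gl ! j = gl ! k" by (auto simp: distinct_conv_nth)
  let ?n = "\<lambda>i. if i = j then 1 else if i = k then - 1 else (0::int)"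
  have "(\<Sum>i<6. zm (?n i) (gl ! i)) = (\<Sum>i\<in>{j, k}. zm (?n i) (gl ! i))"
    using jk by (intro sum.mono_neutral_right) auto
  also have "\<dots> = 0" using jk by (simp add: zm_minus_left)
  finally have "?n j = 0" using gl_independent[of ?n j] jk(1) by blast
  then show False by simp
qed

lemma sum_set_gl: "(\<Sum>g\<in>set gl. f g) = (\<Sum>i<6. f (gl ! i))"
  using sum.reindex_bij_betw[OF bij_betw_nth[OF distinct_gl refl refl], of f] by simp

lemma mw_torsion_free:
  fixes x :: mw
  assumes "zm k x = 0" "k \<noteq> 0"
  shows "x = 0"
proof -
  obtain n where n: "x = (\<Sum>i<6. zm (n i) (gl ! i))" using gl_spans by blast
  have s: "zm k (\<Sum>i\<in>A. f i) = (\<Sum>i\<in>A. zm k (f i))" if "finite A" for A :: "nat set" and f :: "nat \<Rightarrow> mw"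
    using that by (induction A rule: finite_induct) (auto simp: zm_distrib)
  have "(\<Sum>i<6. zm (k * n i) (gl ! i)) = 0" using assms(1) unfolding n by (simp add: s zm_mult)
  from gl_independent[OF this] have "n i = 0" if "i < 6" for i using that assms(2) by simp
  then show ?thesis unfolding n by (intro sum.neutral) auto
qed

text \<open>Fraction-free elimination: y is the pivot for coordinate k, and 2 by 2 minors are the
  coefficients of the smaller system.\<close>

lemma integer_kernel:
  fixes c :: "'a \<Rightarrow> nat \<Rightarrow> int"
  assumes "finite S" "k < card S"
  shows "\<exists>n. (\<exists>x\<in>S. n x \<noteq> 0) \<and> (\<forall>i<k. (\<Sum>x\<in>S. n x * c x i) = 0)"
  using assms
proof (induction k arbitrary: S c)
  case 0
  then show ?case by (intro exI[of _ "\<lambda>_. 1"]) (auto simp: card_gt_0_iff)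
next
  case (Suc k)
  show ?case
  proof (cases "\<forall>x\<in>S. c x k = 0")
    case True
    obtain n where "\<exists>x\<in>S. n x \<noteq> 0" "\<forall>i<k. (\<Sum>x\<in>S. n x * c x i) = 0" using Suc.IH[of S c] Suc.prems by auto
    then show ?thesis using True by (intro exI[of _ n]) (auto simp: less_Suc_eq)
  next
    case False
    then obtain y where y: "y \<in> S" "c y k \<noteq> 0" by blast
    obtain n where n: "\<exists>x\<in>S - {y}. n x \<noteq> 0"
        "\<And>i. i < k \<Longrightarrow> (\<Sum>x\<in>S - {y}. n x * (c y k * c x i - c x k * c y i)) = 0"
    proof -
      have "finite (S - {y})" "k < card (S - {y})" using Suc.prems y(1) by auto
      from Suc.IH[OF this, of "\<lambda>x i. c y k * c x i - c x k * c y i"] that show thesis by blast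
    qed
    define m where "m x = (if x = y then - (\<Sum>x\<in>S - {y}. n x * c x k) else n x * c y k)" for x
    have "(\<Sum>x\<in>S. m x * c x i) = 0" if i: "i < Suc k" for i
    proof -
      have "(\<Sum>x\<in>S. m x * c x i) = m y * c y i + (\<Sum>x\<in>S - {y}. m x * c x i)"
        using Suc.prems(1) y(1) by (rule sum.remove)
      also have "(\<Sum>x\<in>S - {y}. m x * c x i) = (\<Sum>x\<in>S - {y}. n x * c y k * c x i)"
        by (rule sum.cong) (auto simp: m_def)
      also have "m y * c y i = (\<Sum>x\<in>S - {y}. - (n x * c x k * c y i))"
        by (simp add: m_def sum_distrib_right sum_negf)
      also have "\<dots> + (\<Sum>x\<in>S - {y}. n x * c y k * c x i)
          = (\<Sum>x\<in>S - {y}. n x * (c y k * c x i - c x k * c y i))"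
        unfolding sum.distrib[symmetric] by (rule sum.cong) (simp_all add: algebra_simps)
      also have "\<dots> = 0" using n(2) i by (cases "i = k") (auto simp: less_Suc_eq)
      finally show ?thesis .
    qed
    moreover have "\<exists>x\<in>S. m x \<noteq> 0" using n(1) y(2) by (auto simp: m_def)
    ultimately show ?thesis by blast
  qed
qed

text \<open>Structures in bijection with \<open>mw\<close>; the locale is interpreted for
  \<open>E4 UNIV\<close> and for \<open>L4\<close>, so torsion, independence and rank are computed
  once.\<close>

locale mw_model =
  fixes H :: "('a, 'b) monoid_scheme" (structure) and h :: "'a \<Rightarrow> mw"
  assumes bij: "bij_betw h (carrier H) UNIV"
    and one_H: "\<one>\<^bsub>H\<^esub> \<in> carrier H" "h \<one>\<^bsub>H\<^esub> = 0"
    and mult_H: "\<And>x y. x \<in> carrier H \<Longrightarrow> y \<in> carrier H \<Longrightarrow> x \<otimes>\<^bsub>H\<^esub> y \<in> carrier H"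
      "\<And>x y. x \<in> carrier H \<Longrightarrow> y \<in> carrier H \<Longrightarrow> h (x \<otimes>\<^bsub>H\<^esub> y) = h x + h y"
begin

lemma h_eq: "x \<in> carrier H \<Longrightarrow> y \<in> carrier H \<Longrightarrow> h x = h y \<longleftrightarrow> x = y"
  using bij by (auto simp: bij_betw_def inj_on_def)

lemma h_surj: "\<exists>x\<in>carrier H. h x = z" using bij by (metis UNIV_I bij_betw_def imageE)

sublocale comm_group H
proof (rule comm_groupI)
  fix x y z assume c: "x \<in> carrier H" "y \<in> carrier H" "z \<in> carrier H"
  then show "x \<otimes>\<^bsub>H\<^esub> y \<otimes>\<^bsub>H\<^esub> z = x \<otimes>\<^bsub>H\<^esub> (y \<otimes>\<^bsub>H\<^esub> z)"
    using h_eq[of "x \<otimes>\<^bsub>H\<^esub> y \<otimes>\<^bsub>H\<^esub> z" "x \<otimes>\<^bsub>H\<^esub> (y \<otimes>\<^bsub>H\<^esub> z)"] by (simp add: mult_H add.assoc)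
next
  fix x y assume c: "x \<in> carrier H" "y \<in> carrier H"
  then show "x \<otimes>\<^bsub>H\<^esub> y = y \<otimes>\<^bsub>H\<^esub> x"
    using h_eq[of "x \<otimes>\<^bsub>H\<^esub> y" "y \<otimes>\<^bsub>H\<^esub> x"] by (simp add: mult_H add.commute)
next
  fix x assume c: "x \<in> carrier H"
  show "\<one>\<^bsub>H\<^esub> \<otimes>\<^bsub>H\<^esub> x = x" using c one_H h_eq[of "\<one>\<^bsub>H\<^esub> \<otimes>\<^bsub>H\<^esub> x" x] by (simp add: mult_H)
  obtain y where "y \<in> carrier H" "h y = - h x" using h_surj by blast
  then show "\<exists>y\<in>carrier H. y \<otimes>\<^bsub>H\<^esub> x = \<one>\<^bsub>H\<^esub>"
    using c one_H h_eq[of "y \<otimes>\<^bsub>H\<^esub> x" "\<one>\<^bsub>H\<^esub>"] by (intro bexI[of _ y]) (auto simp: mult_H)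
qed (use one_H mult_H in auto)

lemma h_pow_nat: "x \<in> carrier H \<Longrightarrow> h (x [^] (n::nat)) = nm n (h x)"
  by (induction n) (auto simp: one_H mult_H add.commute)

lemma h_inv: assumes "x \<in> carrier H" shows "h (inv x) = - h x"
proof -
  have "h (inv x) + h x = 0" using mult_H(2)[of "inv x" x] assms one_H by simp
  then show ?thesis by (simp add: eq_neg_iff_add_eq_0)
qed

lemma h_pow: "x \<in> carrier H \<Longrightarrow> h (x [^] (n::int)) = zm n (h x)"
  by (cases n rule: int_cases2) (auto simp: int_pow_int int_pow_neg h_inv h_pow_nat zm_def)

lemma h_finprod:
  assumes "finite S" "f \<in> S \<rightarrow> carrier H"
  shows "h (finprod H f S) = (\<Sum>x\<in>S. h (f x))"
  using assms by (induction S rule: finite_induct) (auto simp: one_H mult_H finprod_closed Pi_def)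

lemma torsion_trivial: "torsion H = {\<one>}"
proof (intro subset_antisym subsetI)
  fix x assume "x \<in> torsion H"
  then obtain n :: nat where n: "x \<in> carrier H" "n > 0" "x [^] n = \<one>" by (auto simp: torsion_def)
  then have "zm (int n) (h x) = 0" using h_pow_nat[of x n] one_H by (simp add: zm_def)
  then have "h x = 0" using mw_torsion_free n(2) by simp
  then show "x \<in> {\<one>}" using h_eq[of x \<one>] n(1) one_H by simp
qed (auto simp: torsion_def intro!: exI[of _ 1])

lemma lin_indep_iff:
  "lin_indep H S \<longleftrightarrow> finite S \<and> S \<subseteq> carrier H \<and>
    (\<forall>n. (\<Sum>x\<in>S. zm (n x) (h x)) = 0 \<longrightarrow> (\<forall>x\<in>S. n x = 0))"
proof -
  have "finprod H (\<lambda>x. x [^] n x) S \<in> torsion H \<longleftrightarrow> (\<Sum>x\<in>S. zm (n x) (h x)) = 0"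
    if S: "finite S" "S \<subseteq> carrier H" for n :: "'a \<Rightarrow> int"
  proof -
    let ?p = "finprod H (\<lambda>x. x [^] n x) S"
    have f: "(\<lambda>x. x [^] n x) \<in> S \<rightarrow> carrier H" using S by auto
    have "?p \<in> torsion H \<longleftrightarrow> h ?p = 0"
      using h_eq[OF finprod_closed[OF f] one_H(1)] one_H by (simp add: torsion_trivial)
    also have "h ?p = (\<Sum>x\<in>S. zm (n x) (h x))"
      unfolding h_finprod[OF S(1) f] using S by (intro sum.cong) (auto simp: h_pow)
    finally show ?thesis .
  qed
  then show ?thesis unfolding lin_indep_def by blast
qed

lemma lin_indep_gl:
  assumes S: "S \<subseteq> carrier H" "h ` S = set gl"
  shows "lin_indep H S" "card S = 6"
proof -
  have i: "inj_on h S" using bij S(1) by (auto simp: bij_betw_def intro: inj_on_subset)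
  have f: "finite S" using S(2) finite_imageD[OF _ i] by simp
  have "card S = card (set gl)" using card_image[OF i] S(2) by simp
  then show "card S = 6" by (simp add: distinct_card[OF distinct_gl])
  have "n x = 0" if n: "(\<Sum>x\<in>S. zm (n x) (h x)) = 0" and x: "x \<in> S" for n x
  proof -
    let ?m = "\<lambda>g. n (inv_into S h g)"
    have "(\<Sum>g\<in>h ` S. zm (?m g) g) = (\<Sum>x\<in>S. zm (n x) (h x))"
      unfolding sum.reindex[OF i] by (rule sum.cong) (auto simp: inv_into_f_f[OF i])
    then have "(\<Sum>i<6. zm (?m (gl ! i)) (gl ! i)) = 0" unfolding S(2) sum_set_gl n .
    moreover obtain j where "j < 6" "h x = gl ! j"
      using x S(2) by (metis image_eqI in_set_conv_nth length_gl)
    ultimately have "?m (h x) = 0" using gl_independent[of "\<lambda>i. ?m (gl ! i)" j] by simp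
    then show ?thesis using x by (simp add: inv_into_f_f[OF i])
  qed
  then show "lin_indep H S" using f S(1) by (auto simp: lin_indep_iff)
qed

lemma card_lin_indep: assumes "lin_indep H S" shows "card S \<le> 6"
proof (rule ccontr)
  assume n: "\<not> card S \<le> 6"
  have S: "finite S" "S \<subseteq> carrier H" using assms by (auto simp: lin_indep_def)
  have "\<forall>x. \<exists>c. h x = (\<Sum>i<6. zm (c i) (gl ! i))" using gl_spans by blast
  then obtain c where c: "\<And>x. h x = (\<Sum>i<6. zm (c x i) (gl ! i))" by metis
  obtain m where m: "\<exists>x\<in>S. m x \<noteq> 0" "\<And>i. i < 6 \<Longrightarrow> (\<Sum>x\<in>S. m x * c x i) = 0"
    using integer_kernel[OF S(1), of 6 c] n by auto
  have z: "zm k (\<Sum>i\<in>A. f i) = (\<Sum>i\<in>A. zm k (f i))" if "finite A" for k and A :: "nat set" and f :: "nat \<Rightarrow> mw"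
    using that by (induction A rule: finite_induct) (auto simp: zm_distrib)
  have z': "(\<Sum>x\<in>S. zm (f x) g) = zm (\<Sum>x\<in>S. f x) g" for f :: "'a \<Rightarrow> int" and g :: mw
    using S(1) by (induction S rule: finite_induct) (auto simp: zm_add)
  have "(\<Sum>x\<in>S. zm (m x) (h x)) = (\<Sum>x\<in>S. \<Sum>i<6. zm (m x * c x i) (gl ! i))"
    unfolding c by (simp add: z zm_mult)
  also have "\<dots> = (\<Sum>i<6. \<Sum>x\<in>S. zm (m x * c x i) (gl ! i))" by (rule sum.swap)
  also have "\<dots> = 0" unfolding z' by (rule sum.neutral) (simp add: m(2))
  finally show False using assms m(1) unfolding lin_indep_iff by blast
qed

lemma rank_6: "ab_rank H = 6"
proof -
  let ?S = "inv_into (carrier H) h ` set gl"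
  have "h ` carrier H = UNIV" using bij by (simp add: bij_betw_def)
  then have S: "?S \<subseteq> carrier H" "h ` ?S = set gl"
    by (auto simp: inv_into_into f_inv_into_f image_image)
  have "ab_rank H \<le> enat 6" unfolding ab_rank_def
    by (rule SUP_least) (simp add: card_lin_indep)
  moreover have "enat 6 \<le> ab_rank H" unfolding ab_rank_def
    using lin_indep_gl[OF S] by (intro SUP_upper2[of ?S]) auto
  ultimately show ?thesis by (simp add: numeral_eq_enat)
qed

end

section \<open>Fields of definition\<close>

definition polys_over :: "complex set \<Rightarrow> complex poly set" where
  "polys_over K = {p. \<forall>n. coeff p n \<in> K}"

lemma polys_over_iff:
  assumes "csub K" shows "p \<in> polys_over K \<longleftrightarrow> set (coeffs p) \<subseteq> K"
proof -
  have "p \<in> polys_over K \<longleftrightarrow> range (coeff p) \<subseteq> K" by (auto simp: polys_over_def)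
  then show ?thesis using csubD(2)[OF assms] by (simp add: range_coeff)
qed

lemma polys_over_closed:
  assumes K: "csub K"
  shows "1 \<in> polys_over K" "p \<in> polys_over K \<Longrightarrow> q \<in> polys_over K \<Longrightarrow> p - q \<in> polys_over K"
    "p \<in> polys_over K \<Longrightarrow> q \<in> polys_over K \<Longrightarrow> p * q \<in> polys_over K"
proof -
  note c = csubD[OF K]
  show "1 \<in> polys_over K" using c by (auto simp: polys_over_def coeff_1)
  show "p \<in> polys_over K \<Longrightarrow> q \<in> polys_over K \<Longrightarrow> p - q \<in> polys_over K"
    using c by (auto simp: polys_over_def)
  have s: "sum f A \<in> K" if "finite A" "\<And>i. i \<in> A \<Longrightarrow> f i \<in> K" for f :: "nat \<Rightarrow> complex" and A
    using that by (induction A rule: finite_induct) (auto intro: c)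
  show "p \<in> polys_over K \<Longrightarrow> q \<in> polys_over K \<Longrightarrow> p * q \<in> polys_over K"
    unfolding polys_over_def mem_Collect_eq coeff_mult by (intro allI s c(5)) auto
qed

lemma ratfuns_over_iff:
  assumes K: "csub K"
  shows "z \<in> ratfuns_over K \<longleftrightarrow>
    (\<exists>p\<in>polys_over K. \<exists>q\<in>polys_over K. q \<noteq> 0 \<and> z = to_fract p / to_fract q)"
  unfolding ratfuns_over_def Fract_one using polys_over_iff[OF K] by auto

lemma ratfuns_over_closed:
  assumes K: "csub K"
  shows "1 \<in> ratfuns_over K" "x \<in> ratfuns_over K \<Longrightarrow> y \<in> ratfuns_over K \<Longrightarrow> x - y \<in> ratfuns_over K"
    "x \<in> ratfuns_over K \<Longrightarrow> y \<in> ratfuns_over K \<Longrightarrow> x / y \<in> ratfuns_over K"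
proof -
  note P = polys_over_closed[OF K]
  have n1: "(1::complex poly) \<noteq> 0" by simp
  show o: "1 \<in> ratfuns_over K" unfolding ratfuns_over_iff[OF K]
    by (intro bexI[of _ 1] P(1)) simp
  have zero: "0 \<in> polys_over K" using P(2)[OF P(1) P(1)] by simp
  assume "x \<in> ratfuns_over K" "y \<in> ratfuns_over K"
  then obtain p q r s where x: "p \<in> polys_over K" "q \<in> polys_over K" "q \<noteq> 0" "x = to_fract p / to_fract q"
    and y: "r \<in> polys_over K" "s \<in> polys_over K" "s \<noteq> 0" "y = to_fract r / to_fract s"
    unfolding ratfuns_over_iff[OF K] by blast
  have "x - y = to_fract (p * s - r * q) / to_fract (q * s)"
    unfolding x(4) y(4) using x(3) y(3) by (simp add: diff_frac_eq)
  then show "x - y \<in> ratfuns_over K"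
    unfolding ratfuns_over_iff[OF K]
    by (intro bexI[of _ "p * s - r * q"] bexI[of _ "q * s"] conjI P x y) (simp add: x y)
  show "x / y \<in> ratfuns_over K"
  proof (cases "r = 0")
    case True
    then have "x / y = to_fract 0 / to_fract 1" using y by simp
    then show ?thesis unfolding ratfuns_over_iff[OF K]
      by (intro bexI[of _ 0] bexI[of _ 1] conjI P(1) zero n1)
  next
    case False
    have "x / y = to_fract (p * s) / to_fract (q * r)"
      using x y by simp
    then show ?thesis unfolding ratfuns_over_iff[OF K]
      by (intro bexI[of _ "p * s"] bexI[of _ "q * r"] conjI P x y) (simp add: x y False)
  qed
qed

lemma ratfuns_over_closed':
  assumes K: "csub K"
  shows "0 \<in> ratfuns_over K" "x \<in> ratfuns_over K \<Longrightarrow> - x \<in> ratfuns_over K"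
    "x \<in> ratfuns_over K \<Longrightarrow> y \<in> ratfuns_over K \<Longrightarrow> x + y \<in> ratfuns_over K"
    "x \<in> ratfuns_over K \<Longrightarrow> y \<in> ratfuns_over K \<Longrightarrow> x * y \<in> ratfuns_over K"
    "x \<in> ratfuns_over K \<Longrightarrow> x ^ n \<in> ratfuns_over K" "numeral k \<in> ratfuns_over K"
proof -
  note c = ratfuns_over_closed[OF K]
  show 0: "0 \<in> ratfuns_over K" using c(2)[OF c(1) c(1)] by simp
  show m: "- x \<in> ratfuns_over K" if "x \<in> ratfuns_over K" for x using c(2)[OF 0 that] by simp
  show a: "x + y \<in> ratfuns_over K" if "x \<in> ratfuns_over K" "y \<in> ratfuns_over K" for x y
    using c(2)[OF that(1) m[OF that(2)]] by simp
  show t: "x * y \<in> ratfuns_over K" if "x \<in> ratfuns_over K" "y \<in> ratfuns_over K" for x y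
    using c(3)[OF that(1) c(3)[OF c(1) that(2)]] by simp
  show "x ^ n \<in> ratfuns_over K" if "x \<in> ratfuns_over K" using that c(1) t by (induction n) auto
  have "of_nat j \<in> ratfuns_over K" for j using 0 c(1) a by (induction j) auto
  from this[of "numeral k"] show "numeral k \<in> ratfuns_over K" by simp
qed

lemma ec_add_over:
  assumes K: "csub K" and P: "set_ec_point P \<subseteq> ratfuns_over K" and Q: "set_ec_point Q \<subseteq> ratfuns_over K"
  shows "set_ec_point (ec_add 0 P Q) \<subseteq> ratfuns_over K" "set_ec_point (ec_neg P) \<subseteq> ratfuns_over K"
proof -
  note c = ratfuns_over_closed[OF K] ratfuns_over_closed'[OF K]
  have l: "set_ec_point (line_point l x1 y1 x2) \<subseteq> ratfuns_over K"
    if "l \<in> ratfuns_over K" "x1 \<in> ratfuns_over K" "y1 \<in> ratfuns_over K" "x2 \<in> ratfuns_over K" for l x1 y1 x2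
    unfolding line_point_def Let_def using that by (auto intro!: c)
  show "set_ec_point (ec_add 0 P Q) \<subseteq> ratfuns_over K"
  proof (cases P; cases Q)
    fix x1 y1 x2 y2 assume e: "P = Pt x1 y1" "Q = Pt x2 y2"
    then have m: "x1 \<in> ratfuns_over K" "y1 \<in> ratfuns_over K" "x2 \<in> ratfuns_over K" "y2 \<in> ratfuns_over K"
      using P Q by auto
    show ?thesis unfolding e ec_add.simps by (simp, intro conjI impI l c m)
  qed (use P Q in auto)
  show "set_ec_point (ec_neg P) \<subseteq> ratfuns_over K" using P by (cases P) (auto intro!: c)
qed

lemma of_poly_over: assumes "csub K" "p \<in> polys_over K" shows "of_poly p \<in> ratfuns_over K"
proof -
  have "of_poly p = to_fract p / to_fract 1" by (simp add: Fract_one)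
  then show ?thesis unfolding ratfuns_over_iff[OF assms(1)]
    using assms(2) polys_over_closed(1)[OF assms(1)] by (metis one_neq_zero)
qed

lemma pCons_over: "csub K \<Longrightarrow> a \<in> K \<Longrightarrow> p \<in> polys_over K \<Longrightarrow> pCons a p \<in> polys_over K"
  "csub K \<Longrightarrow> 0 \<in> polys_over K"
  by (auto simp: polys_over_def coeff_pCons csubD split: nat.split)

lemma csub_UNIV: "csub UNIV" by (simp add: csub_def)

lemma ratfuns_over_UNIV: "ratfuns_over UNIV = UNIV"
proof -
  have "z \<in> ratfuns_over UNIV" for z :: ratfun
  proof (cases z rule: Fract_cases)
    case (Fract p q)
    then show ?thesis unfolding ratfuns_over_iff[OF csub_UNIV] polys_over_def
      by (intro bexI[of _ p] bexI[of _ q]) (simp_all add: to_fract_def)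
  qed
  then show ?thesis by blast
qed

lemma E4_UNIV: "carrier (E4 UNIV) = {P. on_curve 0 b4 P}" by (simp add: E4_def ratfuns_over_UNIV)

lemma points_over_K4: "x \<in> set gl \<Longrightarrow> set_ec_point (Rep_mw x) \<subseteq> ratfuns_over K4"
proof -
  note k = csubD[OF csub_K4] K4_gens K4_consts
  have o: "of_poly p \<in> ratfuns_over K4" if "p \<in> polys_over K4" for p
    by (rule of_poly_over[OF csub_K4 that])
  have "\<forall>P\<in>set [P1, P2, P3, P4, P5, P6]. set_ec_point P \<subseteq> ratfuns_over K4"
    unfolding P1_def P2_def P3_def P4_def P5_def P6_def
    by (auto intro!: o pCons_over csub_K4 k)
  then show "x \<in> set gl \<Longrightarrow> set_ec_point (Rep_mw x) \<subseteq> ratfuns_over K4"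
    unfolding Rep_gl[symmetric] by simp
qed

text \<open>The points defined over \<open>K4\<close> form a subgroup, and the six generators belong
  to it.\<close>

lemma E4_K4: "E4 K4 = E4 UNIV"
proof -
  have "mw_subgroup {x. set_ec_point (Rep_mw x) \<subseteq> ratfuns_over K4}"
    using points_over_K4 ec_add_over[OF csub_K4]
    by (intro mw_subgroupI subsetI) (simp_all add: zero_mw.rep_eq plus_mw.rep_eq uminus_mw.rep_eq)
  then have a: "set_ec_point (Rep_mw x) \<subseteq> ratfuns_over K4" for x
    using mw_subgroup.all_in_subgroup by blast
  have "set_ec_point P \<subseteq> ratfuns_over K4" if "on_curve 0 b4 P" for P
    using a[of "Abs_mw P"] that by (simp add: Abs_mw_inverse)
  then show ?thesis by (auto simp: E4_def ratfuns_over_UNIV)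
qed

text \<open>From r q = p the leading coefficient of r is a quotient of elements of F. This recovers
  constants from a field over which a point is defined.\<close>

lemma lead_coeff_over:
  assumes F: "csub F" and r: "of_poly r \<in> ratfuns_over F"
  shows "lead_coeff r \<in> F"
proof -
  obtain p q where pq: "p \<in> polys_over F" "q \<in> polys_over F" "q \<noteq> 0" "to_fract r = to_fract p / to_fract q"
    using r unfolding ratfuns_over_iff[OF F] Fract_one by blast
  then have "to_fract (r * q) = to_fract p" by simp
  then have "r * q = p" by (simp only: to_fract_eq_iff)
  then have "lead_coeff r * lead_coeff q = lead_coeff p" by (metis lead_coeff_mult)
  then have "lead_coeff r = lead_coeff p / lead_coeff q" using pq(3) by (simp add: field_simps)
  then show ?thesis using pq csubD(8)[OF F] by (auto simp: polys_over_def)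
qed

lemma splitting_field_K4: "is_splitting_field K4"
  unfolding is_splitting_field_def
proof (intro conjI allI impI)
  show "subfield K4 complex_ring" using csub_K4 by (simp add: subfield_iff_csub)
  show "carrier (E4 K4) = carrier (E4 UNIV)" by (simp add: E4_K4)
  fix F assume F: "subfield F complex_ring \<and> carrier (E4 F) = carrier (E4 UNIV)"
  then have s: "csub F" by (simp add: subfield_iff_csub)
  \<comment> \<open>The x-coordinates of \<open>P3\<close> and \<open>P6\<close> have the leading
    coefficients \<open>alpha1\<close> and i times \<open>alpha1\<close>, which already generate
    \<open>K4\<close>.\<close>
  have "P3 \<in> carrier (E4 UNIV)" "P6 \<in> carrier (E4 UNIV)"
    unfolding E4_UNIV using AP_aff[of 1] AP_aff[of \<i>] i_facts(4) by (simp_all add: points on_curve_cases)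
  then have "P3 \<in> carrier (E4 F)" "P6 \<in> carrier (E4 F)" using F by simp_all
  then have "of_poly [:sqrt3 - 1, alpha1:] \<in> ratfuns_over F" "of_poly [:sqrt3 - 1, \<i> * alpha1:] \<in> ratfuns_over F"
    by (simp_all add: E4_def P3_def P6_def)
  then have a: "alpha1 \<in> F" "\<i> * alpha1 \<in> F"
    using lead_coeff_over[OF s] alpha1_ne0 by fastforce+
  then have "\<i> \<in> F" using csubD(8)[OF s a(2,1)] alpha1_ne0 by simp
  then show "K4 \<subseteq> F" using K4_minimal[OF s] a(1) by blast
qed

section \<open>Transfer to the groups of the statement\<close>

interpretation E: mw_model "E4 UNIV" Abs_mw
proof
  show "bij_betw Abs_mw (carrier (E4 UNIV)) UNIV"
    unfolding E4_UNIV by (rule bij_betwI[of _ _ _ Rep_mw]) (use Rep_mw Abs_mw_inverse Rep_mw_inverse in auto)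
qed (auto simp: E4_UNIV, auto simp: E4_def on_curve_add zero_mw.abs_eq plus_mw.abs_eq eq_onp_def on_curve_def[of _ _ PtInf])

text \<open>The torsion subgroup is trivial, so the cosets are singletons and the choice of
  representatives in the pairing is forced.\<close>

lemma L4_simps:
  "carrier L4 = (\<lambda>P. {P}) ` carrier (E4 UNIV)" "one L4 = {PtInf}"
  "P \<in> carrier (E4 UNIV) \<Longrightarrow> Q \<in> carrier (E4 UNIV) \<Longrightarrow> {P} \<otimes>\<^bsub>L4\<^esub> {Q} = {ec_add 0 P Q}"
  "pairing L4 U V = height_pairing (SOME P. P \<in> U) (SOME P. P \<in> V)"
proof -
  have o: "one (E4 UNIV) = PtInf" "P \<otimes>\<^bsub>E4 UNIV\<^esub> Q = ec_add 0 P Q" for P Q by (simp_all add: E4_def)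
  show "carrier L4 = (\<lambda>P. {P}) ` carrier (E4 UNIV)" "one L4 = {PtInf}"
    "{P} \<otimes>\<^bsub>L4\<^esub> {Q} = {ec_add 0 P Q}"
    "pairing L4 U V = height_pairing (SOME P. P \<in> U) (SOME P. P \<in> V)"
    by (auto simp: L4_def Let_def FactGroup_def E.torsion_trivial RCOSETS_def r_coset_def set_mult_def o)
qed

interpretation L: mw_model L4 "\<lambda>U. Abs_mw (SOME P. P \<in> U)"
proof
  have "bij_betw (\<lambda>U. SOME P. P \<in> U) (carrier L4) (carrier (E4 UNIV))"
    by (rule bij_betwI[of _ _ _ "\<lambda>P. {P}"]) (auto simp: L4_simps)
  then show "bij_betw (\<lambda>U. Abs_mw (SOME P. P \<in> U)) (carrier L4) UNIV"
    using bij_betw_trans[OF _ E.bij] unfolding comp_def by blast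
qed (use E.one_H E.mult_H in \<open>auto simp: L4_simps, auto simp: E4_def\<close>)

text \<open>Taking the element of a singleton coset is the isomorphism, and the pairing of
  \<open>L4\<close> is defined through this same choice.\<close>

lemma lattice_iso: "lattice_isomorphic L4 (E4 UNIV)"
  unfolding lattice_isomorphic_def
proof (intro bexI ballI)
  let ?f = "\<lambda>U. SOME P. P \<in> (U :: ratfun ec_point set)"
  show "?f \<in> iso L4 (E4 UNIV)"
  proof (rule isoI)
    show "?f \<in> hom L4 (E4 UNIV)"
      by (rule homI) (auto simp: L4_simps, auto simp: E4_def)
    show "bij_betw ?f (carrier L4) (carrier (E4 UNIV))"
      by (rule bij_betwI[of _ _ _ "\<lambda>P. {P}"]) (auto simp: L4_simps)
  qed
  show "pairing (E4 UNIV) (?f x) (?f y) = pairing L4 x y" for x y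
    by (simp add: L4_simps E4_def)
qed

lemma Ps_generate: "lin_indep_generators (E4 UNIV) [P1, P2, P3, P4, P5, P6]"
proof -
  let ?S = "set [P1, P2, P3, P4, P5, P6]"
  have S: "?S = Rep_mw ` set gl" unfolding Rep_gl[symmetric] by simp
  have d: "distinct [P1, P2, P3, P4, P5, P6]"
    unfolding Rep_gl[symmetric] using distinct_gl by (simp add: distinct_map inj_on_def Rep_mw_inject)
  have c: "?S \<subseteq> carrier (E4 UNIV)" unfolding S E4_UNIV using Rep_mw by auto
  have "Abs_mw ` ?S = set gl" unfolding S by (simp add: image_image Rep_mw_inverse)
  then have l: "lin_indep (E4 UNIV) ?S" using E.lin_indep_gl(1)[OF c] by simp
  let ?G = "generate (E4 UNIV) ?S"
  note sg = E.generate_is_subgroup[OF c]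
  have o: "one (E4 UNIV) = PtInf" "P \<otimes>\<^bsub>E4 UNIV\<^esub> Q = ec_add 0 P Q" for P Q by (simp_all add: E4_def)
  have "mw_subgroup {x. Rep_mw x \<in> ?G}"
  proof (rule mw_subgroupI)
    show "0 \<in> {x. Rep_mw x \<in> ?G}" using subgroup.one_closed[OF sg] by (simp add: zero_mw.rep_eq o)
    show "a + b \<in> {x. Rep_mw x \<in> ?G}" if "a \<in> {x. Rep_mw x \<in> ?G}" "b \<in> {x. Rep_mw x \<in> ?G}" for a b
      using subgroup.m_closed[OF sg] that by (simp add: plus_mw.rep_eq o)
    show "- a \<in> {x. Rep_mw x \<in> ?G}" if "a \<in> {x. Rep_mw x \<in> ?G}" for a
    proof -
      have a: "Rep_mw a \<in> carrier (E4 UNIV)" unfolding E4_UNIV by (rule Rep_mw)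
      have "Abs_mw (inv\<^bsub>E4 UNIV\<^esub> (Rep_mw a)) = - a" using E.h_inv[OF a] by (simp add: Rep_mw_inverse)
      moreover have "on_curve 0 b4 (inv\<^bsub>E4 UNIV\<^esub> (Rep_mw a))" using E.inv_closed[OF a] unfolding E4_UNIV by simp
      ultimately have "Rep_mw (- a) = inv\<^bsub>E4 UNIV\<^esub> (Rep_mw a)" by (metis Abs_mw_inverse mem_Collect_eq)
      then show ?thesis using subgroup.m_inv_closed[OF sg] that by simp
    qed
    show "set gl \<subseteq> {x. Rep_mw x \<in> ?G}" using generate.incl[of _ ?S "E4 UNIV"] unfolding S by auto
  qed
  then have a: "Rep_mw x \<in> ?G" for x using mw_subgroup.all_in_subgroup by blast
  have "carrier (E4 UNIV) \<subseteq> ?G"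
  proof
    fix P assume "P \<in> carrier (E4 UNIV)"
    then show "P \<in> ?G" using a[of "Abs_mw P"] by (simp add: E4_UNIV Abs_mw_inverse)
  qed
  then have "?G = carrier (E4 UNIV)" using E.generate_incl[OF c] by blast
  then show ?thesis using d l by (simp add: lin_indep_generators_def)
qed

theorem theorem1p2:
  shows "\<exists>K4. is_splitting_field K4
    \<and> lattice_isomorphic L4 (E4 K4)
    \<and> ab_rank L4 = 6
    \<and> has_degree_over_rat K4 16
    \<and> defining_min_poly K4 g4
    \<and> generate_field complex_ring (\<rat> \<union> {zeta12, alpha1}) \<subseteq> K4
    \<and> lin_indep_generators (E4 K4) [P1, P2, P3, P4, P5, P6]"
  using splitting_field_K4 lattice_iso L.rank_6 degree_K4 min_poly_K4 generate_field_K4 Ps_generate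
  by (intro exI[of _ K4]) (simp add: E4_K4)

end
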